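(* Let $\mathbb{H}$ be the sub-Finsler Heisenberg group equipped with a $C^1$ and strongly convex norm $\|\cdot\|$ and with the Lebesgue measure $\mathscr{L}^3$. Assume there is $\phi^\star\in\mathsf{Z}$ such that for every $\alpha\ge2$, $$C_\circ'(\phi)=o\big(|\phi-\phi^\star|^{\alpha-2}\big)\qquad\text{as }\phi\to\phi^\star,\ \phi\in\mathsf{D}_1.$$ Then $(\mathbb{H},\mathsf{d},\mathscr{L}^3)$ does not satisfy $\mathsf{MCP}(0,N)$ for any $N\in(1,\infty)$.
   Context: Fix a norm $\|\cdot\|$ on $\mathbb{R}^2$. The sub-Finsler Heisenberg group $\mathbb{H}$ is $\mathbb{R}^3$ with group law $(x,y,z)\star(x',y',z')=(x+x',y+y',z+z'+\tfrac12(xy'-x'y))$, identity $\mathrm{e}=(0,0,0)$, and left-invariant vector fields $X_1=\partial_x-\tfrac{y}{2}\partial_z$, $X_2=\partial_y+\tfrac{x}{2}\partial_z$. A curve $\gamma:[0,1]\to\mathbb{R}^3$ is admissible if it is absolutely continuous and there is $u=(u_1,u_2)\in L^2([0,1];\mathbb{R}^2)$ with $\dot\gamma(t)=u_1(t)X_1(\gamma(t))+u_2(t)X_2(\gamma(t))$ for a.e. $t$; its length is $\int_0^1\|u(t)\|\,dt$. The sub-Finsler distance $\mathsf{d}(p,q)$ is the infimum of the lengths of admissible curves from $p$ to $q$. $\mathscr{L}^3$ denotes Lebesgue measure on $\mathbb{R}^3$. A geodesic in a metric space $(X,\mathsf{d})$ is a curve $\gamma:[0,1]\to X$ with $\mathsf{d}(\gamma(s),\gamma(t))=|t-s|\,\mathsf{d}(\gamma(0),\gamma(1))$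 for all $s,t\in[0,1]$. Regularity/convexity of the norm: with $f(x)=\tfrac12\|x\|^2$, the norm is called $C^1$ (resp. $C^2$) if it is of class $C^1$ (resp. $C^2$) on $\mathbb{R}^2\setminus\{0\}$, $C^{1,1}$ if $f$ is $C^1$ with Lipschitz gradient, strictly convex if $f$ is strictly convex, and strongly convex if there is $\alpha>0$ with $f(tx+(1-t)y)\le tf(x)+(1-t)f(y)-\tfrac{\alpha}{2}t(1-t)\|x-y\|^2$ for all $x,y\in\mathbb{R}^2$, $t\in[0,1]$. Convex trigonometry: let $\Omega=\{x:\|x\|\le1\}$ and $\Omega^\circ=\{p:\langle p,x\rangle\le1\ \forall x\in\Omega\}$ (the closed unit ball of the dual norm). For a compact convex $S\subset\mathbb{R}^2$ with $0$ in its interior, let $\pi_S$ be the area of $S$; for $\theta\in[0,2\pi_S)$ let $P^S_\theta\in\partial S$ be the point such that the region of $S$ swept counterclockwise from the ray through $(1,0)$ to the ray through $P^S_\theta$ has area $\theta/2$; extend $2\pi_S$-periodically and write $P^S_\theta=(\cos_S\theta,\sin_S\theta)$. Angles $\theta$ and $\phi$ correspond if $\cos_\Omega(\theta)\cos_{\Omega^\circ}(\phi)+\sin_\Omega(\theta)\sin_{\Omega^\circ}(\phi)=1$. $C_\circ$ is the nondecreasing (possibly multivalued) map on $\mathbb{R}$ assigning to $\phi$ the maximal closed interval of angles $\theta$ corresponding to $\phi$, normalized so that $C_\circ(\phi+2k\pi_{\Omega^\circ})=C_\circ(\phi)+2k\pi_\Omega$ for $k\in\mathbb{Z}$. For a $C^1$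 strongly convex norm $C_\circ$ is single-valued and Lipschitz; $\mathsf{D}_1$ denotes the set of angles where $C_\circ$ is differentiable, $C_\circ'$ its derivative there, and $\mathsf{Z}=\{\phi\in\mathsf{D}_1: C_\circ'(\phi)=0\}$. Measure contraction property: for $K\in\mathbb{R}$, $N\in(1,\infty)$, $t\in[0,1]$, $\theta\ge0$, let $\sigma^{(t)}_{K,N}(\theta)=+\infty$ if $N\pi^2\le K\theta^2$, $\sigma^{(t)}_{K,N}(\theta)=\sin(t\theta\sqrt{K/N})/\sin(\theta\sqrt{K/N})$ if $0<K\theta^2<N\pi^2$, $\sigma^{(t)}_{K,N}(\theta)=t$ if $K=0$, $\sigma^{(t)}_{K,N}(\theta)=\sinh(t\theta\sqrt{-K/N})/\sinh(\theta\sqrt{-K/N})$ if $K<0$; and $\tau^{(t)}_{K,N}(\theta)=t^{1/N}[\sigma^{(t)}_{K,N-1}(\theta)]^{1-1/N}$. For a metric measure space $(X,\mathsf{d},\mathfrak{m})$, $\mathrm{Geo}(X)$ is the space of geodesics, $e_t(\gamma)=\gamma(t)$, and $W_2$ is the quadratic Wasserstein distance. $(X,\mathsf{d},\mathfrak{m})$ satisfies $\mathsf{MCP}(K,N)$ if for every $x\in\mathrm{spt}\,\mathfrak{m}$ and every Borel $A\subset X$ with $0<\mathfrak{m}(A)<\infty$ there is a probability measure $\eta$ on $\mathrm{Geo}(X)$ such that $((e_t)_\#\eta)_{t\in[0,1]}$ is a $W_2$-geodesic from $\delta_x$ to $\mathfrak{m}|_A/\mathfrak{m}(A)$ and, for every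 $t\in[0,1]$, $\frac{1}{\mathfrak{m}(A)}\mathfrak{m}\ge (e_t)_\#\big(\tau^{(t)}_{K,N}(\mathsf{d}(\gamma(0),\gamma(1)))^N\,\eta(d\gamma)\big)$ as measures. *)

theory Defs
  imports "HOL-Probability.Probability" "HOL-Library.Landau_Symbols"
begin

type_synonym pt2 = "real \<times> real"
type_synonym pt3 = "real \<times> real \<times> real"

definition is_norm2 :: "(pt2 \<Rightarrow> real) \<Rightarrow> bool" where
  "is_norm2 Nrm \<longleftrightarrow>
     (\<forall>x. 0 \<le> Nrm x) \<and> (\<forall>x. Nrm x = 0 \<longleftrightarrow> x = 0) \<and>
     (\<forall>c x. Nrm (c *\<^sub>R x) = \<bar>c\<bar> * Nrm x) \<and>
     (\<forall>x y. Nrm (x + y) \<le> Nrm x + Nrm y)"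

definition C1_norm :: "(pt2 \<Rightarrow> real) \<Rightarrow> bool" where
  "C1_norm Nrm \<longleftrightarrow>
     (\<exists>D :: pt2 \<Rightarrow> pt2. continuous_on (- {0}) D \<and>
        (\<forall>x. x \<noteq> 0 \<longrightarrow> (Nrm has_derivative (\<lambda>h. D x \<bullet> h)) (at x)))"

definition strongly_convex_norm :: "(pt2 \<Rightarrow> real) \<Rightarrow> bool" where
  "strongly_convex_norm Nrm \<longleftrightarrow>
     (let f = (\<lambda>x. (Nrm x)\<^sup>2 / 2) in
      \<exists>\<alpha>>0. \<forall>x y. \<forall>t\<in>{0..1}.
        f (t *\<^sub>R x + (1 - t) *\<^sub>R y)
          \<le> t * f x + (1 - t) * f y - \<alpha> / 2 * t * (1 - t) * (Nrm (x - y))\<^sup>2)"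

definition X1 :: "pt3 \<Rightarrow> pt3" where
  "X1 p = (case p of (x, y, z) \<Rightarrow> (1, 0, - y / 2))"

definition X2 :: "pt3 \<Rightarrow> pt3" where
  "X2 p = (case p of (x, y, z) \<Rightarrow> (0, 1, x / 2))"

definition abs_continuous_on :: "real set \<Rightarrow> (real \<Rightarrow> 'a::metric_space) \<Rightarrow> bool" where
  "abs_continuous_on S f \<longleftrightarrow>
     (\<forall>\<epsilon>>0. \<exists>\<delta>>0. \<forall>(n::nat) (a::nat \<Rightarrow> real) (b::nat \<Rightarrow> real).
        (\<forall>i<n. a i \<le> b i \<and> {a i..b i} \<subseteq> S) \<and>
        (\<forall>i<n. \<forall>j<n. i \<noteq> j \<longrightarrow> b i \<le> a j \<or> b j \<le> a i) \<and>
        (\<Sum>i<n. b i - a i) < \<delta>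
        \<longrightarrow> (\<Sum>i<n. dist (f (a i)) (f (b i))) < \<epsilon>)"

definition admissible :: "(real \<Rightarrow> pt3) \<Rightarrow> (real \<Rightarrow> pt2) \<Rightarrow> bool" where
  "admissible \<gamma> u \<longleftrightarrow>
     abs_continuous_on {0..1} \<gamma> \<and>
     set_borel_measurable lborel {0..1} u \<and>
     set_integrable lborel {0..1} (\<lambda>t. (norm (u t))\<^sup>2) \<and>
     (AE t in lborel. t \<in> {0..1} \<longrightarrow>
        (\<gamma> has_vector_derivative
           (fst (u t) *\<^sub>R X1 (\<gamma> t) + snd (u t) *\<^sub>R X2 (\<gamma> t))) (at t within {0..1}))"

definition sF_length :: "(pt2 \<Rightarrow> real) \<Rightarrow> (real \<Rightarrow> pt2) \<Rightarrow> real" where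
  "sF_length Nrm u = (LINT t:{0..1}|lborel. Nrm (u t))"

definition sF_dist :: "(pt2 \<Rightarrow> real) \<Rightarrow> pt3 \<Rightarrow> pt3 \<Rightarrow> real" where
  "sF_dist Nrm p q =
     Inf {sF_length Nrm u | \<gamma> u. admissible \<gamma> u \<and> \<gamma> 0 = p \<and> \<gamma> 1 = q}"

text \<open>Distortion coefficient sigma, with values in [0,\<infinity>]; for theta = 0 (and K > 0 or K < 0)
  the (limit) value t is used.\<close>
definition sigma_KN :: "real \<Rightarrow> real \<Rightarrow> real \<Rightarrow> real \<Rightarrow> ennreal" where
  "sigma_KN K N t \<theta> =
     (if N * pi\<^sup>2 \<le> K * \<theta>\<^sup>2 then \<infinity>
      else if 0 < K * \<theta>\<^sup>2 then
        ennreal (sin (t * \<theta> * sqrt (K / N)) / sin (\<theta> * sqrt (K / N)))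
      else if K * \<theta>\<^sup>2 < 0 then
        ennreal (sinh (t * \<theta> * sqrt (- K / N)) / sinh (\<theta> * sqrt (- K / N)))
      else ennreal t)"

definition enn_powr :: "ennreal \<Rightarrow> real \<Rightarrow> ennreal" where
  "enn_powr x p = (if x = \<infinity> then \<infinity> else ennreal (enn2real x powr p))"

definition tau_KN :: "real \<Rightarrow> real \<Rightarrow> real \<Rightarrow> real \<Rightarrow> ennreal" where
  "tau_KN K N t \<theta> = ennreal (t powr (1 / N)) * enn_powr (sigma_KN K (N - 1) t \<theta>) (1 - 1 / N)"

definition Geo :: "('a \<Rightarrow> 'a \<Rightarrow> real) \<Rightarrow> 'a measure \<Rightarrow> (real \<Rightarrow> 'a) set" where
  "Geo d m = {\<gamma> \<in> PiE {0..1} (\<lambda>_. space m).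
      \<forall>s\<in>{0..1}. \<forall>t\<in>{0..1}. d (\<gamma> s) (\<gamma> t) = \<bar>t - s\<bar> * d (\<gamma> 0) (\<gamma> 1)}"

definition Geo_space :: "('a \<Rightarrow> 'a \<Rightarrow> real) \<Rightarrow> 'a measure \<Rightarrow> (real \<Rightarrow> 'a) measure" where
  "Geo_space d m = restrict_space (Pi\<^sub>M {0..1} (\<lambda>_. m)) (Geo d m)"

definition couplings :: "'a measure \<Rightarrow> 'a measure \<Rightarrow> 'a measure \<Rightarrow> ('a \<times> 'a) measure set" where
  "couplings m \<mu> \<nu> = {\<pi>. prob_space \<pi> \<and> sets \<pi> = sets (m \<Otimes>\<^sub>M m) \<and>
                          distr \<pi> m fst = \<mu> \<and> distr \<pi> m snd = \<nu>}"

definition W2sq :: "('a \<Rightarrow> 'a \<Rightarrow> real) \<Rightarrow> 'a measure \<Rightarrow> 'a measure \<Rightarrow> 'a measure \<Rightarrow> ennreal" where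
  "W2sq d m \<mu> \<nu> = (INF \<pi>\<in>couplings m \<mu> \<nu>. \<integral>\<^sup>+ p. ennreal ((d (fst p) (snd p))\<^sup>2) \<partial>\<pi>)"

definition msupport :: "('a \<Rightarrow> 'a \<Rightarrow> real) \<Rightarrow> 'a measure \<Rightarrow> 'a set" where
  "msupport d m = {x. \<forall>r>0. emeasure m {y. d x y < r} > 0}"

definition MCP :: "('a \<Rightarrow> 'a \<Rightarrow> real) \<Rightarrow> 'a measure \<Rightarrow> real \<Rightarrow> real \<Rightarrow> bool" where
  "MCP d m K N \<longleftrightarrow>
    (\<forall>x\<in>msupport d m. \<forall>A\<in>sets m. 0 < emeasure m A \<and> emeasure m A < \<infinity> \<longrightarrow>
      (\<exists>\<eta>. prob_space \<eta> \<and> sets \<eta> = sets (Geo_space d m) \<and> space \<eta> = space (Geo_space d m) \<and>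
         distr \<eta> m (\<lambda>\<gamma>. \<gamma> 0) = return m x \<and>
         distr \<eta> m (\<lambda>\<gamma>. \<gamma> 1) = density m (\<lambda>y. indicator A y / emeasure m A) \<and>
         (\<forall>s\<in>{0..1}. \<forall>t\<in>{0..1}.
            W2sq d m (distr \<eta> m (\<lambda>\<gamma>. \<gamma> s)) (distr \<eta> m (\<lambda>\<gamma>. \<gamma> t))
              = ennreal ((t - s)\<^sup>2) * W2sq d m (distr \<eta> m (\<lambda>\<gamma>. \<gamma> 0)) (distr \<eta> m (\<lambda>\<gamma>. \<gamma> 1))) \<and>
         (\<forall>t\<in>{0..1}. \<forall>B\<in>sets m.
            (\<integral>\<^sup>+ \<gamma>. indicator B (\<gamma> t) * enn_powr (tau_KN K N t (d (\<gamma> 0) (\<gamma> 1))) N \<partial>\<eta>)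
              \<le> emeasure m B / emeasure m A)))"

definition ang :: "pt2 \<Rightarrow> real" where
  "ang v = (let a = Arg (Complex (fst v) (snd v)) in if a < 0 then a + 2 * pi else a)"

definition pi_S :: "pt2 set \<Rightarrow> real" where
  "pi_S S = measure lborel S"

definition P_S :: "pt2 set \<Rightarrow> real \<Rightarrow> pt2" where
  "P_S S \<theta> =
     (let \<theta>r = \<theta> - 2 * pi_S S * of_int \<lfloor>\<theta> / (2 * pi_S S)\<rfloor> in
      THE P. P \<in> frontier S \<and> measure lborel {v \<in> S. ang v \<le> ang P} = \<theta>r / 2)"

definition cos_S :: "pt2 set \<Rightarrow> real \<Rightarrow> real" where
  "cos_S S \<theta> = fst (P_S S \<theta>)"

definition sin_S :: "pt2 set \<Rightarrow> real \<Rightarrow> real" where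
  "sin_S S \<theta> = snd (P_S S \<theta>)"

definition Omega :: "(pt2 \<Rightarrow> real) \<Rightarrow> pt2 set" where
  "Omega Nrm = {x. Nrm x \<le> 1}"

definition polar_set :: "pt2 set \<Rightarrow> pt2 set" where
  "polar_set S = {p. \<forall>x\<in>S. p \<bullet> x \<le> 1}"

definition corresponds :: "(pt2 \<Rightarrow> real) \<Rightarrow> real \<Rightarrow> real \<Rightarrow> bool" where
  "corresponds Nrm \<theta> \<phi> \<longleftrightarrow>
     cos_S (Omega Nrm) \<theta> * cos_S (polar_set (Omega Nrm)) \<phi>
       + sin_S (Omega Nrm) \<theta> * sin_S (polar_set (Omega Nrm)) \<phi> = 1"

text \<open>C_circ as a single-valued nondecreasing selection of corresponding angles,
  normalised by 2pi-periodicity (single-valued for C^1 strongly convex norms).\<close>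
definition Ccirc_rel :: "(pt2 \<Rightarrow> real) \<Rightarrow> (real \<Rightarrow> real) \<Rightarrow> bool" where
  "Ccirc_rel Nrm C \<longleftrightarrow> mono C \<and> (\<forall>\<phi>. corresponds Nrm (C \<phi>) \<phi>) \<and>
     (\<forall>\<phi>. \<forall>k::int. C (\<phi> + 2 * of_int k * pi_S (polar_set (Omega Nrm)))
                     = C \<phi> + 2 * of_int k * pi_S (Omega Nrm))"

definition Ccirc :: "(pt2 \<Rightarrow> real) \<Rightarrow> real \<Rightarrow> real" where
  "Ccirc Nrm = (SOME C. Ccirc_rel Nrm C)"

definition D1 :: "(pt2 \<Rightarrow> real) \<Rightarrow> real set" where
  "D1 Nrm = {\<phi>. Ccirc Nrm differentiable (at \<phi>)}"

definition Zset :: "(pt2 \<Rightarrow> real) \<Rightarrow> real set" where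
  "Zset Nrm = {\<phi> \<in> D1 Nrm. deriv (Ccirc Nrm) \<phi> = 0}"

end

theory Submission
  imports Defs
begin

text \<open>
  Let \<open>p\<close> be the covector at the angle \<open>\<phi>s\<close>, \<open>e\<close> the unit vector it selects, and write horizontal
  points as \<open>X e + Y v\<close> with \<open>v\<close> in the kernel of \<open>p\<close>. Near \<open>p\<close> the dual unit sphere is a graph
  \<open>(1 - H s) p + s q\<close>, and \<open>k = H'\<close> is the correspondence of angles read in this chart, so the
  hypothesis makes \<open>k\<close> vanish to infinite order at \<open>0\<close>. With \<open>K' = H\<close>, the functions
  \<open>F l m = X - (K (l + m X) - K l) / m + l Y + m (z + X Y / 2)\<close> have horizontal gradient on the dual
  sphere: they are 1-Lipschitz for the distance, and they measure length exactly along the curves with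
  velocity proportional to \<open>e + k (l + m X) v\<close>. Hence, if \<open>y\<close> is the endpoint of such a curve issued
  from \<open>0\<close>, a \<open>t\<close>-intermediate point \<open>P\<close> of \<open>0\<close> and \<open>y\<close> satisfies
  \<open>F l' m' P \<le> t d(0, y) \<le> F l m P\<close> for all nearby \<open>l', m'\<close>. Moving \<open>l\<close> or \<open>m\<close> by \<open>\<plusminus>t\<close> bounds
  \<open>Y\<close> and \<open>z + X Y / 2\<close> at \<open>P\<close> by \<open>sup |K| / t\<close>, which is \<open>O(t ^ n)\<close> for every \<open>n\<close>. The endpoints with
  parameters \<open>t\<close>-close to \<open>(0, \<mu>, 1)\<close> contain a ball of radius comparable to \<open>t\<close>, so contraction
  towards \<open>0\<close> by the factor \<open>t\<close> shrinks its volume faster than any power of \<open>t\<close>.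
\<close>

text \<open>No uniqueness or regularity of geodesics is assumed: the measure on \<open>Geo\<close>
  may charge any of them, so the estimate is made for every point dividing the distance from 0 to y
  in the ratio t. The lower bound at such a point P holds because \<open>F l m\<close> gains the
  whole distance d between 0 and y and at most (1 - t) d between P and y. The bound by
  \<open>K\<close> is strong because X(P) is itself O(t), so that all arguments of \<open>K\<close>
  are O(t). The obstacle is to reach flatness of \<open>K\<close>: the hypothesis speaks of the
  derivative of \<open>Ccirc\<close> only where it exists, and \<open>Ccirc\<close> is an arbitrary
  choice between angles measured by swept area. Increments are recovered from derivatives by
  Lebesgue differentiation, and swept areas are exchanged for Euclidean polar angles by bi-Lipschitz
  changes of variable, which preserve flatness of every order. The ball of endpoints has volume of
  order t ^ 3, so the set of intermediate points must shrink faster than t ^ (N + 3); flatness of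
  every order excludes all N at once.\<close>

section \<open>Absolutely continuous functions\<close>

lemma abs_continuous_onE:
  assumes "abs_continuous_on S f" "\<epsilon> > 0"
  obtains \<delta> where "\<delta> > 0" "\<And>(n::nat) a b. (\<And>i. i < n \<Longrightarrow> a i \<le> b i \<and> {a i..b i} \<subseteq> S) \<Longrightarrow>
        (\<And>i j. i < n \<Longrightarrow> j < n \<Longrightarrow> i \<noteq> j \<Longrightarrow> b i \<le> a j \<or> b j \<le> a i) \<Longrightarrow>
        (\<Sum>i<n. b i - a i) < \<delta> \<Longrightarrow> (\<Sum>i<n. dist (f (a i)) (f (b i))) < \<epsilon>"
proof -
  obtain \<delta> where "\<delta> > 0" and *: "\<forall>(n::nat) a b. (\<forall>i<n. a i \<le> b i \<and> {a i..b i} \<subseteq> S) \<and>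
        (\<forall>i<n. \<forall>j<n. i \<noteq> j \<longrightarrow> b i \<le> a j \<or> b j \<le> a i) \<and>
        (\<Sum>i<n. b i - a i) < \<delta> \<longrightarrow> (\<Sum>i<n. dist (f (a i)) (f (b i))) < \<epsilon>"
    using assms(1)[unfolded abs_continuous_on_def, rule_format, OF assms(2)] by (elim exE conjE)
  show thesis
    by (rule that[OF \<open>\<delta> > 0\<close>]) (rule *[rule_format], simp)
qed

lemma abs_continuous_on_subset:
  assumes "abs_continuous_on S f" "T \<subseteq> S"
  shows "abs_continuous_on T f"
  unfolding abs_continuous_on_def
proof (intro allI impI)
  fix \<epsilon> :: real assume "\<epsilon> > 0"
  obtain \<delta> where \<delta>: "\<delta> > 0" "\<And>(n::nat) a b. (\<And>i. i < n \<Longrightarrow> a i \<le> b i \<and> {a i..b i} \<subseteq> S) \<Longrightarrow>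
        (\<And>i j. i < n \<Longrightarrow> j < n \<Longrightarrow> i \<noteq> j \<Longrightarrow> b i \<le> a j \<or> b j \<le> a i) \<Longrightarrow>
        (\<Sum>i<n. b i - a i) < \<delta> \<Longrightarrow> (\<Sum>i<n. dist (f (a i)) (f (b i))) < \<epsilon>"
    by (rule abs_continuous_onE[OF assms(1) \<open>\<epsilon> > 0\<close>]) blast
  show "\<exists>\<delta>>0. \<forall>(n::nat) (a::nat \<Rightarrow> real) (b::nat \<Rightarrow> real).
        (\<forall>i<n. a i \<le> b i \<and> {a i..b i} \<subseteq> T) \<and>
        (\<forall>i<n. \<forall>j<n. i \<noteq> j \<longrightarrow> b i \<le> a j \<or> b j \<le> a i) \<and>
        (\<Sum>i<n. b i - a i) < \<delta>
        \<longrightarrow> (\<Sum>i<n. dist (f (a i)) (f (b i))) < \<epsilon>"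
  proof (intro exI[of _ \<delta>] conjI[OF \<delta>(1)] allI impI)
    fix n :: nat and a b :: "nat \<Rightarrow> real"
    assume A: "(\<forall>i<n. a i \<le> b i \<and> {a i..b i} \<subseteq> T) \<and>
        (\<forall>i<n. \<forall>j<n. i \<noteq> j \<longrightarrow> b i \<le> a j \<or> b j \<le> a i) \<and> (\<Sum>i<n. b i - a i) < \<delta>"
    have "a i \<le> b i \<and> {a i..b i} \<subseteq> S" if "i < n" for i
      using A that \<open>T \<subseteq> S\<close> by (meson subset_trans)
    with A show "(\<Sum>i<n. dist (f (a i)) (f (b i))) < \<epsilon>"
      by (intro \<delta>(2)) simp_all
  qed
qed

lemma abs_continuous_on_compose_Lipschitz:
  assumes f: "abs_continuous_on S f"
    and lip: "\<And>s t. s \<in> S \<Longrightarrow> t \<in> S \<Longrightarrow> dist (g s) (g t) \<le> L * dist (f s) (f t)"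
  shows "abs_continuous_on S g"
  unfolding abs_continuous_on_def
proof (intro allI impI)
  fix \<epsilon> :: real assume "\<epsilon> > 0"
  \<comment> \<open>\<open>L\<close> may be zero or negative; \<open>L'\<close> is positive and can
    be divided by.\<close>
  define L' where "L' = \<bar>L\<bar> + 1"
  have "L' > 0" by (simp add: L'_def)
  have lip': "dist (g s) (g t) \<le> L' * dist (f s) (f t)" if "s \<in> S" "t \<in> S" for s t
  proof -
    have "L * dist (f s) (f t) \<le> L' * dist (f s) (f t)"
      by (intro mult_right_mono) (auto simp: L'_def)
    then show ?thesis using lip[OF that] by linarith
  qed
  obtain \<delta> where "\<delta> > 0" and \<delta>: "\<And>(n::nat) a b. (\<And>i. i < n \<Longrightarrow> a i \<le> b i \<and> {a i..b i} \<subseteq> S) \<Longrightarrow>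
        (\<And>i j. i < n \<Longrightarrow> j < n \<Longrightarrow> i \<noteq> j \<Longrightarrow> b i \<le> a j \<or> b j \<le> a i) \<Longrightarrow>
        (\<Sum>i<n. b i - a i) < \<delta> \<Longrightarrow> (\<Sum>i<n. dist (f (a i)) (f (b i))) < \<epsilon> / L'"
    by (rule abs_continuous_onE[OF f divide_pos_pos[OF \<open>\<epsilon> > 0\<close> \<open>L' > 0\<close>]]) blast
  show "\<exists>\<delta>>0. \<forall>(n::nat) (a::nat \<Rightarrow> real) (b::nat \<Rightarrow> real).
        (\<forall>i<n. a i \<le> b i \<and> {a i..b i} \<subseteq> S) \<and>
        (\<forall>i<n. \<forall>j<n. i \<noteq> j \<longrightarrow> b i \<le> a j \<or> b j \<le> a i) \<and>
        (\<Sum>i<n. b i - a i) < \<delta>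
        \<longrightarrow> (\<Sum>i<n. dist (g (a i)) (g (b i))) < \<epsilon>"
  proof (intro exI[of _ \<delta>] conjI allI impI)
    fix n :: nat and a b :: "nat \<Rightarrow> real"
    assume A: "(\<forall>i<n. a i \<le> b i \<and> {a i..b i} \<subseteq> S) \<and>
        (\<forall>i<n. \<forall>j<n. i \<noteq> j \<longrightarrow> b i \<le> a j \<or> b j \<le> a i) \<and> (\<Sum>i<n. b i - a i) < \<delta>"
    have "a i \<in> S \<and> b i \<in> S" if "i < n" for i
    proof -
      have "a i \<le> b i" "{a i..b i} \<subseteq> S" using A that by auto
      then show ?thesis by auto
    qed
    then have "(\<Sum>i<n. dist (g (a i)) (g (b i))) \<le> (\<Sum>i<n. L' * dist (f (a i)) (f (b i)))"
      by (intro sum_mono lip') auto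
    also have "\<dots> = L' * (\<Sum>i<n. dist (f (a i)) (f (b i)))"
      by (simp add: sum_distrib_left)
    also have "\<dots> < L' * (\<epsilon> / L')"
      using \<delta>[of n a b] A \<open>L' > 0\<close> by (intro mult_strict_left_mono) auto
    finally show "(\<Sum>i<n. dist (g (a i)) (g (b i))) < \<epsilon>"
      using \<open>L' > 0\<close> by simp
  qed fact
qed

lemma abs_continuous_on_Lipschitz:
  assumes "\<And>s t. s \<in> S \<Longrightarrow> t \<in> S \<Longrightarrow> dist (g s) (g t) \<le> L * \<bar>s - t\<bar>"
  shows "abs_continuous_on S (g :: real \<Rightarrow> 'a::metric_space)"
proof (rule abs_continuous_on_compose_Lipschitz[where f = "\<lambda>x::real. x" and L = L])
  show "abs_continuous_on S (\<lambda>x::real. x)"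
    unfolding abs_continuous_on_def
  proof (intro allI impI)
    fix \<epsilon> :: real assume "\<epsilon> > 0"
    then show "\<exists>\<delta>>0. \<forall>(n::nat) (a::nat \<Rightarrow> real) (b::nat \<Rightarrow> real).
        (\<forall>i<n. a i \<le> b i \<and> {a i..b i} \<subseteq> S) \<and>
        (\<forall>i<n. \<forall>j<n. i \<noteq> j \<longrightarrow> b i \<le> a j \<or> b j \<le> a i) \<and>
        (\<Sum>i<n. b i - a i) < \<delta>
        \<longrightarrow> (\<Sum>i<n. dist (a i) (b i)) < \<epsilon>"
      by (intro exI[of _ \<epsilon>]) (auto simp: dist_real_def)
  qed
qed (use assms in \<open>auto simp: dist_real_def\<close>)

lemma abs_continuous_on_imp_continuous_on:
  assumes "abs_continuous_on {a..b::real} f"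
  shows "continuous_on {a..b} f"
  unfolding continuous_on_iff
proof (intro ballI allI impI)
  fix x \<epsilon> :: real assume x: "x \<in> {a..b}" and "\<epsilon> > 0"
  obtain \<delta> where "\<delta> > 0" and \<delta>: "\<And>(n::nat) u v. (\<And>i. i < n \<Longrightarrow> u i \<le> v i \<and> {u i..v i} \<subseteq> {a..b}) \<Longrightarrow>
        (\<And>i j. i < n \<Longrightarrow> j < n \<Longrightarrow> i \<noteq> j \<Longrightarrow> v i \<le> u j \<or> v j \<le> u i) \<Longrightarrow>
        (\<Sum>i<n. v i - u i) < \<delta> \<Longrightarrow> (\<Sum>i<n. dist (f (u i)) (f (v i))) < \<epsilon>"
    by (rule abs_continuous_onE[OF assms \<open>\<epsilon> > 0\<close>]) blast
  show "\<exists>d>0. \<forall>x'\<in>{a..b}. dist x' x < d \<longrightarrow> dist (f x') (f x) < \<epsilon>"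
  proof (intro exI[of _ \<delta>] conjI ballI impI)
    fix y assume y: "y \<in> {a..b}" "dist y x < \<delta>"
    have "(\<Sum>i<1::nat. dist (f (min x y)) (f (max x y))) < \<epsilon>"
      using x y by (intro \<delta>) (auto simp: dist_real_def)
    then show "dist (f y) (f x) < \<epsilon>"
      by (cases "x \<le> y") (auto simp: dist_commute)
  qed fact
qed

text \<open>Two of the intervals meet at most in endpoints, so the measure of the union is the sum
  of the lengths.\<close>

lemma sum_lengths_le_measure:
  fixes a b :: "'i \<Rightarrow> real"
  assumes "finite I" and "\<And>i. i \<in> I \<Longrightarrow> a i \<le> b i"
    and disj: "\<And>i j. i \<in> I \<Longrightarrow> j \<in> I \<Longrightarrow> i \<noteq> j \<Longrightarrow> b i \<le> a j \<or> b j \<le> a i"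
    and T: "T \<in> lmeasurable" "\<And>i. i \<in> I \<Longrightarrow> {a i..b i} \<subseteq> T"
  shows "(\<Sum>i\<in>I. b i - a i) \<le> measure lebesgue T"
proof -
  have "(\<Sum>i\<in>I. b i - a i) = (\<Sum>i\<in>I. measure lebesgue {a i..b i})"
    using assms(2) by (intro sum.cong) auto
  also have "\<dots> = measure lebesgue (\<Union>i\<in>I. {a i..b i})"
  proof (rule measure_negligible_finite_Union_image[symmetric])
    show "pairwise (\<lambda>i j. negligible ({a i..b i} \<inter> {a j..b j})) I"
    proof (rule pairwiseI)
      fix i j assume "i \<in> I" "j \<in> I" "i \<noteq> j"
      then have "{a i..b i} \<inter> {a j..b j} \<subseteq> {b i, b j}"
        using disj[of i j] by auto
      then show "negligible ({a i..b i} \<inter> {a j..b j})"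
        by (meson finite.emptyI finite.insertI finite_subset negligible_finite)
    qed
  qed (use assms in auto)
  also have "\<dots> \<le> measure lebesgue T"
    using T assms(1) by (intro measure_mono_fmeasurable UN_least sets.finite_UN) auto
  finally show ?thesis .
qed

text \<open>A gauge argument: intervals tagged in the exceptional set are forced into an open set of small
  measure, where absolute continuity bounds the total variation.\<close>

proposition abs_continuous_on_diff_le_integral:
  fixes f :: "real \<Rightarrow> real"
  assumes "a \<le> b" and ac: "abs_continuous_on {a..b} f" and "negligible S"
    and der: "\<And>x. x \<in> {a..b} - S \<Longrightarrow>
                \<exists>D. (f has_real_derivative D) (at x within {a..b}) \<and> D \<le> w x"
    and w: "(w has_integral I) {a..b}"
  shows "f b - f a \<le> I"
proof (rule field_le_epsilon)
  fix e0 :: real assume "e0 > 0"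
  \<comment> \<open>The error budget: \<open>e\<close> for the Riemann sum, \<open>e\<close> for the
    intervals tagged in \<open>S\<close>, and \<open>e * (b - a)\<close> for the derivative estimate
    at the remaining tags.\<close>
  define e where "e = e0 / (b - a + 2)"
  have "e > 0" using \<open>e0 > 0\<close> \<open>a \<le> b\<close> by (simp add: e_def)
  \<comment> \<open>The derivative bound says nothing on \<open>S\<close>. With \<open>w'\<close>
    zero there, those tags drop out of the Riemann sum and only the variation of \<open>f\<close>
    over their intervals remains.\<close>
  define w' where "w' x = (if x \<in> S then 0 else w x)" for x
  have "(w' has_integral I) {a..b}"
    by (rule has_integral_spike[OF \<open>negligible S\<close> _ w]) (auto simp: w'_def)
  then obtain \<gamma> where \<gamma>: "gauge \<gamma>" "\<And>D. D tagged_division_of {a..b} \<Longrightarrow> \<gamma> fine D \<Longrightarrow>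
        norm ((\<Sum>(x,k)\<in>D. measure lborel k *\<^sub>R w' x) - I) < e"
    using \<open>e > 0\<close> unfolding has_integral_real by meson
  obtain \<delta> where "\<delta> > 0" and \<delta>: "\<And>(n::nat) u v. (\<And>i. i < n \<Longrightarrow> u i \<le> v i \<and> {u i..v i} \<subseteq> {a..b}) \<Longrightarrow>
        (\<And>i j. i < n \<Longrightarrow> j < n \<Longrightarrow> i \<noteq> j \<Longrightarrow> v i \<le> u j \<or> v j \<le> u i) \<Longrightarrow>
        (\<Sum>i<n. v i - u i) < \<delta> \<Longrightarrow> (\<Sum>i<n. dist (f (u i)) (f (v i))) < e"
    by (rule abs_continuous_onE[OF ac \<open>e > 0\<close>]) blast
  obtain T where T: "open T" "S \<subseteq> T" "T - S \<in> lmeasurable" "emeasure lebesgue (T - S) < ennreal \<delta>"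
    using sets_lebesgue_outer_open[OF _ \<open>\<delta> > 0\<close>] \<open>negligible S\<close>
    by (meson negligible_imp_sets)
  have S0: "S \<in> lmeasurable" "measure lebesgue S = 0"
    using \<open>negligible S\<close> negligible_iff_measure by auto
  have Tm: "T \<in> lmeasurable"
    using T(2,3) S0(1) fmeasurable.Un[of "T - S" lebesgue S]
    by (metis Un_Diff_cancel2 sup.absorb1)
  have "measure lebesgue T \<le> measure lebesgue (T - S) + measure lebesgue S"
    using measure_Un_le[of "T - S" lebesgue S] T S0
    by (metis Un_Diff_cancel2 fmeasurableD sup.absorb1)
  also have "\<dots> < \<delta>"
    using T(3,4) S0 \<open>\<delta> > 0\<close> by (simp add: emeasure_eq_measure2 ennreal_less_iff)
  finally have mT: "measure lebesgue T < \<delta>" .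
  have "\<exists>r>0. \<forall>y\<in>{a..b}. \<bar>y - x\<bar> < r \<longrightarrow> (x \<le> y \<longrightarrow> f y - f x \<le> (w x + e) * (y - x)) \<and>
        (y \<le> x \<longrightarrow> f x - f y \<le> (w x + e) * (x - y))" if "x \<in> {a..b} - S" for x
  proof -
    obtain D where D: "(f has_real_derivative D) (at x within {a..b})" "D \<le> w x"
      using der[OF \<open>x \<in> {a..b} - S\<close>] by blast
    then have "(f has_derivative (\<lambda>h. h * D)) (at x within {a..b})"
      by (simp add: has_field_derivative_def mult_commute_abs)
    then obtain r where r: "r > 0" "\<And>y. y \<in> {a..b} \<Longrightarrow> norm (y - x) < r \<Longrightarrow>
        norm (f y - f x - (y - x) * D) \<le> e * norm (y - x)"
      using \<open>e > 0\<close> unfolding has_derivative_within_alt by metis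
    show ?thesis
    proof (intro exI[of _ r] conjI ballI impI)
      fix y assume y: "y \<in> {a..b}" "\<bar>y - x\<bar> < r"
      note * = r(2)[of y] y
      { assume "x \<le> y"
        then have "f y - f x \<le> (D + e) * (y - x)" using * by (simp add: algebra_simps)
        also have "\<dots> \<le> (w x + e) * (y - x)" using D \<open>x \<le> y\<close> by (intro mult_right_mono) auto
        finally show "f y - f x \<le> (w x + e) * (y - x)" . }
      { assume "y \<le> x"
        then have "f x - f y \<le> (D + e) * (x - y)" using * by (simp add: algebra_simps)
        also have "\<dots> \<le> (w x + e) * (x - y)" using D \<open>y \<le> x\<close> by (intro mult_right_mono) auto
        finally show "f x - f y \<le> (w x + e) * (x - y)" . }
    qed fact
  qed
  then obtain r where r: "\<And>x. x \<in> {a..b} - S \<Longrightarrow> r x > 0"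
    "\<And>x y. x \<in> {a..b} - S \<Longrightarrow> y \<in> {a..b} \<Longrightarrow> \<bar>y - x\<bar> < r x \<Longrightarrow> x \<le> y \<Longrightarrow> f y - f x \<le> (w x + e) * (y - x)"
    "\<And>x y. x \<in> {a..b} - S \<Longrightarrow> y \<in> {a..b} \<Longrightarrow> \<bar>y - x\<bar> < r x \<Longrightarrow> y \<le> x \<Longrightarrow> f x - f y \<le> (w x + e) * (x - y)"
    by metis
  define g where "g x = \<gamma> x \<inter> (if x \<in> S then T else if x \<in> {a..b} then ball x (r x) else UNIV)" for x
  have "gauge g"
    unfolding gauge_def g_def using \<gamma>(1) T(1,2) r(1) by (auto simp: open_Int)
  then obtain p where p: "p tagged_division_of {a..b}" "g fine p"
    using fine_division_exists_real by metis
  have pf: "\<gamma> fine p" using p(2) unfolding fine_def g_def by blast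
  note pD = tagged_division_ofD[OF p(1)]
  have K: "\<exists>u v. K = {u..v} \<and> u \<le> v \<and> Inf K = u \<and> Sup K = v \<and> measure lborel K = v - u \<and> x \<in> {u..v} \<and> {u..v} \<subseteq> {a..b}"
    if "(x, K) \<in> p" for x K
  proof -
    obtain u v where "K = cbox u v" using pD(4)[OF \<open>(x, K) \<in> p\<close>] by blast
    then show ?thesis using pD(2)[OF that] pD(3)[OF that] by auto
  qed
  \<comment> \<open>Degenerate intervals are left out: they contribute no variation, and disjoint
    interiors would not keep them from lying inside another interval.\<close>
  define q where "q = {(x,K) \<in> p. x \<in> S \<and> Inf K < Sup K}"
  have "finite q" using pD(1) unfolding q_def by (rule rev_finite_subset) auto
  define lo hi where "lo z = Inf (snd z)" and "hi z = Sup (snd z)" for z :: "real \<times> real set"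
  have qK: "lo z \<le> hi z" "lo z < hi z" "{lo z..hi z} \<subseteq> {a..b}" "{lo z..hi z} \<subseteq> T" "snd z = {lo z..hi z}"
    if "z \<in> q" for z
  proof -
    obtain x K' where z: "z = (x, K')" by (cases z)
    have in_p: "(x, K') \<in> p" "x \<in> S" "Inf K' < Sup K'" using that z by (auto simp: q_def)
    obtain u v where uv: "K' = {u..v}" "u \<le> v" "Inf K' = u" "Sup K' = v" "{u..v} \<subseteq> {a..b}"
      using K[OF in_p(1)] by blast
    have "K' \<subseteq> T" using p(2) in_p unfolding fine_def g_def by fastforce
    with uv in_p z show "lo z \<le> hi z" "lo z < hi z" "{lo z..hi z} \<subseteq> {a..b}" "{lo z..hi z} \<subseteq> T" "snd z = {lo z..hi z}"
      by (auto simp: lo_def hi_def)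
  qed
  have qdisj: "hi y \<le> lo z \<or> hi z \<le> lo y" if "y \<in> q" "z \<in> q" "y \<noteq> z" for y z
  proof -
    have "interior (snd y) \<inter> interior (snd z) = {}"
      using pD(5)[of "fst y" "snd y" "fst z" "snd z"] that by (auto simp: q_def)
    then have "{lo y<..<hi y} \<inter> {lo z<..<hi z} = {}"
      using qK(5)[OF that(1)] qK(5)[OF that(2)] by simp
    moreover have "(max (lo y) (lo z) + min (hi y) (hi z)) / 2 \<in> {lo y<..<hi y} \<inter> {lo z<..<hi z}"
      if "\<not> ?thesis" using that qK(2)[OF \<open>y \<in> q\<close>] qK(2)[OF \<open>z \<in> q\<close>] by (auto simp: max_def min_def field_simps)
    ultimately show ?thesis by blast
  qed
  have "(\<Sum>z\<in>q. hi z - lo z) \<le> measure lebesgue T"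
    using \<open>finite q\<close> qK qdisj Tm by (intro sum_lengths_le_measure) auto
  then have qs: "(\<Sum>z\<in>q. hi z - lo z) < \<delta>" using mT by linarith
  obtain en where en: "bij_betw en {..<card q} q"
    using \<open>finite q\<close> by (metis atLeast0LessThan ex_bij_betw_nat_finite)
  have bad: "(\<Sum>z\<in>q. dist (f (lo z)) (f (hi z))) < e"
  proof -
    have "(\<Sum>i<card q. dist (f (lo (en i))) (f (hi (en i)))) < e"
    proof (rule \<delta>)
      show "lo (en i) \<le> hi (en i) \<and> {lo (en i)..hi (en i)} \<subseteq> {a..b}" if "i < card q" for i
        using en qK[of "en i"] that by (auto simp: bij_betw_def)
      show "hi (en i) \<le> lo (en j) \<or> hi (en j) \<le> lo (en i)" if "i < card q" "j < card q" "i \<noteq> j" for i j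
        using en qdisj[of "en i" "en j"] that by (auto simp: bij_betw_def inj_on_def)
      show "(\<Sum>i<card q. hi (en i) - lo (en i)) < \<delta>"
        using qs sum.reindex_bij_betw[OF en, of "\<lambda>z. hi z - lo z"] by simp
    qed
    then show ?thesis
      using sum.reindex_bij_betw[OF en, of "\<lambda>z. dist (f (lo z)) (f (hi z))"] by simp
  qed
  have each: "f (hi z) - f (lo z) \<le> measure lborel (snd z) * w' (fst z) + e * (hi z - lo z)
        + (if z \<in> q then dist (f (lo z)) (f (hi z)) else 0)" if "z \<in> p" for z
  proof -
    obtain x K' where z: "z = (x, K')" by (cases z)
    obtain u v where uv: "K' = {u..v}" "u \<le> v" "Inf K' = u" "Sup K' = v" "measure lborel K' = v - u" "x \<in> {u..v}" "{u..v} \<subseteq> {a..b}"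
      using K[of x K'] \<open>z \<in> p\<close> z by blast
    have lh: "lo z = u" "hi z = v" using z uv by (auto simp: lo_def hi_def)
    show ?thesis
    proof (cases "x \<in> S")
      case True
      then have w0: "w' (fst z) = 0" using z by (simp add: w'_def)
      show ?thesis
      proof (cases "u < v")
        case True
        then have "z \<in> q" using \<open>x \<in> S\<close> z uv that by (auto simp: q_def)
        then show ?thesis using w0 lh \<open>e > 0\<close> uv(2)
          by (simp add: dist_real_def) (smt (verit) mult_nonneg_nonneg)
      next
        case False
        then have "u = v" using uv by auto
        then show ?thesis using w0 lh by simp
      qed
    next
      case False
      then have "z \<notin> q" using z by (auto simp: q_def)
      have xg: "x \<in> {a..b} - S" using False uv by auto
      have "K' \<subseteq> g x" using p(2) that z unfolding fine_def by blast
      then have "K' \<subseteq> ball x (r x)" using xg by (simp add: g_def)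
      moreover have "u \<in> K'" "v \<in> K'" using uv by auto
      ultimately have "u \<in> ball x (r x)" "v \<in> ball x (r x)" by blast+
      then have "\<bar>u - x\<bar> < r x" "\<bar>v - x\<bar> < r x" by (auto simp: dist_real_def)
      then have "f v - f x \<le> (w x + e) * (v - x)" "f x - f u \<le> (w x + e) * (x - u)"
        using r(2)[OF xg, of v] r(3)[OF xg, of u] uv by auto
      then have "f v - f u \<le> (w x + e) * (v - u)" by (simp add: algebra_simps)
      then show ?thesis using \<open>z \<notin> q\<close> z lh uv False by (simp add: w'_def algebra_simps)
    qed
  qed
  have tele: "(\<Sum>z\<in>p. F (hi z) - F (lo z)) = F b - F a" for F :: "real \<Rightarrow> real"
    using additive_tagged_division_1[OF \<open>a \<le> b\<close> p(1), of F] by (simp add: case_prod_beta lo_def hi_def)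
  have "f b - f a = (\<Sum>z\<in>p. f (hi z) - f (lo z))" by (simp add: tele)
  also have "\<dots> \<le> (\<Sum>z\<in>p. measure lborel (snd z) * w' (fst z) + e * (hi z - lo z)
        + (if z \<in> q then dist (f (lo z)) (f (hi z)) else 0))"
    by (intro sum_mono each)
  also have "\<dots> = (\<Sum>z\<in>p. measure lborel (snd z) * w' (fst z)) + e * (b - a) + (\<Sum>z\<in>q. dist (f (lo z)) (f (hi z)))"
  proof -
    have "(\<Sum>z\<in>p. e * (hi z - lo z)) = e * (b - a)"
      using tele[of "\<lambda>x. x"] by (simp add: sum_distrib_left[symmetric])
    moreover have "(\<Sum>z\<in>p. if z \<in> q then dist (f (lo z)) (f (hi z)) else 0) = (\<Sum>z\<in>q. dist (f (lo z)) (f (hi z)))"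
      using pD(1) by (subst sum.mono_neutral_cong_left[of p q]) (auto simp: q_def)
    ultimately show ?thesis by (simp add: sum.distrib)
  qed
  also have "\<dots> \<le> (I + e) + e * (b - a) + e"
    using \<gamma>(2)[OF p(1) pf] bad by (auto simp: case_prod_beta abs_less_iff)
  also have "\<dots> = I + e0"
  proof -
    have "e * (b - a + 2) = e0" using \<open>a \<le> b\<close> by (simp add: e_def)
    then show ?thesis by (simp add: algebra_simps)
  qed
  finally show "f b - f a \<le> I + e0" .
qed

section \<open>Lipschitz homeomorphisms of the line\<close>

text \<open>The density is the Radon--Nikodym derivative of the image of Lebesgue measure under \<open>inv F\<close>;
  local Lipschitz continuity of \<open>F\<close> is what makes that image absolutely continuous.\<close>

lemma has_integral_RN_increasing:
  fixes F :: "real \<Rightarrow> real"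
  assumes mono: "strict_mono F" and cont: "continuous_on UNIV F" and surj: "surj F"
    and lip: "\<And>x. \<exists>T B. open T \<and> x \<in> T \<and> (\<forall>y\<in>T. \<bar>F y - F x\<bar> \<le> B * \<bar>y - x\<bar>)"
  shows "\<exists>r. \<forall>x y. x \<le> y \<longrightarrow> (r has_integral (F y - F x)) {x..y}"
proof -
  define G where "G = inv F"
  have FG[simp]: "F (G y) = y" for y using surj by (simp add: G_def surj_f_inv_f)
  have GF[simp]: "G (F x) = x" for x using mono by (simp add: G_def strict_mono_imp_inj_on)
  have Fle: "F x \<le> F y \<longleftrightarrow> x \<le> y" for x y using mono strict_mono_less_eq by blast
  have Gle: "x \<le> G y \<longleftrightarrow> F x \<le> y" "G y \<le> x \<longleftrightarrow> y \<le> F x" for x y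
    using Fle[of x "G y"] Fle[of "G y" x] by simp_all
  have "mono G" by (rule monoI) (simp add: Gle)
  then have [measurable]: "G \<in> borel_measurable borel" by (rule borel_measurable_mono)
  define M1 where "M1 = distr lborel borel G"
  have M1int: "emeasure M1 {x..y} = ennreal (F y - F x)" if "x \<le> y" for x y
  proof -
    have "G -` {x..y} = {F x..F y}" by (auto simp: Gle)
    then show ?thesis using Fle[of x y] that by (simp add: M1_def emeasure_distr)
  qed
  have "absolutely_continuous lborel M1"
    unfolding absolutely_continuous_def
  proof
    fix A :: "real set" assume A: "A \<in> null_sets lborel"
    then have "negligible A" by (simp add: negligible_iff_null_sets null_sets_completion_iff null_sets_completionI)
    then have "negligible (F ` A)"
    proof (rule negligible_locally_Lipschitz_image[rotated])
      fix x
      obtain T B where "open T" "x \<in> T" "\<forall>y\<in>T. \<bar>F y - F x\<bar> \<le> B * \<bar>y - x\<bar>" using lip[of x] by blast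
      then show "\<exists>T B. open T \<and> x \<in> T \<and> (\<forall>y\<in>A \<inter> T. norm (F y - F x) \<le> B * norm (y - x))"
        by (intro exI[of _ T] exI[of _ B]) auto
    qed simp
    moreover have "F ` A = G -` A" by (auto simp: image_iff) (metis FG)
    moreover have "A \<in> sets borel" using A by auto
    then have "G -` A \<in> sets borel"
      by (metis \<open>G \<in> borel_measurable borel\<close> measurable_sets_borel)
    ultimately have "G -` A \<in> null_sets lborel"
      by (simp add: negligible_iff_null_sets null_sets_completion_iff)
    then have "emeasure lborel (G -` A) = 0" by auto
    then show "A \<in> null_sets M1"
      using \<open>A \<in> sets borel\<close> by (auto simp: M1_def null_sets_def emeasure_distr)
  qed
  moreover have "sets M1 = sets lborel" by (simp add: M1_def)
  ultimately obtain \<rho> where \<rho>: "\<rho> \<in> borel_measurable lborel" "density lborel \<rho> = M1"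
    using sigma_finite_measure.Radon_Nikodym[OF sigma_finite_lborel] by blast
  note [measurable] = \<rho>(1)
  have \<rho>int: "(\<integral>\<^sup>+ t. \<rho> t * indicator {x..y} t \<partial>lborel) = ennreal (F y - F x)" if "x \<le> y" for x y
    using emeasure_density[of \<rho> lborel "{x..y}"] \<rho> M1int[OF that] by simp
  have "((\<lambda>t. enn2real (\<rho> t)) has_integral (F y - F x)) {x..y}" if "x \<le> y" for x y
  proof -
    have "AE t in lborel. \<rho> t * indicator {x..y} t \<noteq> \<infinity>"
      by (rule nn_integral_noteq_infinite) (use \<rho>int[OF that] in auto)
    then have "AE t in lborel. ennreal (enn2real (\<rho> t) * indicator {x..y} t) = \<rho> t * indicator {x..y} t"
      by eventually_elim (auto simp: indicator_def less_top)
    then have "(\<integral>\<^sup>+ t. ennreal (enn2real (\<rho> t) * indicator {x..y} t) \<partial>lborel) = ennreal (F y - F x)"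
      using \<rho>int[OF that] by (simp cong: nn_integral_cong_AE)
    then have "((\<lambda>t. enn2real (\<rho> t) * indicator {x..y} t) has_integral (F y - F x)) UNIV"
      using Fle[of x y] that by (intro nn_integral_has_integral) auto
    moreover have "(\<lambda>t. enn2real (\<rho> t) * indicator {x..y} t) = (\<lambda>t. if t \<in> {x..y} then enn2real (\<rho> t) else 0)"
      by auto
    ultimately show ?thesis by (simp only: has_integral_restrict_UNIV)
  qed
  then show ?thesis by blast
qed

text \<open>The increments of \<open>F\<close> are integrals of a density which, by Lebesgue
  differentiation, is the derivative of \<open>F\<close> almost everywhere; hence it is at most
  \<open>M\<close> off a null set. Monotonicity alone would not do, as singular functions show:
  \<open>lip\<close> is what excludes them.\<close>

proposition diff_le_of_deriv_le:
  fixes F :: "real \<Rightarrow> real"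
  assumes mono: "strict_mono F" and cont: "continuous_on UNIV F" and surj: "surj F"
    and lip: "\<And>x. \<exists>T B. open T \<and> x \<in> T \<and> (\<forall>y\<in>T. \<bar>F y - F x\<bar> \<le> B * \<bar>y - x\<bar>)"
    and M: "\<And>x. a < x \<Longrightarrow> x < b \<Longrightarrow> F differentiable (at x) \<Longrightarrow> deriv F x \<le> M"
    and "a \<le> b"
  shows "F b - F a \<le> M * (b - a)"
proof -
  obtain r where "\<forall>x y. x \<le> y \<longrightarrow> (r has_integral (F y - F x)) {x..y}"
    using has_integral_RN_increasing[OF mono cont surj lip] by (elim exE)
  then have r: "\<And>x y. x \<le> y \<Longrightarrow> (r has_integral (F y - F x)) {x..y}"
    by simp
  have ri: "r integrable_on cbox x y" for x y
    using r[of x y] by (cases "x \<le> y") (auto simp: integrable_on_def)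
  obtain N1 where N1: "negligible N1" "\<And>x e. \<lbrakk>x \<notin> N1; 0 < e\<rbrakk> \<Longrightarrow>
     \<exists>d>0. \<forall>h. 0 < h \<and> h < d \<longrightarrow> norm (integral (cbox x (x + h *\<^sub>R One)) r /\<^sub>R h ^ DIM(real) - r x) < e"
    by (rule integrable_ccontinuous_explicit[OF ri], rule that, assumption+)
  \<comment> \<open>Averages over cubes with lower corner \<open>x\<close> only give right
    derivatives; reflecting the density gives the left ones.\<close>
  have r': "((\<lambda>t. r (- t)) has_integral (F (- x) - F (- y))) {x..y}" if "x \<le> y" for x y
  proof -
    have "(r has_integral (F (- x) - F (- y))) {-y..-x}" using r[of "-y" "-x"] that by simp
    then have "((\<lambda>t. r (- t)) has_integral (F (- x) - F (- y))) {-(-x)..-(-y)}"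
      by (simp only: has_integral_reflect_real)
    then show ?thesis by simp
  qed
  have ri': "(\<lambda>t. r (- t)) integrable_on cbox x y" for x y
    using r'[of x y] by (cases "x \<le> y") (auto simp: integrable_on_def)
  obtain N2 where N2: "negligible N2" "\<And>x e. \<lbrakk>x \<notin> N2; 0 < e\<rbrakk> \<Longrightarrow>
     \<exists>d>0. \<forall>h. 0 < h \<and> h < d \<longrightarrow> norm (integral (cbox x (x + h *\<^sub>R One)) (\<lambda>t. r (- t)) /\<^sub>R h ^ DIM(real) - r (- x)) < e"
    by (rule integrable_ccontinuous_explicit[OF ri'], rule that, assumption+)
  \<comment> \<open>The endpoints join the null set because \<open>M\<close> bounds the derivative
    only strictly between them; in \<open>g_flat\<close> one endpoint is the critical angle.\<close>
  define N where "N = N1 \<union> uminus ` N2 \<union> {a, b}"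
  have "negligible (uminus ` N2)"
    by (rule negligible_differentiable_image_negligible) (auto intro!: N2(1) derivative_intros)
  then have "negligible N" unfolding N_def using N1(1) by (auto intro!: negligible_Un)
  have der: "(F has_real_derivative r x) (at x)" if "x \<notin> N" for x
    unfolding DERIV_def
  proof (rule LIM_I)
    fix e :: real assume "e > 0"
    obtain d1 where d1: "d1 > 0" "\<And>h. 0 < h \<Longrightarrow> h < d1 \<Longrightarrow> norm (integral (cbox x (x + h *\<^sub>R One)) r /\<^sub>R h ^ DIM(real) - r x) < e"
      using N1(2)[OF _ \<open>e > 0\<close>, of x] \<open>x \<notin> N\<close> unfolding N_def by auto
    have "- x \<notin> N2"
    proof
      assume "- x \<in> N2"
      then have "- (- x) \<in> uminus ` N2" by (rule imageI)
      then show False using \<open>x \<notin> N\<close> by (simp add: N_def)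
    qed
    then obtain d2 where d2: "d2 > 0" "\<And>h. 0 < h \<Longrightarrow> h < d2 \<Longrightarrow> norm (integral (cbox (-x) (-x + h *\<^sub>R One)) (\<lambda>t. r (- t)) /\<^sub>R h ^ DIM(real) - r (- (- x))) < e"
      using N2(2)[OF _ \<open>e > 0\<close>, of "-x"] by auto
    show "\<exists>s>0. \<forall>h. h \<noteq> 0 \<and> norm (h - 0) < s \<longrightarrow> norm ((F (x + h) - F x) / h - r x) < e"
    proof (intro exI[of _ "min d1 d2"] conjI allI impI)
      fix h :: real assume h: "h \<noteq> 0 \<and> norm (h - 0) < min d1 d2"
      show "norm ((F (x + h) - F x) / h - r x) < e"
      proof (cases "h > 0")
        case True
        then have "integral {x..x+h} r = F (x + h) - F x"
          using r[of x "x+h"] by (simp add: integral_unique)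
        then show ?thesis using d1(2)[of h] h True by (simp add: divide_inverse mult.commute)
      next
        case False
        then have "integral {-x..-x-h} (\<lambda>t. r (- t)) = F x - F (x + h)"
          using r'[of "-x" "-x-h"] by (simp add: integral_unique add.commute)
        then have "norm ((F x - F (x + h)) / (-h) - r x) < e"
          using d2(2)[of "-h"] h False by (simp add: divide_inverse mult.commute)
        then show ?thesis by (simp add: minus_divide_left)
      qed
    qed (use d1 d2 in auto)
  qed
  \<comment> \<open>Replacing the density by \<open>M\<close> on the null set changes no integral
    and makes the bound hold everywhere.\<close>
  define r2 where "r2 x = (if x \<in> N then M else r x)" for x
  have "(r2 has_integral (F b - F a)) {a..b}"
    by (rule has_integral_spike[OF \<open>negligible N\<close> _ r[OF \<open>a \<le> b\<close>]]) (auto simp: r2_def)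
  moreover have "((\<lambda>x. M) has_integral (M * (b - a))) {a..b}"
    using has_integral_const_real[of M a b] \<open>a \<le> b\<close> by (simp add: mult.commute)
  moreover have "r2 x \<le> M" if "x \<in> {a..b}" for x
  proof (cases "x \<in> N")
    case False
    then have "a < x" "x < b" using that by (auto simp: N_def less_le)
    then have "deriv F x \<le> M" using M der[OF False] real_differentiable_def by blast
    then show ?thesis using False DERIV_imp_deriv[OF der[OF False]] by (simp add: r2_def)
  qed (simp add: r2_def)
  ultimately show ?thesis by (rule has_integral_le)
qed

section \<open>Sectors of discs\<close>

definition dirv :: "real \<Rightarrow> pt2" where
  "dirv \<alpha> = (cos \<alpha>, sin \<alpha>)"

definition rot :: "real \<Rightarrow> pt2 \<Rightarrow> pt2" where
  "rot \<theta> v = (cos \<theta> * fst v - sin \<theta> * snd v, sin \<theta> * fst v + cos \<theta> * snd v)"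

lemma norm_dirv [simp]: "norm (dirv \<alpha>) = 1"
  by (simp add: dirv_def norm_Pair)

lemma dirv_nonzero [simp]: "dirv \<alpha> \<noteq> 0"
  using norm_dirv[of \<alpha>] by (metis norm_zero zero_neq_one)

lemma rot_dirv: "rot \<theta> (r *\<^sub>R dirv \<alpha>) = r *\<^sub>R dirv (\<alpha> + \<theta>)"
  by (simp add: rot_def dirv_def cos_add sin_add algebra_simps)

lemma rot_rot: "rot \<theta> (rot \<theta>' v) = rot (\<theta> + \<theta>') v"
  by (simp add: rot_def cos_add sin_add algebra_simps)

lemma rot_0 [simp]: "rot 0 v = v"
  by (simp add: rot_def)

lemma ang_bounds: "0 \<le> ang v" "ang v < 2 * pi"
  using Arg_bounded[of "Complex (fst v) (snd v)"] by (auto simp: ang_def Let_def)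

lemma dirv_ang: "v = norm v *\<^sub>R dirv (ang v)"
proof -
  define z where "z = Complex (fst v) (snd v)"
  have "rcis (cmod z) (Arg z) = z" by (rule rcis_cmod_Arg)
  moreover have "cmod z = norm v" by (cases v) (simp add: z_def cmod_def norm_Pair)
  moreover have "cis (ang v) = cis (Arg z)"
    by (simp add: ang_def z_def[symmetric] Let_def cis_mult[symmetric] flip: cis_2pi)
  ultimately have "complex_of_real (norm v) * cis (ang v) = z" by (simp add: rcis_def)
  then have "norm v * cos (ang v) = fst v" "norm v * sin (ang v) = snd v"
    by (auto simp: z_def complex_eq_iff)
  then show ?thesis by (simp add: dirv_def prod_eq_iff)
qed

lemma ang_0 [simp]: "ang 0 = 0"
  by (simp add: ang_def Complex_eq_0 Arg_zero zero_prod_def Let_def flip: zero_complex.code)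

lemma dirv_eq_iff:
  assumes "\<bar>\<alpha> - \<beta>\<bar> < 2 * pi" "dirv \<alpha> = dirv \<beta>" shows "\<alpha> = \<beta>"
proof -
  have "cos (\<alpha> - \<beta>) = 1" using assms(2) sin_cos_squared_add3[of \<beta>] by (simp add: dirv_def cos_diff)
  then obtain n :: int where n: "\<alpha> - \<beta> = n * 2 * pi" using cos_one_2pi_int by auto
  have "\<bar>real_of_int n\<bar> * (2 * pi) < 1 * (2 * pi)" using assms(1) n by (simp add: abs_mult)
  then have "\<bar>real_of_int n\<bar> < 1" by (simp only: mult_less_cancel_right) simp
  then have "n = 0" by linarith
  then show ?thesis using n by simp
qed

lemma ex_shift_2pi: "\<exists>n::int. \<bar>\<gamma> + 2 * pi * of_int n - b\<bar> \<le> pi"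
proof -
  define n :: int where "n = round ((\<gamma> - b) / (2 * pi))"
  have "\<bar>of_int n - (\<gamma> - b) / (2 * pi)\<bar> \<le> 1/2" unfolding n_def by (rule of_int_round_abs_le)
  then have "\<bar>of_int n - (\<gamma> - b) / (2 * pi)\<bar> * (2 * pi) \<le> 1/2 * (2 * pi)" by (intro mult_right_mono) auto
  moreover have "\<bar>of_int n - (\<gamma> - b) / (2 * pi)\<bar> * (2 * pi) = \<bar>(of_int n - (\<gamma> - b) / (2 * pi)) * (2 * pi)\<bar>"
    by (simp add: abs_mult)
  moreover have "(of_int n - (\<gamma> - b) / (2 * pi)) * (2 * pi) = b - (\<gamma> + 2 * pi * of_int (- n))" by (simp add: field_simps)
  ultimately have "\<bar>\<gamma> + 2 * pi * of_int (- n) - b\<bar> \<le> pi" by (simp add: abs_minus_commute)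
  then show ?thesis by (rule exI)
qed

lemma ang_dirv:
  assumes "r > 0" "0 \<le> \<alpha>" "\<alpha> < 2 * pi" shows "ang (r *\<^sub>R dirv \<alpha>) = \<alpha>"
proof (rule dirv_eq_iff)
  show "\<bar>ang (r *\<^sub>R dirv \<alpha>) - \<alpha>\<bar> < 2 * pi" using ang_bounds[of "r *\<^sub>R dirv \<alpha>"] assms by auto
  have "r *\<^sub>R dirv (ang (r *\<^sub>R dirv \<alpha>)) = r *\<^sub>R dirv \<alpha>"
    using dirv_ang[of "r *\<^sub>R dirv \<alpha>"] assms by simp
  then show "dirv (ang (r *\<^sub>R dirv \<alpha>)) = dirv \<alpha>" using assms by simp
qed

text \<open>\<open>Arg\<close> is continuous off the nonpositive reals, equals \<open>pi\<close> on
  the negative ones, and is 0 at the origin.\<close>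

lemma borel_measurable_ang [measurable]: "ang \<in> borel_measurable borel"
proof -
  have inner: "(\<lambda>z. if z \<in> \<real>\<^sub>\<le>\<^sub>0 then pi else Arg z) \<in> borel_measurable borel"
    by (rule borel_measurable_continuous_on_if) (auto intro!: continuous_on_Arg)
  have "Arg = (\<lambda>z. if z = 0 then 0 else if z \<in> \<real>\<^sub>\<le>\<^sub>0 then pi else Arg z)"
    by (auto simp: fun_eq_iff Arg_zero complex_nonpos_Reals_iff Arg_eq_pi) (metis complex_eq_iff zero_complex.sel less_eq_real_def)
  also have "\<dots> \<in> borel_measurable borel"
    using inner by measurable
  finally have [measurable]: "Arg \<in> borel_measurable borel" .
  have "(\<lambda>v::pt2. Complex (fst v) (snd v)) = (\<lambda>v. complex_of_real (fst v) + \<i> * complex_of_real (snd v))"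
    by (simp add: Complex_eq)
  also have "\<dots> \<in> borel_measurable borel"
    by (intro borel_measurable_continuous_onI continuous_intros)
  finally have [measurable]: "(\<lambda>v::pt2. Complex (fst v) (snd v)) \<in> borel_measurable borel" .
  show ?thesis unfolding ang_def Let_def by measurable
qed

text \<open>On each line parallel to the shear the map is a translation; Fubini adds up the
  lines.\<close>

lemma emeasure_vimage_shear:
  fixes A :: "pt2 set" assumes A: "A \<in> sets borel"
  shows "emeasure lborel ((\<lambda>v. (fst v + a * snd v, snd v)) -` A) = emeasure lborel A"
    and "emeasure lborel ((\<lambda>v. (fst v, snd v + a * fst v)) -` A) = emeasure lborel A"
proof -
  note alt1 = sigma_finite_measure.emeasure_pair_measure_alt[OF sigma_finite_lborel, where N = lborel]
    and alt2 = pair_sigma_finite.emeasure_pair_measure_alt2[OF pair_sigma_finite.intro[OF sigma_finite_lborel sigma_finite_lborel]]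
  have pm: "sets (lborel \<Otimes>\<^sub>M lborel :: pt2 measure) = sets borel" by (metis lborel_prod sets_lborel)
  have tr: "emeasure lborel ((+) c -` B) = emeasure lborel B" if "B \<in> sets borel" for c :: real and B
    using emeasure_distr[of "(+) c" lborel borel B] that by (simp add: lborel_distr_plus)
  have m1: "(\<lambda>v::pt2. (fst v + a * snd v, snd v)) \<in> borel_measurable borel"
    and m2: "(\<lambda>v::pt2. (fst v, snd v + a * fst v)) \<in> borel_measurable borel"
    by (intro borel_measurable_continuous_onI continuous_intros)+
  have A1: "(\<lambda>v. (fst v + a * snd v, snd v)) -` A \<in> sets borel"
    and A2: "(\<lambda>v. (fst v, snd v + a * fst v)) -` A \<in> sets borel"
    using measurable_sets_borel[OF m1 A] measurable_sets_borel[OF m2 A] by auto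
  have s1: "(\<lambda>x. (x, y)) -` A \<in> sets borel" and s2: "Pair x -` A \<in> sets borel" for x y
    by (rule measurable_sets_borel[OF borel_measurable_continuous_onI A]; intro continuous_intros)+
  have "emeasure lborel ((\<lambda>v. (fst v + a * snd v, snd v)) -` A) =
      (\<integral>\<^sup>+y. emeasure lborel ((\<lambda>x. (x, y)) -` ((\<lambda>v. (fst v + a * snd v, snd v)) -` A)) \<partial>lborel)"
    using alt2[of "(\<lambda>v. (fst v + a * snd v, snd v)) -` A"] A1 pm by (simp add: lborel_prod)
  also have "\<dots> = (\<integral>\<^sup>+y. emeasure lborel ((\<lambda>x. (x, y)) -` A) \<partial>lborel)"
  proof (rule nn_integral_cong)
    fix y :: real
    have "(\<lambda>x. (x, y)) -` ((\<lambda>v. (fst v + a * snd v, snd v)) -` A) = (+) (a * y) -` ((\<lambda>x. (x, y)) -` A)"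
      by (auto simp: add.commute)
    then show "emeasure lborel ((\<lambda>x. (x, y)) -` ((\<lambda>v. (fst v + a * snd v, snd v)) -` A)) = emeasure lborel ((\<lambda>x. (x, y)) -` A)"
      using tr[OF s1] by simp
  qed
  also have "\<dots> = emeasure lborel A"
    using alt2[of A] A pm by (simp add: lborel_prod)
  finally show "emeasure lborel ((\<lambda>v. (fst v + a * snd v, snd v)) -` A) = emeasure lborel A" .
  have "emeasure lborel ((\<lambda>v. (fst v, snd v + a * fst v)) -` A) =
      (\<integral>\<^sup>+x. emeasure lborel (Pair x -` ((\<lambda>v. (fst v, snd v + a * fst v)) -` A)) \<partial>lborel)"
    using alt1[of "(\<lambda>v. (fst v, snd v + a * fst v)) -` A"] A2 pm by (simp add: lborel_prod)
  also have "\<dots> = (\<integral>\<^sup>+x. emeasure lborel (Pair x -` A) \<partial>lborel)"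
  proof (rule nn_integral_cong)
    fix x :: real
    have "Pair x -` ((\<lambda>v. (fst v, snd v + a * fst v)) -` A) = (+) (a * x) -` (Pair x -` A)"
      by (auto simp: add.commute)
    then show "emeasure lborel (Pair x -` ((\<lambda>v. (fst v, snd v + a * fst v)) -` A)) = emeasure lborel (Pair x -` A)"
      using tr[OF s2] by simp
  qed
  also have "\<dots> = emeasure lborel A"
    using alt1[of A] A pm by (simp add: lborel_prod)
  finally show "emeasure lborel ((\<lambda>v. (fst v, snd v + a * fst v)) -` A) = emeasure lborel A" .
qed

text \<open>A rotation by an angle in \<open>[0, \<pi>)\<close> is a product of three shears.\<close>

lemma emeasure_vimage_rot:
  assumes A: "A \<in> sets borel" and \<theta>: "0 \<le> \<theta>" "\<theta> < 2 * pi"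
  shows "emeasure lborel (rot \<theta> -` A) = emeasure lborel A"
proof -
  have small: "emeasure lborel (rot t -` A) = emeasure lborel A \<and> rot t -` A \<in> sets borel"
    if A: "A \<in> sets borel" and t: "0 \<le> t" "t < pi" for A t
  proof -
    \<comment> \<open>The outer shears have slope \<open>- tan (t/2)\<close>, the middle one
      \<open>sin t\<close>; \<open>t < pi\<close> keeps the cosine of \<open>t/2\<close>
      positive.\<close>
    define c s b where "c = cos (t/2)" and "s = sin (t/2)" and "b = - (s / c)"
    have "c > 0" unfolding c_def using t by (intro cos_gt_zero_pi) auto
    have cs: "c * c + s * s = 1" using sin_cos_squared_add3[of "t/2"] by (simp add: c_def s_def)
    have ct: "cos t = c * c - s * s" "sin t = 2 * s * c"
      using cos_double[of "t/2"] sin_double[of "t/2"] by (auto simp: c_def s_def power2_eq_square)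
    define h where "h v = (fst v + b * snd v, snd v)" for v :: pt2
    define k where "k v = (fst v, snd v + sin t * fst v)" for v :: pt2
    have b1: "1 + b * sin t = cos t"
    proof -
      have "b * sin t = - (2 * s * s)" using \<open>c > 0\<close> by (simp add: b_def ct)
      then have "1 + b * sin t = c * c + s * s - 2 * s * s" using cs by linarith
      then show ?thesis by (simp add: ct)
    qed
    have b2: "b + b * cos t = - sin t"
    proof -
      have "1 + cos t = 2 * c * c" using cs by (simp add: ct)
      then have "b + b * cos t = b * (2 * c * c)" by (metis distrib_left mult.right_neutral)
      then show ?thesis using \<open>c > 0\<close> by (simp add: b_def ct)
    qed
    have comp: "rot t v = h (k (h v))" for v
    proof -
      have "cos t * fst v - sin t * snd v = (1 + b * sin t) * fst v + (b + b * (1 + b * sin t)) * snd v"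
        using b1 b2 by simp
      then show ?thesis unfolding rot_def h_def k_def by (simp add: b1[symmetric] algebra_simps)
    qed
    have hm: "h \<in> borel_measurable borel" "k \<in> borel_measurable borel"
      unfolding h_def[abs_def] k_def[abs_def] by (intro borel_measurable_continuous_onI continuous_intros)+
    have B: "h -` A \<in> sets borel" using measurable_sets_borel[OF hm(1) A] .
    have C: "k -` (h -` A) \<in> sets borel" using measurable_sets_borel[OF hm(2) B] .
    have D: "h -` (k -` (h -` A)) \<in> sets borel" using measurable_sets_borel[OF hm(1) C] .
    have eq: "rot t -` A = h -` (k -` (h -` A))" using comp by auto
    show ?thesis
      unfolding eq using D emeasure_vimage_shear(1)[OF C, of b] emeasure_vimage_shear(2)[OF B, of "sin t"]
        emeasure_vimage_shear(1)[OF A, of b] by (simp add: h_def[abs_def] k_def[abs_def])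
  qed
  \<comment> \<open>Half the angle is below \<open>pi\<close>, and the rotation by it is applied
    twice.\<close>
  have "rot \<theta> -` A = rot (\<theta>/2) -` (rot (\<theta>/2) -` A)" by (simp add: set_eq_iff rot_rot)
  then show ?thesis using small[of A "\<theta>/2"] small[of "rot (\<theta>/2) -` A" "\<theta>/2"] A \<theta> by simp
qed

text \<open>The origin is excluded because \<open>ang 0 = 0\<close> would place it in the sectors
  starting at angle 0; the angles are half-open so that adjacent sectors are disjoint.\<close>

definition sector :: "real \<Rightarrow> real \<Rightarrow> real \<Rightarrow> pt2 set" where
  "sector \<rho> \<alpha> \<beta> = {v. norm v \<le> \<rho> \<and> v \<noteq> 0 \<and> \<alpha> \<le> ang v \<and> ang v < \<beta>}"

lemma sector_borel [measurable]: "sector \<rho> \<alpha> \<beta> \<in> sets borel"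
  unfolding sector_def by measurable

lemma sector_fmeasurable: "sector \<rho> \<alpha> \<beta> \<in> fmeasurable lborel"
proof (rule fmeasurableI2)
  show "cball (0::pt2) \<rho> \<in> fmeasurable lborel" by (rule fmeasurable_compact) simp
qed (auto simp: sector_def)

lemma measure_sector_rot:
  assumes "0 \<le> \<alpha>" "\<alpha> + t \<le> 2 * pi" "0 \<le> t"
  shows "measure lborel (sector \<rho> \<alpha> (\<alpha> + t)) = measure lborel (sector \<rho> 0 t)"
proof (cases "t = 0")
  case False
  have "rot \<alpha> -` sector \<rho> \<alpha> (\<alpha> + t) = sector \<rho> 0 t"
  proof (intro set_eqI iffI)
    fix v assume "v \<in> rot \<alpha> -` sector \<rho> \<alpha> (\<alpha> + t)"
    then have v: "norm (rot \<alpha> v) \<le> \<rho>" "rot \<alpha> v \<noteq> 0" "\<alpha> \<le> ang (rot \<alpha> v)" "ang (rot \<alpha> v) < \<alpha> + t"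
      by (auto simp: sector_def)
    define r where "r = norm (rot \<alpha> v)"
    have "v = rot (- \<alpha>) (rot \<alpha> v)" by (simp add: rot_rot)
    also have "\<dots> = rot (- \<alpha>) (r *\<^sub>R dirv (ang (rot \<alpha> v)))" unfolding r_def by (subst dirv_ang) simp
    also have "\<dots> = r *\<^sub>R dirv (ang (rot \<alpha> v) - \<alpha>)" by (simp add: rot_dirv)
    finally have v': "v = r *\<^sub>R dirv (ang (rot \<alpha> v) - \<alpha>)" .
    have "r > 0" using v by (simp add: r_def)
    have "ang v = ang (rot \<alpha> v) - \<alpha>"
      by (subst v', rule ang_dirv) (use v assms \<open>r > 0\<close> in auto)
    moreover have "norm v = r" using \<open>r > 0\<close> by (subst v') simp
    ultimately show "v \<in> sector \<rho> 0 t" using v \<open>r > 0\<close> by (auto simp: sector_def r_def)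
  next
    fix v assume "v \<in> sector \<rho> 0 t"
    then have v: "norm v \<le> \<rho>" "v \<noteq> 0" "0 \<le> ang v" "ang v < t" by (auto simp: sector_def)
    have v': "rot \<alpha> v = norm v *\<^sub>R dirv (ang v + \<alpha>)"
      using rot_dirv[of \<alpha> "norm v" "ang v"] dirv_ang[of v] by simp
    have "ang (rot \<alpha> v) = ang v + \<alpha>"
      unfolding v' by (rule ang_dirv) (use v assms in auto)
    then show "v \<in> rot \<alpha> -` sector \<rho> \<alpha> (\<alpha> + t)"
      using v by (auto simp: sector_def v')
  qed
  moreover have "\<alpha> < 2 * pi" using assms False by auto
  ultimately have "emeasure lborel (sector \<rho> \<alpha> (\<alpha> + t)) = emeasure lborel (sector \<rho> 0 t)"
    using emeasure_vimage_rot[of "sector \<rho> \<alpha> (\<alpha> + t)" \<alpha>] assms(1) by simp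
  then show ?thesis by (simp add: measure_def)
next
  case True
  have "sector \<rho> \<alpha> \<alpha> = {}" for \<alpha> by (auto simp: sector_def)
  with True show ?thesis by simp
qed

text \<open>By rotation invariance the area is additive in the opening angle \<open>t\<close>. About
  \<open>2 * pi / t\<close> copies of a sector fit into the disc and one more covers it, which pins
  the area to \<open>t\<close> up to constants. Bi-Lipschitz bounds of this kind are all that the
  change of angles requires.\<close>

lemma measure_sector_bounds:
  assumes "\<rho> > 0"
  obtains c C where "c > 0" "C > 0"
    "\<And>\<alpha> \<beta>. 0 \<le> \<alpha> \<Longrightarrow> \<alpha> \<le> \<beta> \<Longrightarrow> \<beta> \<le> 2 * pi \<Longrightarrow>
       c * (\<beta> - \<alpha>) \<le> measure lborel (sector \<rho> \<alpha> \<beta>) \<and> measure lborel (sector \<rho> \<alpha> \<beta>) \<le> C * (\<beta> - \<alpha>)"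
proof -
  define m where "m t = measure lborel (sector \<rho> 0 t)" for t
  have add: "m (s + t) = m s + m t" if "0 \<le> s" "0 \<le> t" "s + t \<le> 2 * pi" for s t
  proof -
    have "sector \<rho> 0 (s + t) = sector \<rho> 0 s \<union> sector \<rho> s (s + t)"
      using that by (auto simp: sector_def)
    moreover have "sector \<rho> 0 s \<inter> sector \<rho> s (s + t) = {}" by (auto simp: sector_def)
    ultimately show ?thesis
      using measure_sector_rot[of s t \<rho>] that measure_Union[of lborel "sector \<rho> 0 s" "sector \<rho> s (s + t)"]
        sector_fmeasurable[of \<rho>] by (simp add: m_def fmeasurable_def less_top)
  qed
  have "sector \<rho> 0 0 = {}" by (auto simp: sector_def)
  then have m0: "m 0 = 0" by (simp add: m_def)
  have mge: "m t \<ge> 0" for t by (simp add: m_def)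
  have mono: "m s \<le> m t" if "0 \<le> s" "s \<le> t" "t \<le> 2 * pi" for s t
    using add[of s "t - s"] mge[of "t - s"] that by simp
  have mult: "m (real n * t) = real n * m t" if "0 \<le> t" "real n * t \<le> 2 * pi" for n t
    using that(2)
  proof (induction n)
    case (Suc n)
    have "real (Suc n) * t = real n * t + t" by (simp add: algebra_simps)
    moreover have "m (real n * t + t) = m (real n * t) + m t"
      using Suc.prems that(1) by (intro add) (auto simp: algebra_simps)
    ultimately show ?case using Suc that(1) by (simp add: algebra_simps)
  qed (simp add: m0)
  define T where "T = m (2 * pi)"
  have "T > 0"
  proof -
    define c where "c = (\<rho>/2) *\<^sub>R dirv 0"
    have nc: "norm c = \<rho>/2" using assms by (simp add: c_def)
    have "ball c (\<rho>/2) \<subseteq> sector \<rho> 0 (2 * pi)"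
    proof
      fix v assume "v \<in> ball c (\<rho>/2)"
      then have "norm (c - v) < \<rho>/2" by (simp add: dist_norm)
      then have "norm v \<le> \<rho>" "v \<noteq> 0"
        using norm_triangle_ineq2[of v c] nc by (auto simp: norm_minus_commute)
      then show "v \<in> sector \<rho> 0 (2 * pi)" using ang_bounds[of v] by (simp add: sector_def)
    qed
    then have "measure lborel (ball c (\<rho>/2)) \<le> T"
      unfolding T_def m_def by (intro measure_mono_fmeasurable sector_fmeasurable) auto
    moreover have "measure lborel (ball c (\<rho>/2)) > 0"
      using content_ball_pos[of "\<rho>/2" c] assms by simp
    ultimately show ?thesis by linarith
  qed
  have key: "T / (4 * pi) * t \<le> m t \<and> m t \<le> T / pi * t" if t: "0 \<le> t" "t \<le> 2 * pi" for t
  proof (cases "t = 0")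
    case False
    then have "t > 0" using t by simp
    define n where "n = nat \<lfloor>2 * pi / t\<rfloor>"
    have "2 * pi / t \<ge> 1" using t \<open>t > 0\<close> by simp
    then have n: "real n \<le> 2 * pi / t" "2 * pi / t < real n + 1" "real n \<ge> 1"
    proof -
      have "1 \<le> \<lfloor>2 * pi / t\<rfloor>" using \<open>2 * pi / t \<ge> 1\<close> by (simp add: le_floor_iff del: le_divide_eq_1_pos)
      then have "real n = of_int \<lfloor>2 * pi / t\<rfloor>" "real_of_int \<lfloor>2 * pi / t\<rfloor> \<ge> 1" by (simp_all add: n_def)
      then show "real n \<le> 2 * pi / t" "2 * pi / t < real n + 1" "real n \<ge> 1" by linarith+
    qed
    have n1: "real n * t \<le> 2 * pi" using n(1) \<open>t > 0\<close> by (simp add: field_simps)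
    have n2: "2 * pi < real n * t + t" using n(2) \<open>t > 0\<close> by (simp add: field_simps)
    \<comment> \<open>\<open>n * t\<close> exceeds \<open>2 * pi - t\<close> and is at least
      \<open>t\<close>, so its double exceeds \<open>2 * pi\<close>.\<close>
    have n3: "pi \<le> real n * t" using n1 n2 n(3) \<open>t > 0\<close> by (smt (verit) mult_less_cancel_right2 mult_le_cancel_right1)
    have "real n * m t \<le> T" using mult[of t n] mono[of "real n * t" "2 * pi"] n1 t by (simp add: T_def)
    then have "pi * m t \<le> T * t"
    proof -
      have "pi * m t \<le> real n * t * m t" using n3 mge by (intro mult_right_mono) auto
      also have "\<dots> = t * (real n * m t)" by simp
      also have "\<dots> \<le> t * T" using \<open>real n * m t \<le> T\<close> \<open>t > 0\<close> by (intro mult_left_mono) auto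
      finally show ?thesis by (simp add: mult.commute)
    qed
    moreover have "T * t \<le> 4 * pi * m t"
    proof -
      have "T = m (real n * t) + m (2 * pi - real n * t)"
        using add[of "real n * t" "2 * pi - real n * t"] n1 t by (simp add: T_def)
      also have "\<dots> \<le> real n * m t + m t"
        using mult[of t n] n1 n2 t mono[of "2 * pi - real n * t" t] by simp
      also have "\<dots> \<le> 2 * real n * m t" using mult_right_mono[OF n(3) mge[of t]] by (simp add: algebra_simps)
      finally have "T * t \<le> 2 * real n * m t * t" using \<open>t > 0\<close> by (intro mult_right_mono) auto
      also have "\<dots> = (2 * m t) * (real n * t)" by simp
      also have "\<dots> \<le> (2 * m t) * (2 * pi)" using n1 mge[of t] by (intro mult_left_mono) auto
      finally show ?thesis by (simp add: mult_ac)
    qed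
    ultimately show ?thesis by (simp add: field_simps)
  qed (simp add: m0)
  show thesis
  proof (rule that[of "T / (4 * pi)" "T / pi"])
    fix \<alpha> \<beta> :: real assume "0 \<le> \<alpha>" "\<alpha> \<le> \<beta>" "\<beta> \<le> 2 * pi"
    then show "T / (4 * pi) * (\<beta> - \<alpha>) \<le> measure lborel (sector \<rho> \<alpha> \<beta>) \<and> measure lborel (sector \<rho> \<alpha> \<beta>) \<le> T / pi * (\<beta> - \<alpha>)"
      using key[of "\<beta> - \<alpha>"] measure_sector_rot[of \<alpha> "\<beta> - \<alpha>" \<rho>] by (simp add: m_def)
  qed (use \<open>T > 0\<close> in auto)
qed

section \<open>Convex trigonometry of a planar norm\<close>

locale plane_norm =
  fixes N :: "pt2 \<Rightarrow> real"
  assumes norm2: "is_norm2 N"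
begin

lemma N_nonneg [simp]: "0 \<le> N x"
  and N_eq_0_iff [simp]: "N x = 0 \<longleftrightarrow> x = 0"
  and N_scale: "N (c *\<^sub>R x) = \<bar>c\<bar> * N x"
  and N_triangle: "N (x + y) \<le> N x + N y"
  using norm2 unfolding is_norm2_def by blast+

lemma N_0 [simp]: "N 0 = 0" by simp

lemma N_pos: "x \<noteq> 0 \<Longrightarrow> 0 < N x"
  using N_nonneg[of x] N_eq_0_iff[of x] by linarith

lemma N_minus: "N (- x) = N x"
  using N_scale[of "-1" x] by simp

lemma N_upper: obtains C where "C > 0" "\<And>x. N x \<le> C * norm x"
proof
  let ?C = "N (1, 0) + N (0, 1)"
  show "?C > 0" by (intro add_pos_nonneg N_pos N_nonneg) (simp add: zero_prod_def)
  show "N x \<le> ?C * norm x" for x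
  proof -
    have "N x = N (fst x *\<^sub>R (1, 0) + snd x *\<^sub>R (0, 1))" by simp
    also have "\<dots> \<le> \<bar>fst x\<bar> * N (1, 0) + \<bar>snd x\<bar> * N (0, 1)"
      using N_triangle[of "fst x *\<^sub>R (1, 0)" "snd x *\<^sub>R (0, 1)"] by (simp only: N_scale)
    also have "\<dots> \<le> norm x * N (1, 0) + norm x * N (0, 1)"
      using norm_fst_le[of "fst x" "snd x"] norm_snd_le[of "snd x" "fst x"]
      by (intro add_mono mult_right_mono) auto
    finally show ?thesis by (simp add: algebra_simps)
  qed
qed

lemma N_diff: "\<bar>N x - N y\<bar> \<le> N (x - y)"
  using N_triangle[of "x - y" y] N_triangle[of "y - x" x] N_minus[of "x - y"] by simp

lemma N_continuous: "continuous_on S N"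
proof -
  obtain C where C: "C > 0" "\<And>x. N x \<le> C * norm x" by (rule N_upper, rule that, assumption+)
  have "C-lipschitz_on UNIV N"
  proof (rule lipschitz_onI)
    show "dist (N x) (N y) \<le> C * dist x y" for x y
      using C(2)[of "x - y"] N_diff[of x y] by (simp add: dist_real_def dist_norm)
  qed (use C in simp)
  then show ?thesis using lipschitz_on_continuous_on continuous_on_subset by blast
qed

lemma N_lower: obtains c where "c > 0" "\<And>x. c * norm x \<le> N x"
proof -
  have "compact (sphere (0::pt2) 1)" "sphere (0::pt2) 1 \<noteq> {}"
    using norm_dirv[of 0] by (auto simp del: norm_dirv)
  then have "\<exists>x\<in>sphere 0 1. \<forall>y\<in>sphere 0 1. N x \<le> N y"
    by (rule continuous_attains_inf) (rule N_continuous)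
  then obtain x0 where x0: "x0 \<in> sphere 0 1" "\<And>y. y \<in> sphere 0 1 \<Longrightarrow> N x0 \<le> N y"
    by blast
  show thesis
  proof
    show "N x0 > 0" using x0(1) by (intro N_pos) auto
    show "N x0 * norm x \<le> N x" for x
    proof (cases "x = 0")
      case False
      then have "N x0 \<le> N (inverse (norm x) *\<^sub>R x)" by (intro x0) simp
      then show ?thesis using False by (simp add: N_scale field_simps)
    qed simp
  qed
qed

lemma N_measurable [measurable]: "N \<in> borel_measurable borel"
  using N_continuous by (rule borel_measurable_continuous_onI)

lemma mem_Omega [simp]: "x \<in> Omega N \<longleftrightarrow> N x \<le> 1"
  by (simp add: Omega_def)

lemma closed_Omega: "closed (Omega N)"
  unfolding Omega_def by (intro closed_Collect_le N_continuous continuous_on_const)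

lemma bounded_Omega: "bounded (Omega N)"
proof -
  obtain c where c: "c > 0" "\<And>x. c * norm x \<le> N x" by (rule N_lower, rule that, assumption+)
  show ?thesis
  proof (rule boundedI)
    fix x assume "x \<in> Omega N"
    then have "c * norm x \<le> 1" using c(2)[of x] by simp
    then show "norm x \<le> 1 / c" using c(1) by (simp add: field_simps)
  qed
qed

lemma compact_Omega: "compact (Omega N)"
  using closed_Omega bounded_Omega by (simp add: compact_eq_bounded_closed)

lemma frontier_Omega: "frontier (Omega N) = {x. N x = 1}"
proof -
  have "open {x. N x < 1}" by (intro open_Collect_less N_continuous continuous_on_const)
  then have sub: "{x. N x < 1} \<subseteq> interior (Omega N)" by (intro interior_maximal) (auto simp: Omega_def)
  have ne: "x \<notin> interior (Omega N)" if "N x = 1" for x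
  proof
    assume "x \<in> interior (Omega N)"
    then obtain e where e: "e > 0" "ball x e \<subseteq> Omega N" by (auto simp: mem_interior)
    have "x \<noteq> 0" using that by auto
    define d where "d = e / (2 * norm x)"
    have "d > 0" using e \<open>x \<noteq> 0\<close> by (simp add: d_def)
    have "(1 + d) *\<^sub>R x \<in> ball x e"
      using e \<open>x \<noteq> 0\<close> by (simp add: dist_norm scaleR_left_distrib d_def)
    then have "N ((1 + d) *\<^sub>R x) \<le> 1" using e by auto
    then show False using that \<open>d > 0\<close> by (simp add: N_scale)
  qed
  have le: "N x \<le> 1" if "x \<in> interior (Omega N)" for x
    using subsetD[OF interior_subset that] by simp
  have "x \<in> interior (Omega N) \<longleftrightarrow> N x < 1" for x
    using subsetD[OF sub, of x] ne[of x] le[of x] by (auto simp: less_le)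
  then have "interior (Omega N) = {x. N x < 1}" by blast
  then have "frontier (Omega N) = Omega N - {x. N x < 1}"
    by (simp only: frontier_def closure_closed[OF closed_Omega])
  moreover have "N x \<le> 1 \<and> \<not> N x < 1 \<longleftrightarrow> N x = 1" for x by linarith
  ultimately show ?thesis by (simp only: set_eq_iff Diff_iff mem_Omega mem_Collect_eq) simp
qed

text \<open>The unit sphere by Euclidean polar angle, periodic on the line; \<open>P_S\<close> runs
  through the same curve by swept area.\<close>

definition bd :: "real \<Rightarrow> pt2" where
  "bd \<alpha> = inverse (N (dirv \<alpha>)) *\<^sub>R dirv \<alpha>"

lemma N_dirv_pos [simp]: "0 < N (dirv \<alpha>)"
  by (rule N_pos) simp

lemma N_bd [simp]: "N (bd \<alpha>) = 1"
  using N_dirv_pos[of \<alpha>] by (simp add: bd_def N_scale less_imp_neq[symmetric])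

lemma ang_bd: "0 \<le> \<alpha> \<Longrightarrow> \<alpha> < 2 * pi \<Longrightarrow> ang (bd \<alpha>) = \<alpha>"
  unfolding bd_def by (rule ang_dirv) auto

lemma dirv_2pi: "dirv (\<alpha> + 2 * pi * of_int k) = dirv \<alpha>"
  using cos.plus_of_int[of \<alpha> k] sin.plus_of_int[of \<alpha> k] by (simp add: dirv_def mult.commute)

lemma bd_2pi: "bd (\<alpha> + 2 * pi * of_int k) = bd \<alpha>"
  by (simp add: bd_def dirv_2pi)

lemma eq_bd_scaled: "r > 0 \<Longrightarrow> N (r *\<^sub>R dirv \<alpha>) = 1 \<Longrightarrow> r *\<^sub>R dirv \<alpha> = bd \<alpha>"
  by (simp add: N_scale bd_def field_simps)

lemma eq_bd_ang: "N x = 1 \<Longrightarrow> x = bd (ang x)"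
  using eq_bd_scaled[of "norm x" "ang x"] dirv_ang[of x] by (metis N_0 norm_eq_zero norm_ge_zero order_le_less zero_neq_one)

text \<open>The factor 2 follows the convention that the angle \<theta> sweeps the area \<theta> /
  2.\<close>

definition area2 :: "real \<Rightarrow> real" where
  "area2 \<alpha> = 2 * measure lborel {v \<in> Omega N. ang v \<le> \<alpha>}"

lemma Omega_borel [measurable]: "Omega N \<in> sets borel"
  using closed_Omega by simp

lemma Omega_fmeasurable: "Omega N \<in> fmeasurable lborel"
  by (rule fmeasurable_compact[OF compact_Omega])

text \<open>The unit ball lies between two Euclidean discs, so its sectors are squeezed between disc
  sectors.\<close>

lemma area2_bounds:
  obtains c C where "c > 0" "C > 0"
    "\<And>\<alpha> \<beta>. 0 \<le> \<alpha> \<Longrightarrow> \<alpha> \<le> \<beta> \<Longrightarrow> \<beta> \<le> 2 * pi \<Longrightarrow>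
       c * (\<beta> - \<alpha>) \<le> area2 \<beta> - area2 \<alpha> \<and> area2 \<beta> - area2 \<alpha> \<le> C * (\<beta> - \<alpha>)"
    "area2 0 = 0" "area2 (2 * pi) = 2 * pi_S (Omega N)"
proof -
  obtain k where k: "k > 0" "\<And>x. k * norm x \<le> N x" by (rule N_lower, rule that, assumption+)
  obtain K where K: "K > 0" "\<And>x. N x \<le> K * norm x" by (rule N_upper, rule that, assumption+)
  have in1: "N v \<le> 1" if "norm v \<le> 1 / K" for v
    using K(2)[of v] that K(1) by (simp add: field_simps)
  have in2: "norm v \<le> 1 / k" if "N v \<le> 1" for v
    using k(2)[of v] that k(1) by (simp add: field_simps)
  obtain c1 C1 where c1: "c1 > 0" "\<And>\<alpha> \<beta>. 0 \<le> \<alpha> \<Longrightarrow> \<alpha> \<le> \<beta> \<Longrightarrow> \<beta> \<le> 2 * pi \<Longrightarrow>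
       c1 * (\<beta> - \<alpha>) \<le> measure lborel (sector (1/K) \<alpha> \<beta>) \<and> measure lborel (sector (1/K) \<alpha> \<beta>) \<le> C1 * (\<beta> - \<alpha>)"
    by (rule measure_sector_bounds[of "1/K"], use K(1) in simp, rule that, assumption+)
  obtain c2 C2 where c2: "C2 > 0" "\<And>\<alpha> \<beta>. 0 \<le> \<alpha> \<Longrightarrow> \<alpha> \<le> \<beta> \<Longrightarrow> \<beta> \<le> 2 * pi \<Longrightarrow>
       c2 * (\<beta> - \<alpha>) \<le> measure lborel (sector (1/k) \<alpha> \<beta>) \<and> measure lborel (sector (1/k) \<alpha> \<beta>) \<le> C2 * (\<beta> - \<alpha>)"
    by (rule measure_sector_bounds[of "1/k"], use k(1) in simp, rule that, assumption+)
  have fm: "{v \<in> Omega N. P v} \<in> fmeasurable lborel" if "{v. P v} \<in> sets borel" for P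
  proof (rule fmeasurableI2[OF Omega_fmeasurable])
    have "{v \<in> Omega N. P v} = Omega N \<inter> {v. P v}" by auto
    then show "{v \<in> Omega N. P v} \<in> sets lborel" using that Omega_borel by auto
  qed auto
  have b1: "{v. ang v \<le> \<alpha>} \<in> sets borel" "{v. \<alpha> < ang v \<and> ang v \<le> \<beta>} \<in> sets borel" for \<alpha> \<beta>
    by measurable
  have diff: "area2 \<beta> - area2 \<alpha> = 2 * measure lborel {v \<in> Omega N. \<alpha> < ang v \<and> ang v \<le> \<beta>}" if "\<alpha> \<le> \<beta>" for \<alpha> \<beta>
  proof -
    have "{v \<in> Omega N. ang v \<le> \<beta>} = {v \<in> Omega N. ang v \<le> \<alpha>} \<union> {v \<in> Omega N. \<alpha> < ang v \<and> ang v \<le> \<beta>}"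
      using that by auto
    moreover have "{v \<in> Omega N. ang v \<le> \<alpha>} \<inter> {v \<in> Omega N. \<alpha> < ang v \<and> ang v \<le> \<beta>} = {}" by auto
    ultimately show ?thesis
      using measure_Union[of lborel "{v \<in> Omega N. ang v \<le> \<alpha>}" "{v \<in> Omega N. \<alpha> < ang v \<and> ang v \<le> \<beta>}"]
        fm[OF b1(1)] fm[OF b1(2)] by (simp add: area2_def fmeasurable_def less_top)
  qed
  have lower: "2 * c1 * (\<beta> - \<alpha>) \<le> area2 \<beta> - area2 \<alpha>" if "0 \<le> \<alpha>" "\<alpha> \<le> \<beta>" "\<beta> \<le> 2 * pi" for \<alpha> \<beta>
  proof (rule field_le_epsilon)
    fix e :: real assume "e > 0"
    \<comment> \<open>The region is open at \<alpha> while a disc sector contains its first ray;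
      starting the sector slightly later costs at most \<open>e\<close>.\<close>
    define a where "a = \<alpha> + e / (2 * c1)"
    have "a > \<alpha>" using \<open>e > 0\<close> c1(1) by (simp add: a_def)
    have mono: "area2 \<beta> - area2 \<alpha> \<ge> 0" using diff[OF that(2)] by simp
    show "2 * c1 * (\<beta> - \<alpha>) \<le> area2 \<beta> - area2 \<alpha> + e"
    proof (cases "a \<le> \<beta>")
      case True
      have "sector (1/K) a \<beta> \<subseteq> {v \<in> Omega N. \<alpha> < ang v \<and> ang v \<le> \<beta>}"
        using \<open>a > \<alpha>\<close> in1 by (auto simp: sector_def)
      then have "measure lborel (sector (1/K) a \<beta>) \<le> measure lborel {v \<in> Omega N. \<alpha> < ang v \<and> ang v \<le> \<beta>}"
        by (intro measure_mono_fmeasurable fm[OF b1(2)]) auto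
      moreover have "c1 * (\<beta> - a) \<le> measure lborel (sector (1/K) a \<beta>)"
        using c1(2)[of a \<beta>] True \<open>a > \<alpha>\<close> that by auto
      moreover have "2 * c1 * (\<beta> - \<alpha>) = 2 * (c1 * (\<beta> - a)) + e" using c1(1) by (simp add: a_def field_simps)
      ultimately show ?thesis using diff[OF that(2)] by linarith
    next
      case False
      then have "2 * c1 * (\<beta> - \<alpha>) \<le> 2 * c1 * (e / (2 * c1))" using c1(1) by (intro mult_left_mono) (auto simp: a_def)
      also have "\<dots> = e" using c1(1) by simp
      finally show ?thesis using mono by linarith
    qed
  qed
  have upper: "area2 \<beta> - area2 \<alpha> \<le> 2 * C2 * (\<beta> - \<alpha>)" if "0 \<le> \<alpha>" "\<alpha> \<le> \<beta>" "\<beta> \<le> 2 * pi" for \<alpha> \<beta>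
  proof (rule field_le_epsilon)
    fix e :: real assume "e > 0"
    \<comment> \<open>The sector must end after \<beta> in order to contain that ray, but not after
      a full turn; at \<open>2 * pi\<close> nothing is lost because \<open>ang\<close> stays below
      it.\<close>
    define b where "b = min (2 * pi) (\<beta> + e / (2 * C2))"
    have b: "b \<le> 2 * pi" "\<beta> \<le> b" "b \<le> \<beta> + e / (2 * C2)" "\<beta> < b \<or> b = 2 * pi"
    proof -
      have "\<beta> < \<beta> + e / (2 * C2)" using \<open>e > 0\<close> c2(1) by simp
      then show "b \<le> 2 * pi" "\<beta> \<le> b" "b \<le> \<beta> + e / (2 * C2)" "\<beta> < b \<or> b = 2 * pi"
        using that(3) unfolding b_def min_def by (simp_all split: if_split) linarith?
    qed
    have "{v \<in> Omega N. \<alpha> < ang v \<and> ang v \<le> \<beta>} \<subseteq> sector (1/k) \<alpha> b"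
    proof
      fix v assume v: "v \<in> {v \<in> Omega N. \<alpha> < ang v \<and> ang v \<le> \<beta>}"
      then have "v \<noteq> 0" using that(1) by auto
      moreover have "ang v < b" using v b(4) ang_bounds(2)[of v] by auto
      ultimately show "v \<in> sector (1/k) \<alpha> b" using v in2 by (auto simp: sector_def)
    qed
    then have "measure lborel {v \<in> Omega N. \<alpha> < ang v \<and> ang v \<le> \<beta>} \<le> measure lborel (sector (1/k) \<alpha> b)"
      using fm[OF b1(2)] by (intro measure_mono_fmeasurable sector_fmeasurable) (auto simp: fmeasurable_def)
    also have "\<dots> \<le> C2 * (b - \<alpha>)" using c2(2)[of \<alpha> b] that b by auto
    also have "\<dots> \<le> C2 * (\<beta> + e / (2 * C2) - \<alpha>)" using b c2(1) by (intro mult_left_mono) auto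
    also have "\<dots> = C2 * (\<beta> - \<alpha>) + e / 2" using c2(1) by (simp add: field_simps)
    finally show "area2 \<beta> - area2 \<alpha> \<le> 2 * C2 * (\<beta> - \<alpha>) + e"
      using diff[OF that(2)] by linarith
  qed
  \<comment> \<open>The ray at angle 0 lies in arbitrarily thin sectors, apart from the
    origin.\<close>
  have a0: "area2 0 \<le> 0"
  proof (rule field_le_epsilon)
    fix e :: real assume "e > 0"
    define b where "b = min (2 * pi) (e / (2 * C2))"
    have b: "b > 0" "b \<le> 2 * pi" "b \<le> e / (2 * C2)" using \<open>e > 0\<close> c2(1) by (auto simp: b_def)
    have "{v \<in> Omega N. ang v \<le> 0} \<subseteq> {0} \<union> sector (1/k) 0 b"
      using in2 b(1) ang_bounds(1) by (auto simp: sector_def)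
    then have "measure lborel {v \<in> Omega N. ang v \<le> 0} \<le> measure lborel ({0} \<union> sector (1/k) 0 b)"
      using fm[OF b1(1), of 0] by (intro measure_mono_fmeasurable fmeasurable.Un sector_fmeasurable) (auto simp: fmeasurable_def)
    also have "\<dots> \<le> measure lborel {0::pt2} + measure lborel (sector (1/k) 0 b)"
      by (rule measure_Un_le) auto
    also have "\<dots> \<le> C2 * b" using c2(2)[of 0 b] b by auto
    also have "\<dots> \<le> C2 * (e / (2 * C2))" using b c2(1) by (intro mult_left_mono) auto
    finally show "area2 0 \<le> 0 + e" using c2(1) by (simp add: area2_def)
  qed
  have a2: "{v \<in> Omega N. ang v \<le> 2 * pi} = Omega N" using ang_bounds(2) by (auto simp: less_imp_le)
  show thesis
  proof (rule that[of "2 * c1" "2 * C2"])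
    show "area2 0 = 0" using a0 by (simp add: area2_def order_antisym)
    show "area2 (2 * pi) = 2 * pi_S (Omega N)" unfolding area2_def a2 pi_S_def by simp
  qed (use c1(1) c2(1) lower upper in auto)
qed

lemma pi_S_pos: "0 < pi_S (Omega N)"
proof -
  obtain c C where c: "c > 0"
    "\<And>\<alpha> \<beta>. 0 \<le> \<alpha> \<Longrightarrow> \<alpha> \<le> \<beta> \<Longrightarrow> \<beta> \<le> 2 * pi \<Longrightarrow>
       c * (\<beta> - \<alpha>) \<le> area2 \<beta> - area2 \<alpha> \<and> area2 \<beta> - area2 \<alpha> \<le> C * (\<beta> - \<alpha>)"
    "area2 0 = 0" "area2 (2 * pi) = 2 * pi_S (Omega N)"
    by (rule area2_bounds, rule that, assumption+)
  have "c * (2 * pi - 0) \<le> area2 (2 * pi) - area2 0"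
    by (rule conjunct1[OF c(2)]) auto
  moreover have "0 < c * (2 * pi - 0)" using c(1) by simp
  ultimately show ?thesis using c(3,4) by linarith
qed

text \<open>Twice the area swept up to polar angle \<open>\<alpha>\<close>, lifted to the whole line; it inverts the
  parametrisation \<open>P_S\<close> (see \<open>P_S_Theta\<close>).\<close>

definition Theta :: "real \<Rightarrow> real" where
  "Theta \<alpha> = area2 (\<alpha> - 2 * pi * of_int \<lfloor>\<alpha> / (2 * pi)\<rfloor>) + 2 * pi_S (Omega N) * of_int \<lfloor>\<alpha> / (2 * pi)\<rfloor>"

lemma Theta_2pi: "Theta (\<alpha> + 2 * pi * of_int k) = Theta \<alpha> + 2 * pi_S (Omega N) * of_int k"
proof -
  have "(\<alpha> + 2 * pi * of_int k) / (2 * pi) = \<alpha> / (2 * pi) + of_int k" by (simp add: field_simps)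
  then have "\<lfloor>(\<alpha> + 2 * pi * of_int k) / (2 * pi)\<rfloor> = \<lfloor>\<alpha> / (2 * pi)\<rfloor> + k" by simp
  then show ?thesis by (simp add: Theta_def algebra_simps)
qed

text \<open>An interval of angles splits into the rest of the turn of \<alpha>, some whole turns,
  and the beginning of the turn of \<beta>; \<open>area2_bounds\<close> applies to each.\<close>

lemma Theta_bounds:
  obtains c C where "c > 0" "C > 0"
    "\<And>\<alpha> \<beta>. \<alpha> \<le> \<beta> \<Longrightarrow> c * (\<beta> - \<alpha>) \<le> Theta \<beta> - Theta \<alpha> \<and> Theta \<beta> - Theta \<alpha> \<le> C * (\<beta> - \<alpha>)"
proof -
  obtain c C where c: "c > 0" "C > 0"
    "\<And>\<alpha> \<beta>. 0 \<le> \<alpha> \<Longrightarrow> \<alpha> \<le> \<beta> \<Longrightarrow> \<beta> \<le> 2 * pi \<Longrightarrow>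
       c * (\<beta> - \<alpha>) \<le> area2 \<beta> - area2 \<alpha> \<and> area2 \<beta> - area2 \<alpha> \<le> C * (\<beta> - \<alpha>)"
    and c0: "area2 0 = 0" and cpi: "area2 (2 * pi) = 2 * pi_S (Omega N)"
    by (rule area2_bounds, rule that, assumption+)
  have "c * (\<beta> - \<alpha>) \<le> Theta \<beta> - Theta \<alpha> \<and> Theta \<beta> - Theta \<alpha> \<le> C * (\<beta> - \<alpha>)" if "\<alpha> \<le> \<beta>" for \<alpha> \<beta>
  proof -
    define m n where "m = \<lfloor>\<alpha> / (2 * pi)\<rfloor>" and "n = \<lfloor>\<beta> / (2 * pi)\<rfloor>"
    define a b where "a = \<alpha> - 2 * pi * of_int m" and "b = \<beta> - 2 * pi * of_int n"
    have a: "0 \<le> a" "a \<le> 2 * pi" and b: "0 \<le> b" "b \<le> 2 * pi"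
      using floor_divide_lower[of "2*pi" \<alpha>] floor_divide_upper[of "2*pi" \<alpha>]
        floor_divide_lower[of "2*pi" \<beta>] floor_divide_upper[of "2*pi" \<beta>]
      by (auto simp: a_def b_def m_def n_def algebra_simps)
    have T: "Theta \<alpha> = area2 a + area2 (2 * pi) * of_int m" "Theta \<beta> = area2 b + area2 (2 * pi) * of_int n"
      by (simp_all add: Theta_def a_def b_def m_def n_def cpi)
    have "m \<le> n" unfolding m_def n_def by (intro floor_mono divide_right_mono that) simp
    show ?thesis
    proof (cases "m = n")
      case True
      then have "\<beta> - \<alpha> = b - a" "Theta \<beta> - Theta \<alpha> = area2 b - area2 a" by (simp_all add: T a_def b_def)
      then show ?thesis using c(3)[of a b] a b that by auto
    next
      case False
      then have k: "real_of_int (n - m - 1) \<ge> 0" using \<open>m \<le> n\<close> by simp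
      define k where "k = real_of_int (n - m - 1)"
      have e1: "\<beta> - \<alpha> = (b - 0) + k * (2 * pi - 0) + (2 * pi - a)"
        by (simp add: a_def b_def k_def algebra_simps)
      have e2: "Theta \<beta> - Theta \<alpha> = (area2 b - area2 0) + k * (area2 (2 * pi) - area2 0) + (area2 (2 * pi) - area2 a)"
        by (simp add: T k_def c0 algebra_simps)
      have i1: "c * (b - 0) \<le> area2 b - area2 0" "area2 b - area2 0 \<le> C * (b - 0)" using c(3)[of 0 b] b by auto
      have i2: "c * (2 * pi - a) \<le> area2 (2 * pi) - area2 a" "area2 (2 * pi) - area2 a \<le> C * (2 * pi - a)"
        using c(3)[of a "2*pi"] a by auto
      have i3: "k * (c * (2 * pi - 0)) \<le> k * (area2 (2 * pi) - area2 0)" "k * (area2 (2 * pi) - area2 0) \<le> k * (C * (2 * pi - 0))"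
        using c(3)[of 0 "2*pi"] k by (auto intro!: mult_left_mono simp: k_def)
      have "c * (\<beta> - \<alpha>) = c * (b - 0) + k * (c * (2 * pi - 0)) + c * (2 * pi - a)"
        "C * (\<beta> - \<alpha>) = C * (b - 0) + k * (C * (2 * pi - 0)) + C * (2 * pi - a)"
        by (simp_all only: e1) (simp_all add: algebra_simps)
      then show ?thesis using i1 i2 i3 e2 by linarith
    qed
  qed
  then show thesis using that c(1,2) by blast
qed

lemma strict_mono_Theta: "strict_mono Theta"
proof (rule strict_monoI)
  obtain c C where c: "c > 0" "\<And>\<alpha> \<beta>. \<alpha> \<le> \<beta> \<Longrightarrow> c * (\<beta> - \<alpha>) \<le> Theta \<beta> - Theta \<alpha> \<and> Theta \<beta> - Theta \<alpha> \<le> C * (\<beta> - \<alpha>)"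
    by (rule Theta_bounds, rule that, assumption+)
  fix x y :: real assume "x < y"
  then have "0 < c * (y - x)" using c(1) by simp
  then show "Theta x < Theta y" using c(2)[of x y] \<open>x < y\<close> by simp
qed

lemma Theta_continuous: "continuous_on UNIV Theta"
proof -
  obtain c C where c: "C > 0" "\<And>\<alpha> \<beta>. \<alpha> \<le> \<beta> \<Longrightarrow> c * (\<beta> - \<alpha>) \<le> Theta \<beta> - Theta \<alpha> \<and> Theta \<beta> - Theta \<alpha> \<le> C * (\<beta> - \<alpha>)"
    by (rule Theta_bounds, rule that, assumption+)
  have "C-lipschitz_on UNIV Theta"
  proof (rule lipschitz_onI)
    fix x y :: real
    show "dist (Theta x) (Theta y) \<le> C * dist x y"
      using c(2)[of x y] c(2)[of y x] strict_mono_less_eq[OF strict_mono_Theta, of x y] strict_mono_less_eq[OF strict_mono_Theta, of y x]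
      by (cases "x \<le> y") (auto simp: dist_real_def)
  qed (use c in simp)
  then show ?thesis by (rule lipschitz_on_continuous_on)
qed

lemma surj_Theta: "surj Theta"
proof -
  obtain c C where c: "c > 0" "\<And>\<alpha> \<beta>. \<alpha> \<le> \<beta> \<Longrightarrow> c * (\<beta> - \<alpha>) \<le> Theta \<beta> - Theta \<alpha> \<and> Theta \<beta> - Theta \<alpha> \<le> C * (\<beta> - \<alpha>)"
    by (rule Theta_bounds, rule that, assumption+)
  have "\<exists>x. Theta x = y" for y
  proof -
    define r where "r = \<bar>y - Theta 0\<bar> / c"
    have "r \<ge> 0" using c(1) by (simp add: r_def)
    have "c * r = \<bar>y - Theta 0\<bar>" using c(1) by (simp add: r_def)
    then have "Theta (-r) \<le> y" "y \<le> Theta r"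
      using c(2)[of "-r" 0] c(2)[of 0 r] \<open>r \<ge> 0\<close> by auto
    then show ?thesis
      using IVT'[of Theta "-r" y r] \<open>r \<ge> 0\<close> Theta_continuous continuous_on_subset by force
  qed
  then show ?thesis by (metis surjI)
qed

text \<open>Reducing \<open>Theta \<alpha>\<close> modulo the period leaves \<open>area2\<close> of
  the reduced polar angle, and strict monotonicity of \<open>area2\<close> on a turn makes the point
  in the definite description of \<open>P_S\<close> unique.\<close>

lemma P_S_Theta: "P_S (Omega N) (Theta \<alpha>) = bd \<alpha>"
proof -
  define n where "n = \<lfloor>\<alpha> / (2 * pi)\<rfloor>"
  define a where "a = \<alpha> - 2 * pi * of_int n"
  obtain c C where c: "c > 0"
    "\<And>\<alpha> \<beta>. 0 \<le> \<alpha> \<Longrightarrow> \<alpha> \<le> \<beta> \<Longrightarrow> \<beta> \<le> 2 * pi \<Longrightarrow>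
       c * (\<beta> - \<alpha>) \<le> area2 \<beta> - area2 \<alpha> \<and> area2 \<beta> - area2 \<alpha> \<le> C * (\<beta> - \<alpha>)"
    and c0: "area2 0 = 0" and cpi: "area2 (2 * pi) = 2 * pi_S (Omega N)"
    by (rule area2_bounds, rule that, assumption+)
  have a: "0 \<le> a" "a < 2 * pi"
    using floor_divide_lower[of "2*pi" \<alpha>] floor_divide_upper[of "2*pi" \<alpha>]
    by (auto simp: a_def n_def algebra_simps)
  have less: "area2 x < area2 y" if "0 \<le> x" "x < y" "y \<le> 2 * pi" for x y
  proof -
    have "0 < c * (y - x)" using that c(1) by simp
    then show ?thesis using c(2)[of x y] that by simp
  qed
  have ar: "0 \<le> area2 a" "area2 a < 2 * pi_S (Omega N)"
    using less[of 0 a] less[of a "2*pi"] a c0 cpi by (cases "a = 0"; simp)+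
  have T: "Theta \<alpha> = area2 a + 2 * pi_S (Omega N) * of_int n" by (simp add: Theta_def a_def n_def)
  have "\<lfloor>Theta \<alpha> / (2 * pi_S (Omega N))\<rfloor> = n"
  proof -
    have "Theta \<alpha> / (2 * pi_S (Omega N)) = area2 a / (2 * pi_S (Omega N)) + of_int n"
      using pi_S_pos by (simp add: T field_simps)
    moreover have "\<lfloor>area2 a / (2 * pi_S (Omega N))\<rfloor> = 0"
      using ar pi_S_pos by (intro floor_unique) auto
    ultimately show ?thesis by simp
  qed
  then have r: "Theta \<alpha> - 2 * pi_S (Omega N) * of_int \<lfloor>Theta \<alpha> / (2 * pi_S (Omega N))\<rfloor> = area2 a"
    by (simp add: T)
  have bda: "bd \<alpha> = bd a" using bd_2pi[of a n] by (simp add: a_def)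
  show ?thesis
    unfolding P_S_def r Let_def
  proof (rule the_equality)
    show "bd \<alpha> \<in> frontier (Omega N) \<and> measure lborel {v \<in> Omega N. ang v \<le> ang (bd \<alpha>)} = area2 a / 2"
      using ang_bd[OF a] by (simp add: frontier_Omega area2_def bda)
  next
    fix P assume P: "P \<in> frontier (Omega N) \<and> measure lborel {v \<in> Omega N. ang v \<le> ang P} = area2 a / 2"
    then have "N P = 1" "area2 (ang P) = area2 a" by (auto simp: frontier_Omega area2_def)
    then have "ang P = a" using less[of "ang P" a] less[of a "ang P"] a ang_bounds[of P]
      by (cases "ang P" a rule: linorder_cases) auto
    then show "P = bd \<alpha>" using eq_bd_ang[OF \<open>N P = 1\<close>] bda by simp
  qed
qed

end

section \<open>Dual norm and corresponding angles\<close>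

declare split_paired_All [simp del] split_paired_Ex [simp del]

definition cross2 :: "pt2 \<Rightarrow> pt2 \<Rightarrow> real" where
  "cross2 a b = fst a * snd b - snd a * fst b"

lemma inner2: "(a::pt2) \<bullet> b = fst a * fst b + snd a * snd b"
  by (simp add: inner_prod_def)

text \<open>The Binet-Cauchy identity. It relates the orientation of two covectors to that of the
  vectors they are paired with.\<close>

lemma lagrange_cross2: "cross2 p q * cross2 x y = (p \<bullet> x) * (q \<bullet> y) - (p \<bullet> y) * (q \<bullet> x)"
  by (simp add: cross2_def inner2 algebra_simps)

lemma cross2_scale: "cross2 (r *\<^sub>R a) (s *\<^sub>R b) = r * s * cross2 a b"
  by (simp add: cross2_def algebra_simps)

lemma cross2_dirv: "cross2 (dirv \<alpha>) (dirv \<beta>) = sin (\<beta> - \<alpha>)"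
  by (simp add: cross2_def dirv_def sin_diff)

lemma inner_dirv: "dirv \<alpha> \<bullet> dirv \<beta> = cos (\<alpha> - \<beta>)"
  by (simp add: inner2 dirv_def cos_diff)

lemma abs_cross2_le: "\<bar>cross2 a b\<bar> \<le> norm a * norm b"
proof -
  have "cross2 a b = a \<bullet> (snd b, - fst b)" by (simp add: cross2_def inner2)
  moreover have "norm (snd b, - fst b) = norm b" by (cases b) (simp add: norm_Pair add.commute)
  ultimately show ?thesis using Cauchy_Schwarz_ineq2[of a "(snd b, - fst b)"] by simp
qed

lemma cross2_diff_self: "cross2 (a - b) b = cross2 a b"
  by (simp add: cross2_def algebra_simps)

text \<open>On the positive side, the derivative \<open>2 * cos x - 1\<close> of the difference is
  nonnegative as far as \<open>pi / 3\<close>.\<close>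

lemma abs_le_2_sin:
  assumes "\<bar>t\<bar> \<le> pi / 3" shows "\<bar>t\<bar> \<le> 2 * \<bar>sin t\<bar>"
proof -
  have "t \<le> 2 * sin t" if "0 \<le> t" "t \<le> pi / 3" for t
  proof -
    have "2 * sin 0 - 0 \<le> 2 * sin t - t"
    proof (rule DERIV_nonneg_imp_nondecreasing[OF that(1)])
      fix x assume x: "0 \<le> x" "x \<le> t"
      have "cos (pi / 3) \<le> cos x" using x that by (intro cos_monotone_0_pi_le) auto
      then have "0 \<le> 2 * cos x - 1" by (simp add: cos_60)
      moreover have "((\<lambda>t. 2 * sin t - t) has_real_derivative 2 * cos x - 1) (at x)"
        by (auto intro!: derivative_eq_intros)
      ultimately show "\<exists>y. ((\<lambda>t. 2 * sin t - t) has_real_derivative y) (at x) \<and> 0 \<le> y" by blast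
    qed
    then show ?thesis by simp
  qed
  from this[of t] this[of "-t"] assms show ?thesis by (cases "0 \<le> t") auto
qed

lemma abs_cos_diff_le: "\<bar>cos a - cos b\<bar> \<le> \<bar>a - b :: real\<bar>"
  and abs_sin_diff_le: "\<bar>sin a - sin b\<bar> \<le> \<bar>a - b\<bar>"
proof -
  have h: "\<bar>sin ((a - b) / 2)\<bar> \<le> \<bar>a - b\<bar> / 2" "\<bar>sin ((b - a) / 2)\<bar> \<le> \<bar>a - b\<bar> / 2"
    using abs_sin_x_le_abs_x[of "(a - b) / 2"] abs_sin_x_le_abs_x[of "(b - a) / 2"] by (auto simp: abs_minus_commute)
  have "\<bar>sin ((a + b) / 2)\<bar> * \<bar>sin ((b - a) / 2)\<bar> \<le> 1 * (\<bar>a - b\<bar> / 2)"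
    using h by (intro mult_mono) auto
  then show "\<bar>cos a - cos b\<bar> \<le> \<bar>a - b\<bar>" by (simp add: cos_diff_cos abs_mult)
  have "\<bar>sin ((a - b) / 2)\<bar> * \<bar>cos ((a + b) / 2)\<bar> \<le> (\<bar>a - b\<bar> / 2) * 1"
    using h by (intro mult_mono) auto
  then show "\<bar>sin a - sin b\<bar> \<le> \<bar>a - b\<bar>" by (simp add: sin_diff_sin abs_mult)
qed

lemma norm_dirv_diff: "norm (dirv a - dirv b) \<le> 2 * \<bar>a - b\<bar>"
proof -
  have "norm (dirv a - dirv b) \<le> norm (cos a - cos b) + norm (sin a - sin b)"
    using norm_Pair_le[of "cos a - cos b" "sin a - sin b"] by (simp add: dirv_def)
  moreover have "\<bar>cos a - cos b\<bar> \<le> \<bar>a - b\<bar>" "\<bar>sin a - sin b\<bar> \<le> \<bar>a - b\<bar>"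
    by (rule abs_cos_diff_le, rule abs_sin_diff_le)
  ultimately show ?thesis by simp
qed

context plane_norm
begin

lemma bd_inj: assumes "\<bar>a - b\<bar> < 2 * pi" "bd a = bd b" shows "a = b"
proof (rule dirv_eq_iff[OF assms(1)])
  have "norm (bd a) *\<^sub>R dirv a = bd a" "norm (bd b) *\<^sub>R dirv b = bd b"
    using N_dirv_pos[of a] N_dirv_pos[of b] by (simp_all add: bd_def)
  then show "dirv a = dirv b"
    using assms(2) N_bd[of a] by (metis N_0 norm_eq_zero scaleR_cancel_left zero_neq_one)
qed

lemma bd_Lipschitz: "\<exists>B>0. \<forall>a b. norm (bd a - bd b) \<le> B * \<bar>a - b\<bar>"
proof -
  obtain c where c: "c > 0" "\<And>x. c * norm x \<le> N x" by (rule N_lower, rule that, assumption+)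
  obtain C where C: "C > 0" "\<And>x. N x \<le> C * norm x" by (rule N_upper, rule that, assumption+)
  define B where "B = 2 / c + 2 * C / (c * c)"
  have "norm (bd a - bd b) \<le> B * \<bar>a - b\<bar>" for a b
  proof -
    have Na: "c \<le> N (dirv a)" and Nb: "c \<le> N (dirv b)" using c(2)[of "dirv a"] c(2)[of "dirv b"] by simp_all
    have "bd a - bd b = inverse (N (dirv a)) *\<^sub>R (dirv a - dirv b) + (inverse (N (dirv a)) - inverse (N (dirv b))) *\<^sub>R dirv b"
      by (simp add: bd_def algebra_simps)
    then have "norm (bd a - bd b) \<le> norm (inverse (N (dirv a)) *\<^sub>R (dirv a - dirv b)) + norm ((inverse (N (dirv a)) - inverse (N (dirv b))) *\<^sub>R dirv b)"
      by (metis norm_triangle_ineq)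
    also have "norm (inverse (N (dirv a)) *\<^sub>R (dirv a - dirv b)) \<le> (1 / c) * (2 * \<bar>a - b\<bar>)"
      using Na c(1) norm_dirv_diff[of a b] by (simp add: divide_inverse) (intro mult_mono; simp add: le_imp_inverse_le)
    also have "norm ((inverse (N (dirv a)) - inverse (N (dirv b))) *\<^sub>R dirv b) \<le> C * (2 * \<bar>a - b\<bar>) / (c * c)"
    proof -
      have "inverse (N (dirv a)) - inverse (N (dirv b)) = (N (dirv b) - N (dirv a)) / (N (dirv a) * N (dirv b))"
        using Na Nb c(1) by (simp add: field_simps)
      then have "norm ((inverse (N (dirv a)) - inverse (N (dirv b))) *\<^sub>R dirv b) = \<bar>N (dirv b) - N (dirv a)\<bar> / (N (dirv a) * N (dirv b))"
        by (simp add: abs_mult)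
      also have "\<dots> \<le> (C * (2 * \<bar>a - b\<bar>)) / (c * c)"
      proof (rule frac_le)
        have "\<bar>N (dirv b) - N (dirv a)\<bar> \<le> C * norm (dirv a - dirv b)"
          using N_diff[of "dirv a" "dirv b"] C(2)[of "dirv a - dirv b"] by linarith
        also have "\<dots> \<le> C * (2 * \<bar>a - b\<bar>)" using norm_dirv_diff[of a b] C(1) by (intro mult_left_mono) auto
        finally show "\<bar>N (dirv b) - N (dirv a)\<bar> \<le> C * (2 * \<bar>a - b\<bar>)" .
        show "c * c \<le> N (dirv a) * N (dirv b)" using Na Nb c(1) by (intro mult_mono) auto
      qed (use c C in auto)
      finally show ?thesis .
    qed
    finally show ?thesis by (simp add: B_def algebra_simps)
  qed
  moreover have "B > 0" using c C by (auto simp: B_def intro!: add_pos_pos divide_pos_pos)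
  ultimately show ?thesis by blast
qed

lemma cross2_bd: "cross2 (bd a) (bd b) = sin (b - a) / (N (dirv a) * N (dirv b))"
  by (simp add: bd_def cross2_scale cross2_dirv field_simps)

lemma abs_cross2_bd_le: "\<exists>B>0. \<forall>a b. \<bar>cross2 (bd a) (bd b)\<bar> \<le> B * \<bar>a - b\<bar>"
proof -
  obtain c where c: "c > 0" "\<And>x. c * norm x \<le> N x" by (rule N_lower, rule that, assumption+)
  have "\<bar>cross2 (bd a) (bd b)\<bar> \<le> 1 / (c * c) * \<bar>a - b\<bar>" for a b
  proof -
    have "c \<le> N (dirv a)" "c \<le> N (dirv b)" using c(2)[of "dirv a"] c(2)[of "dirv b"] by simp_all
    then have "c * c \<le> N (dirv a) * N (dirv b)" using c(1) by (intro mult_mono) auto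
    moreover have "\<bar>sin (b - a)\<bar> \<le> \<bar>a - b\<bar>" using abs_sin_x_le_abs_x[of "b - a"] by (simp add: abs_minus_commute)
    ultimately have "\<bar>sin (b - a)\<bar> / (N (dirv a) * N (dirv b)) \<le> \<bar>a - b\<bar> / (c * c)"
      using c(1) by (intro frac_le) auto
    then show ?thesis by (simp add: cross2_bd abs_mult)
  qed
  then show ?thesis using c(1) by (intro exI[of _ "1 / (c * c)"]) auto
qed

lemma norm_sphere_le: "\<exists>B>0. \<forall>x. N x = 1 \<longrightarrow> norm x \<le> B"
proof -
  obtain c where c: "c > 0" "\<And>x. c * norm x \<le> N x" by (rule N_lower, rule that, assumption+)
  have "norm x \<le> 1 / c" if "N x = 1" for x using c(2)[of x] c(1) that by (simp add: field_simps)
  then show ?thesis using c(1) by (intro exI[of _ "1 / c"]) auto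
qed

text \<open>A local Lipschitz inverse of \<open>bd\<close>. A positive inner product rules out an
  obtuse angle between the two points, and the sine of the angle is a multiple of a cross product,
  hence bounded by their distance.\<close>

lemma angle_near: "\<exists>A>0. \<exists>r>0. \<forall>x b. N x = 1 \<longrightarrow> norm (x - bd b) < r \<longrightarrow>
    (\<exists>a. x = bd a \<and> \<bar>a - b\<bar> \<le> pi / 3 \<and> \<bar>a - b\<bar> \<le> A * norm (x - bd b))"
proof -
  obtain C where C: "C > 0" "\<And>x. N x \<le> C * norm x" by (rule N_upper, rule that, assumption+)
  obtain S where S: "S > 0" "\<And>x. N x = 1 \<Longrightarrow> norm x \<le> S" using norm_sphere_le by blast
  \<comment> \<open>The first bound keeps \<open>x\<close> closer to \<open>bd b\<close> than the
    origin is, so that the inner product is positive; the second keeps the sine of the angle below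
    1/2.\<close>
  define r where "r = min (1 / C) (1 / (2 * C * C * S))"
  have "r > 0" using C S by (simp add: r_def)
  have "\<exists>a. x = bd a \<and> \<bar>a - b\<bar> \<le> pi / 3 \<and> \<bar>a - b\<bar> \<le> (2 * C * C * S) * norm (x - bd b)"
    if x: "N x = 1" and xb: "norm (x - bd b) < r" for x b
  proof -
    define y where "y = bd b"
    define \<gamma> where "\<gamma> = ang x"
    obtain n :: int where ab0: "\<bar>\<gamma> + 2 * pi * of_int n - b\<bar> \<le> pi" using ex_shift_2pi by blast
    define a where "a = \<gamma> + 2 * pi * of_int n"
    have ab: "\<bar>a - b\<bar> \<le> pi" using ab0 by (simp add: a_def)
    have xa: "x = bd a" using eq_bd_ang[OF x] bd_2pi[of \<gamma> n] by (simp add: a_def \<gamma>_def)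
    have ny: "1 / C \<le> norm y" "norm y \<le> S"
      using C(2)[of y] C(1) by (auto simp: y_def field_simps intro: S(2))
    have "x \<bullet> y > 0"
    proof -
      have "2 * (x \<bullet> y) = x \<bullet> x + y \<bullet> y - (x - y) \<bullet> (x - y)"
        by (simp add: inner_diff_left inner_diff_right inner_commute)
      moreover have "norm (x - y) < norm y" using xb ny by (simp add: r_def y_def)
      then have "(x - y) \<bullet> (x - y) < y \<bullet> y" by (simp add: norm_lt)
      ultimately show ?thesis using inner_ge_zero[of x] by linarith
    qed
    then have cs: "0 < cos \<bar>a - b\<bar>"
      using N_dirv_pos[of a] N_dirv_pos[of b] by (simp add: xa y_def bd_def inner_dirv zero_less_mult_iff)
    have CC: "N (dirv a) * N (dirv b) \<le> C * C"
      using C(2)[of "dirv a"] C(2)[of "dirv b"] C(1) by (intro mult_mono) auto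
    have cr: "\<bar>cross2 x y\<bar> \<le> norm (x - y) * S"
    proof -
      have "\<bar>cross2 x y\<bar> \<le> norm (x - y) * norm y" using abs_cross2_le[of "x - y" y] by (simp add: cross2_diff_self)
      also have "\<dots> \<le> norm (x - y) * S" using ny by (intro mult_left_mono) auto
      finally show ?thesis .
    qed
    have "\<bar>sin (b - a)\<bar> = (N (dirv a) * N (dirv b)) * \<bar>cross2 x y\<bar>"
      using N_dirv_pos[of a] N_dirv_pos[of b] by (simp add: cross2_bd abs_mult xa y_def)
    also have "\<dots> \<le> (C * C) * (norm (x - y) * S)" using CC cr C(1) by (rule_tac mult_mono) auto
    finally have sn: "\<bar>sin (a - b)\<bar> \<le> C * C * S * norm (x - y)"
      by (metis abs_minus_cancel minus_diff_eq mult.assoc mult.commute sin_minus)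
    have sn2: "\<bar>sin (a - b)\<bar> < 1/2"
    proof -
      have "norm (x - y) < 1 / (2 * C * C * S)" using xb by (simp add: r_def y_def)
      then have "norm (x - y) * (2 * C * C * S) < 1" using C S by (simp add: pos_less_divide_eq)
      then show ?thesis using sn by (simp add: mult_ac)
    qed
    have hp: "\<bar>a - b\<bar> < pi / 2"
    proof (rule ccontr)
      assume "\<not> ?thesis"
      then have "cos \<bar>a - b\<bar> \<le> cos (pi/2)" using ab by (intro cos_monotone_0_pi_le) auto
      then show False using cs by simp
    qed
    have a3: "\<bar>a - b\<bar> \<le> pi / 3"
    proof (rule ccontr)
      assume "\<not> ?thesis"
      then have "sin (pi/6) \<le> sin \<bar>a - b\<bar>" using hp by (intro sin_monotone_2pi_le) auto
      moreover have "sin \<bar>a - b\<bar> \<le> \<bar>sin (a - b)\<bar>"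
      proof (cases "a - b \<ge> 0")
        case False
        have "sin (b - a) = - sin (a - b)" by (metis minus_diff_eq sin_minus)
        then show ?thesis using False by (simp add: abs_if)
      qed simp
      ultimately show False using sn2 by (simp add: sin_30)
    qed
    have "\<bar>a - b\<bar> \<le> 2 * \<bar>sin (a - b)\<bar>" by (rule abs_le_2_sin[OF a3])
    also have "\<dots> \<le> (2 * C * C * S) * norm (x - y)" using sn by simp
    finally show ?thesis using xa a3 by (auto simp: y_def)
  qed
  then show ?thesis using \<open>r > 0\<close> C S
    by (intro exI[of _ "2 * C * C * S"] conjI exI[of _ r]) auto
qed

lemma compact_sphere: "compact {x. N x = 1}"
  using compact_frontier[OF compact_Omega] by (simp add: frontier_Omega)

end

section \<open>The dual norm and the polar body\<close>

definition dualN :: "(pt2 \<Rightarrow> real) \<Rightarrow> pt2 \<Rightarrow> real" where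
  "dualN N p = Sup ((\<lambda>x. p \<bullet> x) ` {x. N x = 1})"

context plane_norm
begin

lemma dual_attained: "\<exists>x. N x = 1 \<and> p \<bullet> x = dualN N p"
  and inner_le_dual1: "N y = 1 \<Longrightarrow> p \<bullet> y \<le> dualN N p"
proof -
  have ne: "{x. N x = 1} \<noteq> {}" using N_bd[of 0] by blast
  have "\<exists>x\<in>{x. N x = 1}. \<forall>y\<in>{x. N x = 1}. p \<bullet> y \<le> p \<bullet> x"
    by (rule continuous_attains_sup[OF compact_sphere ne]) (intro continuous_intros)
  then obtain x where x: "N x = 1" "\<And>y. N y = 1 \<Longrightarrow> p \<bullet> y \<le> p \<bullet> x" by blast
  then have *: "dualN N p = p \<bullet> x"
    unfolding dualN_def by (intro cSup_eq_maximum) auto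
  then show "\<exists>x. N x = 1 \<and> p \<bullet> x = dualN N p" using x(1) by metis
  show "p \<bullet> y \<le> dualN N p" if "N y = 1" using * x(2)[OF that] by simp
qed

lemma inner_le_dual: "p \<bullet> y \<le> dualN N p * N y"
proof (cases "y = 0")
  case False
  then have "N (inverse (N y) *\<^sub>R y) = 1" using N_pos[OF False] by (simp add: N_scale)
  from inner_le_dual1[OF this, of p] show ?thesis using N_pos[OF False] by (simp add: field_simps)
qed simp

lemma plane_norm_dual: "plane_norm (dualN N)"
proof
  show "is_norm2 (dualN N)"
    unfolding is_norm2_def
  proof (intro conjI allI)
    fix p q :: pt2 and c :: real
    show nn: "0 \<le> dualN N p" for p
      using inner_le_dual1[of "bd 0" p] inner_le_dual1[of "- bd 0" p] by (simp add: N_minus)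
    show "dualN N p = 0 \<longleftrightarrow> p = 0"
    proof
      assume "dualN N p = 0"
      then have "p \<bullet> p \<le> 0" using inner_le_dual[of p p] by simp
      then show "p = 0" using inner_ge_zero[of p] inner_eq_zero_iff[of p] by linarith
    next
      assume "p = 0"
      then show "dualN N p = 0" using dual_attained[of p] by auto
    qed
    have le: "dualN N (c *\<^sub>R p) \<le> \<bar>c\<bar> * dualN N p" for c p
    proof -
      obtain x where x: "N x = 1" "(c *\<^sub>R p) \<bullet> x = dualN N (c *\<^sub>R p)" using dual_attained by blast
      have "p \<bullet> (c *\<^sub>R x) \<le> dualN N p * N (c *\<^sub>R x)" by (rule inner_le_dual)
      then show ?thesis using x by (simp add: N_scale mult.commute)
    qed
    show "dualN N (c *\<^sub>R p) = \<bar>c\<bar> * dualN N p"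
    proof (cases "c = 0")
      case False
      have "\<bar>c\<bar> * dualN N p = \<bar>c\<bar> * dualN N (inverse c *\<^sub>R (c *\<^sub>R p))" using False by simp
      also have "\<dots> \<le> \<bar>c\<bar> * (\<bar>inverse c\<bar> * dualN N (c *\<^sub>R p))" by (intro mult_left_mono le) simp
      also have "\<dots> = dualN N (c *\<^sub>R p)" using False by (simp add: abs_inverse)
      finally show ?thesis using le[of c p] by linarith
    next
      case True
      then show ?thesis using le[of 0 p] nn[of "0 *\<^sub>R p"] by simp
    qed
    obtain x where x: "N x = 1" "(p + q) \<bullet> x = dualN N (p + q)" using dual_attained by blast
    then show "dualN N (p + q) \<le> dualN N p + dualN N q"
      using inner_le_dual1[of x p] inner_le_dual1[of x q] by (simp add: inner_add_left)
  qed
qed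

lemma polar_Omega: "polar_set (Omega N) = Omega (dualN N)"
proof (rule set_eqI)
  fix p
  obtain x where x: "N x = 1" "p \<bullet> x = dualN N p" using dual_attained by blast
  have "p \<bullet> y \<le> 1" if "dualN N p \<le> 1" "N y \<le> 1" for y
  proof -
    have "p \<bullet> y \<le> dualN N p * N y" by (rule inner_le_dual)
    also have "\<dots> \<le> 1 * N y" using that by (intro mult_right_mono) auto
    finally show ?thesis using that by simp
  qed
  moreover have "dualN N p \<le> 1" if "\<forall>y. N y \<le> 1 \<longrightarrow> p \<bullet> y \<le> 1"
    using that[rule_format, of x] x by simp
  ultimately show "p \<in> polar_set (Omega N) \<longleftrightarrow> p \<in> Omega (dualN N)"
    unfolding polar_set_def Omega_def by blast
qed

end

section \<open>The duality map of a smooth, strongly convex norm\<close>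

locale sc_norm = plane_norm N + D: plane_norm "dualN N" for N +
  assumes smooth: "C1_norm N" and sconv: "strongly_convex_norm N"
begin

text \<open>\<open>N y - p \<bullet> y\<close> is nonnegative and vanishes at \<open>x\<close>, so
  \<open>p\<close> is the gradient of \<open>N\<close> at \<open>x\<close>. Differentiability of the
  norm enters through this lemma alone.\<close>

lemma supp_unique:
  assumes x: "N x = 1" and p: "dualN N p = 1" "p \<bullet> x = 1" and q: "dualN N q = 1" "q \<bullet> x = 1"
  shows "p = q"
proof -
  obtain D where D: "\<And>x. x \<noteq> 0 \<Longrightarrow> (N has_derivative (\<lambda>h. D x \<bullet> h)) (at x)"
    using smooth unfolding C1_norm_def by blast
  have "x \<noteq> 0" using x by auto
  have *: "p = D x" if p: "dualN N p = 1" "p \<bullet> x = 1" for p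
  proof -
    have "((\<lambda>y. N y - p \<bullet> y) has_derivative (\<lambda>h. D x \<bullet> h - p \<bullet> h)) (at x)"
      by (intro derivative_intros D \<open>x \<noteq> 0\<close>)
    then have "(\<lambda>h. D x \<bullet> h - p \<bullet> h) = (\<lambda>h. 0)"
    proof (rule differential_zero_maxmin[of x UNIV, rotated 2])
      show "(\<forall>y\<in>UNIV. N y - p \<bullet> y \<le> N x - p \<bullet> x) \<or> (\<forall>y\<in>UNIV. N x - p \<bullet> x \<le> N y - p \<bullet> y)"
        using inner_le_dual[of p] p x by simp
    qed auto
    then have "(D x - p) \<bullet> (D x - p) = 0" by (metis inner_diff_left)
    then show ?thesis by simp
  qed
  show ?thesis using *[OF p] *[OF q] by simp
qed

text \<open>Strong convexity is applied at the point \<open>z\<close> that lies a fraction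
  \<open>t\<close> of the way from \<open>x\<close> to \<open>y\<close>. Comparison with
  \<open>p \<bullet> z \<le> N z\<close> and division by \<open>t\<close> leave the quadratic gap as
  \<open>t\<close> tends to 0.\<close>

lemma strong_supp: "\<exists>\<kappa>>0. \<forall>p x y. dualN N p = 1 \<longrightarrow> N x = 1 \<longrightarrow> p \<bullet> x = 1 \<longrightarrow> N y = 1 \<longrightarrow> \<kappa> * (N (x - y))\<^sup>2 \<le> 1 - p \<bullet> y"
proof -
  obtain a where a: "a > 0" "\<And>x y t. t \<in> {0..1} \<Longrightarrow>
     (N (t *\<^sub>R x + (1 - t) *\<^sub>R y))\<^sup>2 / 2 \<le> t * ((N x)\<^sup>2 / 2) + (1 - t) * ((N y)\<^sup>2 / 2) - a / 2 * t * (1 - t) * (N (x - y))\<^sup>2"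
    using sconv unfolding strongly_convex_norm_def Let_def by blast
  have "a / 2 * (N (x - y))\<^sup>2 \<le> 1 - p \<bullet> y"
    if p: "dualN N p = 1" and x: "N x = 1" "p \<bullet> x = 1" and y: "N y = 1" for p x y
  proof (rule field_le_epsilon)
    fix e :: real assume "e > 0"
    define Q where "Q = a / 2 * (N (x - y))\<^sup>2"
    have "Q \<ge> 0" using a(1) by (simp add: Q_def)
    \<comment> \<open>Small enough that the term \<open>t * Q\<close>, which disappears in the
      limit, is at most \<open>e\<close>.\<close>
    define t where "t = min (1/2) (e / (Q + 1))"
    have t: "0 < t" "t \<le> 1/2" "t \<le> e / (Q + 1)"
    proof -
      show "0 < t" using \<open>e > 0\<close> \<open>Q \<ge> 0\<close> by (simp add: t_def)
    qed (simp_all only: t_def min.cobounded1 min.cobounded2)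
    have tQ: "t * Q \<le> e"
    proof -
      have "t * Q \<le> t * (Q + 1)" using t by simp
      also have "\<dots> \<le> e / (Q + 1) * (Q + 1)" using t \<open>Q \<ge> 0\<close> by (intro mult_right_mono) auto
      finally show ?thesis using \<open>Q \<ge> 0\<close> by simp
    qed
    define z where "z = t *\<^sub>R y + (1 - t) *\<^sub>R x"
    have "p \<bullet> z \<le> N z" using inner_le_dual[of p z] p by simp
    moreover have "2 * N z - 1 \<le> (N z)\<^sup>2" using zero_le_power2[of "N z - 1"] by (simp add: power2_diff)
    moreover have "(N z)\<^sup>2 / 2 \<le> t * (1 / 2) + (1 - t) * (1 / 2) - t * ((1 - t) * Q)"
    proof -
      have "N (y - x) = N (x - y)" using N_minus[of "x - y"] by simp
      then have "a / 2 * t * (1 - t) * (N (y - x))\<^sup>2 = t * ((1 - t) * Q)" by (simp add: Q_def)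
      moreover have "(N z)\<^sup>2 / 2 \<le> t * ((N y)\<^sup>2 / 2) + (1 - t) * ((N x)\<^sup>2 / 2) - a / 2 * t * (1 - t) * (N (y - x))\<^sup>2"
        unfolding z_def by (rule a(2)) (use t in auto)
      ultimately show ?thesis by (simp only: x y power_one)
    qed
    moreover have "p \<bullet> z = t * (p \<bullet> y) + (1 - t)" using x by (simp add: z_def inner_add_right)
    moreover have "t * (1 / 2) + (1 - t) * (1 / 2) = (1 / 2 :: real)" by (simp add: field_simps)
    ultimately have "t * (p \<bullet> y) + (1 - t) - 1/2 \<le> 1 / 2 - t * ((1 - t) * Q)"
      by linarith
    then have "t * ((1 - t) * Q) \<le> t * (1 - p \<bullet> y)" by (simp add: algebra_simps)
    then have "(1 - t) * Q \<le> 1 - p \<bullet> y" using t by simp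
    moreover have "(1 - t) * Q = Q - t * Q" by (simp add: algebra_simps)
    ultimately show "a / 2 * (N (x - y))\<^sup>2 \<le> 1 - p \<bullet> y + e"
      using tQ unfolding Q_def[symmetric] by linarith
  qed
  then show ?thesis using a(1) by (intro exI[of _ "a/2"]) auto
qed

text \<open>On the dual sphere this is the duality map, and the choice is unique by
  \<open>G_unique\<close>.\<close>

definition G :: "pt2 \<Rightarrow> pt2" where
  "G p = (SOME x. N x = 1 \<and> p \<bullet> x = dualN N p)"

lemma G: "N (G p) = 1" "p \<bullet> G p = dualN N p"
  using someI_ex[OF dual_attained[of p]] unfolding G_def by auto

lemma G_unique: assumes "dualN N p = 1" "N x = 1" "p \<bullet> x = 1" shows "x = G p"
proof -
  obtain \<kappa> where "\<kappa> > 0" and \<kappa>: "\<forall>p x y. dualN N p = 1 \<longrightarrow> N x = 1 \<longrightarrow> p \<bullet> x = 1 \<longrightarrow> N y = 1 \<longrightarrow> \<kappa> * (N (x - y))\<^sup>2 \<le> 1 - p \<bullet> y"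
    using strong_supp by blast
  have "\<kappa> * (N (x - G p))\<^sup>2 \<le> 1 - p \<bullet> G p" using \<kappa> assms G(1) by blast
  then have "\<kappa> * (N (x - G p))\<^sup>2 \<le> 0" using G(2)[of p] assms by simp
  then have "(N (x - G p))\<^sup>2 \<le> 0" using \<open>\<kappa> > 0\<close> by (simp add: mult_le_0_iff)
  then show ?thesis by simp
qed

text \<open>Adding the quadratic gaps of \<open>p\<close> at \<open>G q\<close> and of
  \<open>q\<close> at \<open>G p\<close> gives
  \<open>2 * \<kappa> * n * n \<le> (p - q) \<bullet> (G p - G q)\<close> with
  \<open>n = N (G p - G q)\<close>, and the right side is at most
  \<open>dualN N (p - q) * n\<close>.\<close>

lemma G_Lipschitz: "\<exists>L>0. \<forall>p q. dualN N p = 1 \<longrightarrow> dualN N q = 1 \<longrightarrow> norm (G p - G q) \<le> L * norm (p - q)"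
proof -
  obtain \<kappa> where "\<kappa> > 0" and \<kappa>: "\<forall>p x y. dualN N p = 1 \<longrightarrow> N x = 1 \<longrightarrow> p \<bullet> x = 1 \<longrightarrow> N y = 1 \<longrightarrow> \<kappa> * (N (x - y))\<^sup>2 \<le> 1 - p \<bullet> y"
    using strong_supp by blast
  obtain c where c: "c > 0" "\<And>x. c * norm x \<le> N x" by (rule N_lower, rule that, assumption+)
  obtain C where C: "C > 0" "\<And>x. dualN N x \<le> C * norm x" by (rule D.N_upper, rule that, assumption+)
  have "norm (G p - G q) \<le> C / (2 * \<kappa> * c) * norm (p - q)" if p: "dualN N p = 1" and q: "dualN N q = 1" for p q
  proof -
    define n where "n = N (G p - G q)"
    have "\<kappa> * (N (G p - G q))\<^sup>2 \<le> 1 - p \<bullet> G q" "\<kappa> * (N (G q - G p))\<^sup>2 \<le> 1 - q \<bullet> G p"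
      using \<kappa> p q G G(2)[of p] G(2)[of q] by auto
    moreover have "N (G q - G p) = n" using N_minus[of "G q - G p"] by (simp add: n_def)
    moreover have "(p - q) \<bullet> (G p - G q) = (1 - p \<bullet> G q) + (1 - q \<bullet> G p)"
      using G(2)[of p] G(2)[of q] p q by (simp add: inner_diff_left inner_diff_right)
    moreover have "(p - q) \<bullet> (G p - G q) \<le> dualN N (p - q) * n" unfolding n_def by (rule inner_le_dual)
    ultimately have "(2 * \<kappa> * n) * n \<le> dualN N (p - q) * n"
      by (simp add: n_def power2_eq_square)
    then have "2 * \<kappa> * n \<le> dualN N (p - q)"
      using N_nonneg[of "G p - G q"] D.N_nonneg[of "p - q"] unfolding n_def[symmetric]
      by (cases "n = 0") auto
    also have "\<dots> \<le> C * norm (p - q)" by (rule C)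
    finally have "n \<le> C / (2 * \<kappa>) * norm (p - q)" using \<open>\<kappa> > 0\<close> by (simp add: field_simps)
    moreover have "c * norm (G p - G q) \<le> n" unfolding n_def by (rule c)
    ultimately have "c * norm (G p - G q) \<le> C / (2 * \<kappa>) * norm (p - q)" by linarith
    then show ?thesis using c(1) \<open>\<kappa> > 0\<close> by (simp add: field_simps)
  qed
  moreover have "C / (2 * \<kappa> * c) > 0" using C c \<open>\<kappa> > 0\<close> by simp
  ultimately show ?thesis by blast
qed

end

section \<open>The correspondence of directions and of angles\<close>

context sc_norm
begin

text \<open>A covector makes an acute angle with the unit vector it selects; this singles out a lift \<open>g\<close> of
  the correspondence of directions to polar angles on the line.\<close>

lemma lift_ex: "\<exists>\<alpha>. \<beta> - pi/2 < \<alpha> \<and> \<alpha> < \<beta> + pi/2 \<and> bd \<alpha> = G (D.bd \<beta>)"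
proof -
  define x where "x = G (D.bd \<beta>)"
  have x: "N x = 1" "D.bd \<beta> \<bullet> x = 1" using G[of "D.bd \<beta>"] by (simp_all add: x_def)
  define \<gamma> where "\<gamma> = ang x"
  have xg: "x = bd \<gamma>" using eq_bd_ang[OF x(1)] by (simp add: \<gamma>_def)
  obtain k :: int where b0: "\<bar>\<gamma> + 2 * pi * of_int k - \<beta>\<bar> \<le> pi" using ex_shift_2pi by blast
  define \<alpha> where "\<alpha> = \<gamma> + 2 * pi * of_int k"
  have b: "\<bar>\<alpha> - \<beta>\<bar> \<le> pi" using b0 by (simp add: \<alpha>_def)
  have xa: "x = bd \<alpha>" using bd_2pi[of \<gamma> k] xg by (simp add: \<alpha>_def)
  have "0 < D.bd \<beta> \<bullet> bd \<alpha>" using x xa by simp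
  then have "0 < cos (\<beta> - \<alpha>)"
    using D.N_dirv_pos[of \<beta>] N_dirv_pos[of \<alpha>] by (simp add: D.bd_def bd_def inner_dirv zero_less_mult_iff)
  then have c: "0 < cos \<bar>\<alpha> - \<beta>\<bar>" by (metis abs_minus_commute cos_abs_real)
  have "\<bar>\<alpha> - \<beta>\<bar> < pi/2"
  proof (rule ccontr)
    assume "\<not> ?thesis"
    then have "cos \<bar>\<alpha> - \<beta>\<bar> \<le> cos (pi/2)" using b by (intro cos_monotone_0_pi_le) auto
    then show False using c by simp
  qed
  then have "\<beta> - pi/2 < \<alpha>" "\<alpha> < \<beta> + pi/2" by linarith+
  then show ?thesis using xa x_def by (intro exI[of _ \<alpha>]) simp
qed

definition g :: "real \<Rightarrow> real" where
  "g \<beta> = (SOME \<alpha>. \<beta> - pi/2 < \<alpha> \<and> \<alpha> < \<beta> + pi/2 \<and> bd \<alpha> = G (D.bd \<beta>))"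

lemma g: "\<beta> - pi/2 < g \<beta>" "g \<beta> < \<beta> + pi/2" "bd (g \<beta>) = G (D.bd \<beta>)"
  using someI_ex[OF lift_ex[of \<beta>]] unfolding g_def by auto

lemma g_2pi: "g (\<beta> + 2 * pi * of_int k) = g \<beta> + 2 * pi * of_int k"
proof (rule bd_inj)
  show "\<bar>g (\<beta> + 2 * pi * of_int k) - (g \<beta> + 2 * pi * of_int k)\<bar> < 2 * pi"
    using g(1,2)[of \<beta>] g(1,2)[of "\<beta> + 2 * pi * of_int k"] pi_gt_zero by (simp add: abs_if)
  show "bd (g (\<beta> + 2 * pi * of_int k)) = bd (g \<beta> + 2 * pi * of_int k)"
    by (simp add: g(3) bd_2pi D.bd_2pi)
qed

lemma inner_bd_g: "D.bd \<beta> \<bullet> bd (g \<beta>) = 1"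
  using G(2)[of "D.bd \<beta>"] by (simp add: g(3))

text \<open>Were the order reversed, the covectors and the unit vectors they select would have cross
  products of opposite signs. By Binet-Cauchy \<open>(p1 \<bullet> x2) * (p2 \<bullet> x1)\<close>
  would exceed 1, while both factors are at most 1 and the first is positive. Equality is excluded
  by \<open>supp_unique\<close>.\<close>

lemma strict_mono_g: "strict_mono g"
proof (rule strict_monoI, rule ccontr)
  fix b1 b2 :: real assume "b1 < b2" and "\<not> g b1 < g b2"
  then have le: "g b2 \<le> g b1" by simp
  have lt: "b2 - b1 < pi" using g(1)[of b2] g(2)[of b1] le by linarith
  define p1 p2 x1 x2 where "p1 = D.bd b1" "p2 = D.bd b2" "x1 = bd (g b1)" "x2 = bd (g b2)"
  note defs = p1_p2_x1_x2_def
  show False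
  proof (cases "g b1 = g b2")
    case True
    have "p1 = p2"
      by (rule supp_unique[of x1]) (use inner_bd_g[of b1] inner_bd_g[of b2] True in \<open>simp_all add: defs\<close>)
    then have "b1 = b2" using lt \<open>b1 < b2\<close> by (intro D.bd_inj) (auto simp: defs)
    then show False using \<open>b1 < b2\<close> by simp
  next
    case False
    have d: "0 < g b1 - g b2" "g b1 - g b2 < pi"
      using False le g(1)[of b2] g(2)[of b1] \<open>b1 < b2\<close> by linarith+
    have "cross2 p1 p2 > 0"
      using sin_gt_zero[of "b2 - b1"] \<open>b1 < b2\<close> lt by (simp add: defs D.cross2_bd)
    moreover have "cross2 x1 x2 < 0"
    proof -
      have "sin (g b2 - g b1) < 0" using sin_gt_zero[OF d] by (metis minus_diff_eq neg_less_0_iff_less sin_minus)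
      then show ?thesis by (simp add: defs cross2_bd divide_neg_pos)
    qed
    ultimately have "cross2 p1 p2 * cross2 x1 x2 < 0" by (rule mult_pos_neg)
    then have "1 < (p1 \<bullet> x2) * (p2 \<bullet> x1)"
      using inner_bd_g[of b1] inner_bd_g[of b2] by (simp add: lagrange_cross2 defs)
    moreover have "p1 \<bullet> x2 \<le> 1" "p2 \<bullet> x1 \<le> 1"
      using inner_le_dual1[of x2 p1] inner_le_dual1[of x1 p2] by (simp_all add: defs)
    moreover have "p1 \<bullet> x2 > 0"
    proof -
      have "cos (b1 - g b2) > 0"
        using g(1)[of b2] g(2)[of b1] le \<open>b1 < b2\<close> by (intro cos_gt_zero_pi) linarith+
      then show ?thesis by (simp add: defs bd_def D.bd_def inner_dirv)
    qed
    ultimately show False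
      by (smt (verit) mult_le_cancel_left1 mult_le_cancel_left2)
  qed
qed

lemma g_Lipschitz: "\<exists>L>0. \<exists>r>0. \<forall>a b. \<bar>a - b\<bar> < r \<longrightarrow> \<bar>g a - g b\<bar> \<le> L * \<bar>a - b\<bar>"
proof -
  obtain L where L: "L > 0" "\<And>p q. dualN N p = 1 \<Longrightarrow> dualN N q = 1 \<Longrightarrow> norm (G p - G q) \<le> L * norm (p - q)"
    using G_Lipschitz by blast
  obtain B where B: "B > 0" "\<And>a b. norm (D.bd a - D.bd b) \<le> B * \<bar>a - b\<bar>"
    using D.bd_Lipschitz by blast
  obtain A r where A: "A > 0" "r > 0" "\<And>x b. N x = 1 \<Longrightarrow> norm (x - bd b) < r \<Longrightarrow>
      \<exists>a. x = bd a \<and> \<bar>a - b\<bar> \<le> pi / 3 \<and> \<bar>a - b\<bar> \<le> A * norm (x - bd b)"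
    using angle_near by blast
  have xd: "norm (bd (g a) - bd (g b)) \<le> (L * B) * \<bar>a - b\<bar>" for a b
  proof -
    have "norm (bd (g a) - bd (g b)) \<le> L * norm (D.bd a - D.bd b)"
      using L(2)[of "D.bd a" "D.bd b"] by (simp add: g(3))
    also have "\<dots> \<le> L * (B * \<bar>a - b\<bar>)" using B(2) L(1) by (intro mult_left_mono) auto
    finally show ?thesis by (simp add: mult.assoc)
  qed
  have "\<bar>g a - g b\<bar> \<le> A * (L * B) * \<bar>a - b\<bar>" if ab: "\<bar>a - b\<bar> < min (pi / 3) (r / (L * B))" for a b
  proof -
    have "(L * B) * \<bar>a - b\<bar> < r" using ab L(1) B(1) by (simp add: pos_less_divide_eq mult.commute)
    then have "norm (bd (g a) - bd (g b)) < r" using xd[of a b] by linarith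
    then obtain \<alpha> where \<alpha>: "bd (g a) = bd \<alpha>" "\<bar>\<alpha> - g b\<bar> \<le> pi / 3" "\<bar>\<alpha> - g b\<bar> \<le> A * norm (bd (g a) - bd (g b))"
      using A(3)[of "bd (g a)" "g b"] by auto
    have "\<bar>a - b\<bar> < pi / 3" using ab by simp
    \<comment> \<open>\<open>g a\<close> and \<open>g b\<close> lie within \<open>pi / 2\<close> of
      their arguments, so the two representatives of the same direction differ by less than a full
      turn and coincide.\<close>
    then have "\<bar>g a - \<alpha>\<bar> < 2 * pi" using g(1,2)[of a] g(1,2)[of b] \<alpha>(2) by linarith
    then have "g a = \<alpha>" using \<alpha>(1) by (rule bd_inj)
    then have "\<bar>g a - g b\<bar> \<le> A * norm (bd (g a) - bd (g b))" using \<alpha>(3) by simp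
    also have "\<dots> \<le> A * ((L * B) * \<bar>a - b\<bar>)" using xd A(1) by (intro mult_left_mono) auto
    finally show ?thesis by (simp add: mult_ac)
  qed
  then show ?thesis using A L(1) B(1)
    by (intro exI[of _ "A * (L * B)"] conjI exI[of _ "min (pi / 3) (r / (L * B))"]) auto
qed

definition Dinv :: "real \<Rightarrow> real" where "Dinv = inv D.Theta"

lemma Theta_Dinv [simp]: "D.Theta (Dinv \<phi>) = \<phi>"
  by (simp add: Dinv_def surj_f_inv_f D.surj_Theta)

lemma Dinv_Theta [simp]: "Dinv (D.Theta \<beta>) = \<beta>"
  by (simp add: Dinv_def inv_f_f strict_mono_imp_inj_on D.strict_mono_Theta)

lemma Dinv_less: "Dinv x < Dinv y \<longleftrightarrow> x < y"
  using strict_mono_less[OF D.strict_mono_Theta, of "Dinv x" "Dinv y"] by simp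

lemma Dinv_Lipschitz: "\<exists>L>0. \<forall>x y. \<bar>Dinv x - Dinv y\<bar> \<le> L * \<bar>x - y\<bar>"
proof -
  obtain c C where c: "c > 0" "\<And>\<alpha> \<beta>. \<alpha> \<le> \<beta> \<Longrightarrow> c * (\<beta> - \<alpha>) \<le> D.Theta \<beta> - D.Theta \<alpha> \<and> D.Theta \<beta> - D.Theta \<alpha> \<le> C * (\<beta> - \<alpha>)"
    by (rule D.Theta_bounds, rule that, assumption+)
  have "c * \<bar>Dinv x - Dinv y\<bar> \<le> \<bar>x - y\<bar>" for x y
    using c(2)[of "Dinv x" "Dinv y"] c(2)[of "Dinv y" "Dinv x"] by (cases "Dinv x \<le> Dinv y") auto
  then have "\<bar>Dinv x - Dinv y\<bar> \<le> 1 / c * \<bar>x - y\<bar>" for x y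
    using c(1) by (simp add: field_simps)
  then show ?thesis using c(1) by (intro exI[of _ "1/c"]) auto
qed

lemma Dinv_2pi: "Dinv (\<phi> + 2 * pi_S (Omega (dualN N)) * of_int k) = Dinv \<phi> + 2 * pi * of_int k"
proof -
  have "D.Theta (Dinv \<phi> + 2 * pi * of_int k) = \<phi> + 2 * pi_S (Omega (dualN N)) * of_int k"
    by (simp add: D.Theta_2pi)
  then show ?thesis by (metis Dinv_Theta)
qed

text \<open>The correspondence of polar angles, transported to swept areas on both sides;
  \<open>Ccirc N\<close> is \<open>C0\<close> plus a constant.\<close>

definition C0 :: "real \<Rightarrow> real" where
  "C0 \<phi> = Theta (g (Dinv \<phi>))"

lemma strict_mono_C0: "strict_mono C0"
  by (rule strict_monoI)
    (simp add: C0_def strict_mono_less[OF strict_mono_Theta] strict_mono_less[OF strict_mono_g] Dinv_less)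

lemma C0_shift: "C0 (\<phi> + 2 * pi_S (Omega (dualN N)) * of_int k) = C0 \<phi> + 2 * pi_S (Omega N) * of_int k"
  by (simp add: C0_def Dinv_2pi g_2pi Theta_2pi)

lemma corresponds_iff: "corresponds N \<theta> \<phi> \<longleftrightarrow> D.bd (Dinv \<phi>) \<bullet> P_S (Omega N) \<theta> = 1"
proof -
  have "P_S (polar_set (Omega N)) \<phi> = D.bd (Dinv \<phi>)"
    using D.P_S_Theta[of "Dinv \<phi>"] by (simp add: polar_Omega)
  then show ?thesis by (simp add: corresponds_def cos_S_def sin_S_def inner2 mult.commute)
qed

text \<open>\<open>Ccirc\<close> is a choice among the normalised selections, so both their existence and their
  uniqueness up to an additive constant are needed.\<close>

lemma Ccirc_rel_C0: "Ccirc_rel N C0"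
  unfolding Ccirc_rel_def
proof (intro conjI allI)
  show "mono C0" by (rule strict_mono_mono[OF strict_mono_C0])
  show "corresponds N (C0 \<phi>) \<phi>" for \<phi>
    by (simp add: corresponds_iff C0_def P_S_Theta inner_bd_g)
  show "C0 (\<phi> + 2 * of_int k * pi_S (polar_set (Omega N))) = C0 \<phi> + 2 * of_int k * pi_S (Omega N)" for \<phi> k
    using C0_shift[of \<phi> k] by (simp add: polar_Omega mult_ac)
qed

text \<open>Corresponding angles are unique modulo the period \<open>p\<close>, so
  \<open>C \<phi>\<close> and \<open>C0 \<phi>\<close> differ by an integer multiple of
  \<open>p\<close>. The integer is periodic in \<phi> with period \<open>q\<close>, and monotonicity
  of \<open>C\<close> keeps it from dropping within one period; hence it is constant.\<close>

lemma Ccirc_rel_unique: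
  assumes C: "Ccirc_rel N C"
  shows "\<exists>d. \<forall>\<phi>. C \<phi> = C0 \<phi> + d"
proof -
  define p where "p = 2 * pi_S (Omega N)"
  define q where "q = 2 * pi_S (Omega (dualN N))"
  have "p > 0" "q > 0" using pi_S_pos D.pi_S_pos by (auto simp: p_def q_def)
  have shift: "C (\<phi> + q * of_int k) = C \<phi> + p * of_int k" "C0 (\<phi> + q * of_int k) = C0 \<phi> + p * of_int k" for \<phi> k
    using C C0_shift[of \<phi> k] unfolding Ccirc_rel_def by (auto simp: p_def q_def polar_Omega mult_ac)
  have "\<exists>n::int. C \<phi> = C0 \<phi> + p * of_int n" for \<phi>
  proof -
    obtain \<alpha> where \<alpha>: "Theta \<alpha> = C \<phi>" using surj_Theta by (metis surj_def)
    have "corresponds N (C \<phi>) \<phi>" using C by (simp add: Ccirc_rel_def)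
    then have "D.bd (Dinv \<phi>) \<bullet> bd \<alpha> = 1" using P_S_Theta[of \<alpha>] by (simp add: corresponds_iff \<alpha>)
    then have "bd \<alpha> = G (D.bd (Dinv \<phi>))" by (intro G_unique) auto
    then have eq: "bd \<alpha> = bd (g (Dinv \<phi>))" by (simp add: g(3))
    define k where "k = \<lfloor>(\<alpha> - g (Dinv \<phi>)) / (2 * pi)\<rfloor>"
    have "\<alpha> + 2 * pi * of_int (- k) = g (Dinv \<phi>)"
    proof (rule bd_inj)
      show "\<bar>\<alpha> + 2 * pi * of_int (- k) - g (Dinv \<phi>)\<bar> < 2 * pi"
        using floor_divide_lower[of "2*pi" "\<alpha> - g (Dinv \<phi>)"] floor_divide_upper[of "2*pi" "\<alpha> - g (Dinv \<phi>)"]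
        by (auto simp: k_def algebra_simps)
      show "bd (\<alpha> + 2 * pi * of_int (- k)) = bd (g (Dinv \<phi>))" using eq by (simp only: bd_2pi)
    qed
    then have "\<alpha> = g (Dinv \<phi>) + 2 * pi * of_int k" by simp
    then have "C \<phi> = C0 \<phi> + p * of_int k" using \<alpha> Theta_2pi[of "g (Dinv \<phi>)" k] by (simp add: C0_def p_def)
    then show ?thesis by blast
  qed
  then obtain n :: "real \<Rightarrow> int" where n: "\<And>\<phi>. C \<phi> = C0 \<phi> + p * of_int (n \<phi>)" by metis
  have nshift: "n (\<phi> + q * of_int k) = n \<phi>" for \<phi> k
  proof -
    have "p * of_int (n (\<phi> + q * of_int k)) = p * of_int (n \<phi>)" using shift[of \<phi> k] n[of \<phi>] n[of "\<phi> + q * of_int k"] by simp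
    then show ?thesis using \<open>p > 0\<close> by simp
  qed
  have ge: "n x \<le> n y" if "x < y" "y < x + q" for x y
  proof (rule ccontr)
    assume "\<not> ?thesis"
    then have "real_of_int (n y) \<le> real_of_int (n x) - 1" by linarith
    then have "p * of_int (n y) \<le> p * (of_int (n x) - 1)" using \<open>p > 0\<close> by (intro mult_left_mono) auto
    moreover have "C x \<le> C y" using C that(1) by (auto simp: Ccirc_rel_def mono_def)
    moreover have "C0 y < C0 x + p"
      using strict_monoD[OF strict_mono_C0 that(2)] shift(2)[of x 1] by simp
    ultimately show False using n[of x] n[of y] by (simp add: algebra_simps)
  qed
  have same: "n x = n y" if "x < y" "y < x + q" for x y
  proof (rule antisym[OF ge[OF that]])
    \<comment> \<open>The pair \<open>y\<close>, \<open>x + q\<close> also satisfies the assumptions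
      of \<open>ge\<close>, and periodicity turns the result into the reverse inequality.\<close>
    have "n y \<le> n (x + q * of_int 1)" by (rule ge) (use that in auto)
    then show "n y \<le> n x" by (simp only: nshift)
  qed
  have "n x = n 0" for x
  proof -
    define k where "k = \<lfloor>x / q\<rfloor>"
    define y where "y = x - q * of_int k"
    have y: "0 \<le> y" "y < q"
      using floor_divide_lower[OF \<open>q > 0\<close>, of x] floor_divide_upper[OF \<open>q > 0\<close>, of x]
      by (auto simp: y_def k_def algebra_simps)
    have "n x = n y" using nshift[of y k] by (simp add: y_def)
    also have "n y = n 0" using same[of 0 y] y by (cases "y = 0") auto
    finally show ?thesis .
  qed
  then show ?thesis using n by metis
qed

lemma Ccirc_eq: "\<exists>d. \<forall>\<phi>. Ccirc N \<phi> = C0 \<phi> + d"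
  using Ccirc_rel_unique[OF someI[of "Ccirc_rel N", OF Ccirc_rel_C0]] by (simp add: Ccirc_def)

lemma C0_continuous: "continuous_on UNIV C0" and surj_C0: "surj C0"
  and C0_Lipschitz: "\<exists>L>0. \<exists>r>0. \<forall>x y. \<bar>x - y\<bar> < r \<longrightarrow> \<bar>C0 x - C0 y\<bar> \<le> L * \<bar>x - y\<bar>"
proof -
  obtain L1 where L1: "L1 > 0" "\<And>x y. \<bar>Dinv x - Dinv y\<bar> \<le> L1 * \<bar>x - y\<bar>" using Dinv_Lipschitz by blast
  obtain L2 r2 where L2: "L2 > 0" "r2 > 0" "\<And>a b. \<bar>a - b\<bar> < r2 \<Longrightarrow> \<bar>g a - g b\<bar> \<le> L2 * \<bar>a - b\<bar>" using g_Lipschitz by blast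
  obtain c L3 where L3: "L3 > 0" "\<And>\<alpha> \<beta>. \<alpha> \<le> \<beta> \<Longrightarrow> c * (\<beta> - \<alpha>) \<le> Theta \<beta> - Theta \<alpha> \<and> Theta \<beta> - Theta \<alpha> \<le> L3 * (\<beta> - \<alpha>)"
    by (rule Theta_bounds, rule that, assumption+)
  have L3': "\<bar>Theta a - Theta b\<bar> \<le> L3 * \<bar>a - b\<bar>" for a b
    using L3(2)[of a b] L3(2)[of b a] strict_mono_less_eq[OF strict_mono_Theta, of a b] strict_mono_less_eq[OF strict_mono_Theta, of b a]
    by (cases "a \<le> b") auto
  have lip: "\<bar>C0 x - C0 y\<bar> \<le> (L3 * (L2 * L1)) * \<bar>x - y\<bar>" if "\<bar>x - y\<bar> < r2 / L1" for x y
  proof -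
    have "\<bar>C0 x - C0 y\<bar> \<le> L3 * \<bar>g (Dinv x) - g (Dinv y)\<bar>" unfolding C0_def by (rule L3')
    also have "\<bar>g (Dinv x) - g (Dinv y)\<bar> \<le> L2 * \<bar>Dinv x - Dinv y\<bar>"
    proof (rule L2(3))
      have "L1 * \<bar>x - y\<bar> < r2" using that L1(1) by (simp add: pos_less_divide_eq mult.commute)
      then show "\<bar>Dinv x - Dinv y\<bar> < r2" using L1(2)[of x y] by linarith
    qed
    also have "\<bar>Dinv x - Dinv y\<bar> \<le> L1 * \<bar>x - y\<bar>" by (rule L1)
    finally show ?thesis using L1(1) L2(1) L3(1) by (simp add: mult_left_mono mult_ac)
  qed
  then show l: "\<exists>L>0. \<exists>r>0. \<forall>x y. \<bar>x - y\<bar> < r \<longrightarrow> \<bar>C0 x - C0 y\<bar> \<le> L * \<bar>x - y\<bar>"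
    using L1(1) L2(1,2) L3(1) by (intro exI[of _ "L3 * (L2 * L1)"] conjI exI[of _ "r2 / L1"]) auto
  define L where "L = L3 * (L2 * L1)"
  have "L > 0" using L1 L2 L3 by (simp add: L_def)
  show cont: "continuous_on UNIV C0"
    unfolding continuous_on_iff
  proof (intro ballI allI impI)
    fix x e :: real assume "e > 0"
    show "\<exists>d>0. \<forall>x'\<in>UNIV. dist x' x < d \<longrightarrow> dist (C0 x') (C0 x) < e"
    proof (intro exI[of _ "min (r2 / L1) (e / L)"] conjI ballI impI)
      fix y assume "dist y x < min (r2 / L1) (e / L)"
      then have y: "\<bar>y - x\<bar> < r2 / L1" "\<bar>y - x\<bar> < e / L" by (auto simp: dist_real_def)
      have "\<bar>C0 y - C0 x\<bar> \<le> L * \<bar>y - x\<bar>" using lip[OF y(1)] by (simp add: L_def)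
      also have "\<dots> < e" using y(2) \<open>L > 0\<close> by (simp add: pos_less_divide_eq mult.commute)
      finally show "dist (C0 y) (C0 x) < e" by (simp add: dist_real_def)
    qed (use L1 L2 \<open>e > 0\<close> \<open>L > 0\<close> in auto)
  qed
  have "\<exists>x. C0 x = y" for y
  proof -
    define p where "p = 2 * pi_S (Omega N)"
    define q where "q = 2 * pi_S (Omega (dualN N))"
    have "p > 0" "q > 0" using pi_S_pos D.pi_S_pos by (auto simp: p_def q_def)
    define k :: int where "k = \<lfloor>(y - C0 0) / p\<rfloor>"
    have "C0 (q * of_int k) \<le> y" "y \<le> C0 (q * of_int (k + 1))"
      using C0_shift[of 0 k] C0_shift[of 0 "k+1"] floor_divide_lower[OF \<open>p > 0\<close>, of "y - C0 0"] floor_divide_upper[OF \<open>p > 0\<close>, of "y - C0 0"]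
      by (auto simp: k_def p_def q_def algebra_simps)
    then show ?thesis
      using IVT'[of C0 "q * of_int k" y "q * of_int (k + 1)"] \<open>q > 0\<close> cont continuous_on_subset by force
  qed
  then show "surj C0" by (metis surjI)
qed

end

section \<open>Flatness of the correspondence at the critical angle\<close>

context sc_norm
begin

text \<open>Near the critical angle the derivative of \<open>Ccirc\<close>, wherever it exists, is
  at most the n-th power of the distance, so \<open>diff_le_of_deriv_le\<close> bounds the
  increments by one power more. The bounds on \<open>Theta\<close> and \<open>D.Theta\<close> carry
  this over to polar angles.\<close>

proposition g_flat:
  assumes "\<forall>\<alpha>::real. \<alpha> \<ge> 2 \<longrightarrow>
           (\<lambda>\<phi>. deriv (Ccirc N) \<phi>) \<in> o[at \<phi>s within D1 N](\<lambda>\<phi>. \<bar>\<phi> - \<phi>s\<bar> powr (\<alpha> - 2))"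
  shows "\<exists>A>0. \<exists>r>0. \<forall>\<beta>. \<bar>\<beta> - Dinv \<phi>s\<bar> < r \<longrightarrow> \<bar>g \<beta> - g (Dinv \<phi>s)\<bar> \<le> A * \<bar>\<beta> - Dinv \<phi>s\<bar> ^ Suc n"
proof -
  obtain d where d: "\<And>\<phi>. Ccirc N \<phi> = C0 \<phi> + d" using Ccirc_eq by blast
  have Cfun: "Ccirc N = (\<lambda>\<phi>. C0 \<phi> + d)" using d by auto
  have sm: "strict_mono (Ccirc N)"
    by (rule strict_monoI) (simp add: d strict_mono_less[OF strict_mono_C0])
  have "continuous_on UNIV (\<lambda>\<phi>. C0 \<phi> + d)"
    by (rule continuous_on_add[OF C0_continuous continuous_on_const])
  then have ct: "continuous_on UNIV (Ccirc N)"
    by (rule ssubst[OF Cfun])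
  have sj: "surj (Ccirc N)"
  proof -
    have "\<exists>x. Ccirc N x = y" for y
    proof -
      obtain x where "y - d = C0 x" using surjD[OF surj_C0, of "y - d"] by (elim exE)
      then have "Ccirc N x = y" by (simp add: d)
      then show ?thesis by (rule exI)
    qed
    then show ?thesis by (metis surjI)
  qed
  obtain L r0 where L: "L > 0" "r0 > 0" "\<And>x y. \<bar>x - y\<bar> < r0 \<Longrightarrow> \<bar>C0 x - C0 y\<bar> \<le> L * \<bar>x - y\<bar>" using C0_Lipschitz by blast
  have lip: "\<exists>T B. open T \<and> x \<in> T \<and> (\<forall>y\<in>T. \<bar>Ccirc N y - Ccirc N x\<bar> \<le> B * \<bar>y - x\<bar>)" for x
    using L by (intro exI[of _ "ball x r0"] exI[of _ L]) (auto simp: d dist_real_def abs_minus_commute)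
  \<comment> \<open>The order n + 2 makes the exponent in the hypothesis equal to
    \<open>n\<close>.\<close>
  have small: "(\<lambda>\<phi>. deriv (Ccirc N) \<phi>) \<in> o[at \<phi>s within D1 N](\<lambda>\<phi>. \<bar>\<phi> - \<phi>s\<bar> powr ((real n + 2) - 2))"
    by (rule mp[OF spec[OF assms]]) linarith
  have "eventually (\<lambda>\<phi>. norm (deriv (Ccirc N) \<phi>) \<le> 1 * norm (\<bar>\<phi> - \<phi>s\<bar> powr ((real n + 2) - 2))) (at \<phi>s within D1 N)"
    by (rule landau_o.smallD[OF small zero_less_one])
  then obtain r1 where r1: "r1 > 0" "\<And>\<phi>. \<phi> \<in> D1 N \<Longrightarrow> \<phi> \<noteq> \<phi>s \<Longrightarrow> dist \<phi> \<phi>s < r1 \<Longrightarrow> \<bar>deriv (Ccirc N) \<phi>\<bar> \<le> \<bar>\<phi> - \<phi>s\<bar> powr real n"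
    unfolding eventually_at by auto
  have der: "deriv (Ccirc N) \<phi> \<le> h ^ n" if "Ccirc N differentiable (at \<phi>)" "\<phi> \<noteq> \<phi>s" "\<bar>\<phi> - \<phi>s\<bar> \<le> h" "h < r1" for \<phi> h
  proof -
    have "\<bar>deriv (Ccirc N) \<phi>\<bar> \<le> \<bar>\<phi> - \<phi>s\<bar> powr real n" using that by (intro r1) (auto simp: D1_def dist_real_def)
    \<comment> \<open>Here \<phi> differs from \<phi>s; at base 0, \<open>powr\<close> is 0 even for
      exponent 0.\<close>
    also have "\<dots> = \<bar>\<phi> - \<phi>s\<bar> ^ n" using that by (simp add: powr_realpow)
    also have "\<dots> \<le> h ^ n" using that by (intro power_mono) auto
    finally show ?thesis by simp
  qed
  have C0flat: "\<bar>C0 \<phi> - C0 \<phi>s\<bar> \<le> \<bar>\<phi> - \<phi>s\<bar> ^ Suc n" if "\<bar>\<phi> - \<phi>s\<bar> < r1" for \<phi>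
  proof (cases "\<phi>s \<le> \<phi>")
    case True
    have "Ccirc N \<phi> - Ccirc N \<phi>s \<le> (\<phi> - \<phi>s) ^ n * (\<phi> - \<phi>s)"
      by (rule diff_le_of_deriv_le[OF sm ct sj lip _ True]) (use that in \<open>auto intro!: der\<close>)
    then show ?thesis using True strict_mono_less_eq[OF strict_mono_C0, of \<phi>s \<phi>] by (simp add: d mult.commute)
  next
    case False
    have "Ccirc N \<phi>s - Ccirc N \<phi> \<le> (\<phi>s - \<phi>) ^ n * (\<phi>s - \<phi>)"
      by (rule diff_le_of_deriv_le[OF sm ct sj lip _]) (use that False in \<open>auto intro!: der\<close>)
    then show ?thesis using False strict_mono_less_eq[OF strict_mono_C0, of \<phi> \<phi>s] by (simp add: d mult.commute abs_if)
  qed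
  obtain c L3 where c: "c > 0" "\<And>\<alpha> \<beta>. \<alpha> \<le> \<beta> \<Longrightarrow> c * (\<beta> - \<alpha>) \<le> Theta \<beta> - Theta \<alpha> \<and> Theta \<beta> - Theta \<alpha> \<le> L3 * (\<beta> - \<alpha>)"
    by (rule Theta_bounds, rule that, assumption+)
  have c': "\<bar>a - b\<bar> \<le> 1 / c * \<bar>Theta a - Theta b\<bar>" for a b
  proof -
    have "c * \<bar>a - b\<bar> \<le> \<bar>Theta a - Theta b\<bar>"
      using c(2)[of a b] c(2)[of b a] by (cases "a \<le> b") auto
    then show ?thesis using c(1) by (simp add: field_simps)
  qed
  obtain cD LD where LD: "LD > 0" "\<And>\<alpha> \<beta>. \<alpha> \<le> \<beta> \<Longrightarrow> cD * (\<beta> - \<alpha>) \<le> D.Theta \<beta> - D.Theta \<alpha> \<and> D.Theta \<beta> - D.Theta \<alpha> \<le> LD * (\<beta> - \<alpha>)"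
    by (rule D.Theta_bounds, rule that, assumption+)
  have LD': "\<bar>D.Theta a - D.Theta b\<bar> \<le> LD * \<bar>a - b\<bar>" for a b
    using LD(2)[of a b] LD(2)[of b a] strict_mono_less_eq[OF D.strict_mono_Theta, of a b] strict_mono_less_eq[OF D.strict_mono_Theta, of b a]
    by (cases "a \<le> b") auto
  have "\<bar>g \<beta> - g (Dinv \<phi>s)\<bar> \<le> (1 / c * LD ^ Suc n) * \<bar>\<beta> - Dinv \<phi>s\<bar> ^ Suc n" if "\<bar>\<beta> - Dinv \<phi>s\<bar> < r1 / LD" for \<beta>
  proof -
    have b: "\<bar>D.Theta \<beta> - \<phi>s\<bar> \<le> LD * \<bar>\<beta> - Dinv \<phi>s\<bar>" using LD'[of \<beta> "Dinv \<phi>s"] by simp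
    have "LD * \<bar>\<beta> - Dinv \<phi>s\<bar> < r1" using that LD(1) by (simp add: pos_less_divide_eq mult.commute)
    then have "\<bar>C0 (D.Theta \<beta>) - C0 \<phi>s\<bar> \<le> \<bar>D.Theta \<beta> - \<phi>s\<bar> ^ Suc n" using b by (intro C0flat) linarith
    also have "\<dots> \<le> (LD * \<bar>\<beta> - Dinv \<phi>s\<bar>) ^ Suc n" using b by (intro power_mono) auto
    finally have "\<bar>Theta (g \<beta>) - Theta (g (Dinv \<phi>s))\<bar> \<le> (LD * \<bar>\<beta> - Dinv \<phi>s\<bar>) ^ Suc n" by (simp add: C0_def)
    then have "1 / c * \<bar>Theta (g \<beta>) - Theta (g (Dinv \<phi>s))\<bar> \<le> 1 / c * (LD * \<bar>\<beta> - Dinv \<phi>s\<bar>) ^ Suc n"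
      using c(1) by (intro mult_left_mono) auto
    then show ?thesis using c'[of "g \<beta>" "g (Dinv \<phi>s)"] by (simp only: power_mult_distrib mult.assoc)
  qed
  then show ?thesis using c(1) LD(1) r1(1)
    by (intro exI[of _ "1 / c * LD ^ Suc n"] conjI exI[of _ "r1 / LD"]) auto
qed

end

section \<open>A frame in which the dual unit ball is flat to infinite order\<close>

definition jrot :: "pt2 \<Rightarrow> pt2" where
  "jrot a = (- snd a, fst a)"

text \<open>The interface between convex trigonometry and the metric argument. By
  \<open>calib_le\<close> and \<open>calib_eq\<close> the covectors \<open>(1 - H s) p + s q\<close>
  lie on the dual sphere and select the direction \<open>e + k s v\<close>; the hypothesis on
  \<open>Ccirc\<close> survives as \<open>K_flat\<close>.\<close>

locale flat_frame = plane_norm N for N +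
  fixes e v p q :: pt2 and s0 :: real and H k K :: "real \<Rightarrow> real"
  assumes pe: "p \<bullet> e = 1" and pv: "p \<bullet> v = 0" and qe: "q \<bullet> e = 0" and qv: "q \<bullet> v = 1"
    and ev: "cross2 e v = 1" and s0: "s0 > 0"
    and calib_le: "\<And>s u. \<bar>s\<bar> \<le> s0 \<Longrightarrow> (1 - H s) * (p \<bullet> u) + s * (q \<bullet> u) \<le> N u"
    and calib_eq: "\<And>s. \<bar>s\<bar> \<le> s0 \<Longrightarrow> N (e + k s *\<^sub>R v) = 1 - H s + s * k s"
    and H_deriv: "\<And>s. \<bar>s\<bar> < s0 \<Longrightarrow> (H has_real_derivative k s) (at s)"
    and K_deriv: "\<And>s. \<bar>s\<bar> < s0 \<Longrightarrow> (K has_real_derivative H s) (at s)"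
    and k_cont: "continuous_on {-s0..s0} k"
    and k_strict: "\<And>s t. - s0 \<le> s \<Longrightarrow> s < t \<Longrightarrow> t \<le> s0 \<Longrightarrow> k s < k t"
    and k0: "k 0 = 0" and H0: "H 0 = 0" and K0: "K 0 = 0"
    and K_flat: "\<And>n. \<exists>A>0. \<exists>r>0. \<forall>s. \<bar>s\<bar> < r \<longrightarrow> \<bar>K s\<bar> \<le> A * \<bar>s\<bar> ^ n"

context sc_norm
begin

text \<open>\<open>H\<close> is the convex conjugate of \<open>h - 1\<close>, where \<open>h\<close>
  is the norm along the affine line \<open>e + w v\<close>, and \<open>k\<close> is the derivative
  of \<open>H\<close>, that is, the maximising \<open>w\<close>. Strong convexity makes
  \<open>k\<close> continuous, differentiability of the norm makes it strictly increasing, and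
  \<open>flat\<close> makes it vanish to every order.\<close>

proposition ex_flat_frame:
  assumes flat: "\<And>n. \<exists>A>0. \<exists>r>0. \<forall>\<beta>. \<bar>\<beta> - \<beta>s\<bar> < r \<longrightarrow> \<bar>g \<beta> - g \<beta>s\<bar> \<le> A * \<bar>\<beta> - \<beta>s\<bar> ^ Suc n"
  shows "\<exists>e v p q s0 H k K. flat_frame N e v p q s0 H k K"
proof -
  define p where "p = D.bd \<beta>s"
  define e where "e = G p"
  \<comment> \<open>Quarter turns give the orthogonality relations at once and reduce
    \<open>qv\<close> and \<open>ev\<close> to \<open>pe\<close>.\<close>
  define v where "v = jrot p"
  define q where "q = jrot e"
  have dp: "dualN N p = 1" by (simp add: p_def)
  have Ne: "N e = 1" and pe: "p \<bullet> e = 1" using G[of p] dp by (simp_all add: e_def)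
  have pv: "p \<bullet> v = 0" and qe: "q \<bullet> e = 0" by (simp_all add: v_def q_def jrot_def inner2)
  have qv: "q \<bullet> v = 1" using pe by (simp add: v_def q_def jrot_def inner2 algebra_simps)
  have ev: "cross2 e v = 1" using pe by (simp add: v_def jrot_def inner2 cross2_def algebra_simps)
  have decomp: "u = (p \<bullet> u) *\<^sub>R e + (q \<bullet> u) *\<^sub>R v" for u
  proof -
    have "fst u = fst u * (p \<bullet> e)" "snd u = snd u * (p \<bullet> e)" using pe by simp_all
    then show ?thesis
      by (auto simp: prod_eq_iff v_def q_def jrot_def inner2 algebra_simps)
  qed
  have "v \<noteq> 0" using qv by auto
  have "q \<noteq> 0" using qv by auto
  define B where "B = dualN N q"
  have "B > 0" using D.N_pos[OF \<open>q \<noteq> 0\<close>] by (simp add: B_def)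
  have qB: "\<bar>q \<bullet> u\<bar> \<le> B * N u" for u
    using inner_le_dual[of q u] inner_le_dual[of q "-u"] by (simp add: B_def N_minus abs_le_iff)
  define h where "h w = N (e + w *\<^sub>R v)" for w
  have h0: "h 0 = 1" by (simp add: h_def Ne)
  have h1: "1 \<le> h w" for w
    using inner_le_dual[of p "e + w *\<^sub>R v"] dp by (simp add: h_def inner_add_right pe pv)
  have hB: "\<bar>w\<bar> \<le> B * h w" for w
    using qB[of "e + w *\<^sub>R v"] by (simp add: h_def inner_add_right qe qv)
  have hcont: "continuous_on S h" for S
    unfolding h_def by (rule continuous_on_compose2[OF N_continuous[of UNIV]]) (auto intro!: continuous_intros)
  \<comment> \<open>Since \<open>\<bar>w\<bar> \<le> B * h w\<close>, for slopes up to
    \<open>1 / (4 * B)\<close> the values \<open>h w - s * w\<close> with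
    \<open>\<bar>w\<bar> > 2 * B\<close> exceed the value 1 taken at \<open>w = 0\<close>; the
    minimum is therefore attained on a compact interval.\<close>
  define s1 where "s1 = 1 / (4 * B)"
  have "s1 > 0" using \<open>B > 0\<close> by (simp add: s1_def)
  have "\<exists>w. \<bar>w\<bar> \<le> 2 * B \<and> (\<forall>w'. h w - s * w \<le> h w' - s * w')" if s: "\<bar>s\<bar> \<le> s1" for s
  proof -
    have "\<exists>w\<in>{-(2*B)..2*B}. \<forall>w'\<in>{-(2*B)..2*B}. h w - s * w \<le> h w' - s * w'"
      using \<open>B > 0\<close> by (intro continuous_attains_inf) (auto intro!: continuous_intros hcont)
    then obtain w where w: "w \<in> {-(2*B)..2*B}" "\<And>w'. w' \<in> {-(2*B)..2*B} \<Longrightarrow> h w - s * w \<le> h w' - s * w'"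
      by blast
    have "h w - s * w \<le> h w' - s * w'" for w'
    proof (cases "\<bar>w'\<bar> \<le> 2 * B")
      case False
      have "h w - s * w \<le> 1" using w(2)[of 0] h0 \<open>B > 0\<close> by simp
      moreover have "1 \<le> h w' - s * w'"
      proof -
        have "s * w' \<le> \<bar>s\<bar> * \<bar>w'\<bar>" by (metis abs_ge_self abs_mult)
        also have "\<dots> \<le> s1 * \<bar>w'\<bar>" using s by (intro mult_right_mono) auto
        finally have "B * (s * w') \<le> \<bar>w'\<bar> / 4" using \<open>B > 0\<close> by (simp add: s1_def field_simps)
        moreover have "\<bar>w'\<bar> \<le> B * h w'" by (rule hB)
        ultimately have "B * 1 \<le> B * (h w' - s * w')" using False by (simp add: right_diff_distrib)
        then show ?thesis using \<open>B > 0\<close> by (simp only: mult_le_cancel_left_pos)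
      qed
      ultimately show ?thesis by linarith
    next
      case True
      then have "w' \<in> {-(2*B)..2*B}" by auto
      then show ?thesis by (rule w(2))
    qed
    then show ?thesis using w(1) by (intro exI[of _ w]) auto
  qed
  then obtain k where k: "\<And>s. \<bar>s\<bar> \<le> s1 \<Longrightarrow> \<bar>k s\<bar> \<le> 2 * B" "\<And>s w'. \<bar>s\<bar> \<le> s1 \<Longrightarrow> h (k s) - s * k s \<le> h w' - s * w'"
    by metis
  define H where "H s = 1 - (h (k s) - s * k s)" for s
  have Heq: "h (k s) = 1 - H s + s * k s" for s by (simp add: H_def)
  have Hle: "1 - H s + s * w \<le> h w" if "\<bar>s\<bar> \<le> s1" for s w
    using k(2)[OF that, of w] by (simp add: H_def)
  have Hnn: "0 \<le> H s" if "\<bar>s\<bar> \<le> s1" for s using Hle[OF that, of 0] h0 by simp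
  have Hub: "H s \<le> 2 * B * \<bar>s\<bar>" if "\<bar>s\<bar> \<le> s1" for s
  proof -
    have "s * k s \<le> \<bar>s\<bar> * \<bar>k s\<bar>" by (metis abs_ge_self abs_mult)
    also have "\<dots> \<le> \<bar>s\<bar> * (2 * B)" using k(1)[OF that] by (intro mult_left_mono) auto
    finally show ?thesis using h1[of "k s"] by (simp add: H_def mult_ac)
  qed
  have H1: "H s \<le> 1" if "\<bar>s\<bar> \<le> s1" for s
  proof -
    have "2 * B * \<bar>s\<bar> \<le> 2 * B * s1" using that \<open>B > 0\<close> by (intro mult_left_mono) auto
    then show ?thesis using Hub[OF that] \<open>B > 0\<close> by (simp add: s1_def)
  qed
  have calib: "(1 - H s) * (p \<bullet> u) + s * (q \<bullet> u) \<le> N u" if s: "\<bar>s\<bar> \<le> s1" for s u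
  proof (cases "p \<bullet> u > 0")
    case True
    define X Y where "X = p \<bullet> u" and "Y = q \<bullet> u"
    have "X > 0" using True by (simp add: X_def)
    have "u = X *\<^sub>R (e + (Y / X) *\<^sub>R v)"
      using decomp[of u] \<open>X > 0\<close> by (simp add: X_def Y_def scaleR_add_right)
    then have "N u = X * h (Y / X)" using \<open>X > 0\<close> by (metis N_scale abs_of_pos h_def)
    moreover have "X * (1 - H s + s * (Y / X)) \<le> X * h (Y / X)"
      using Hle[OF s, of "Y / X"] \<open>X > 0\<close> by (intro mult_left_mono) auto
    moreover have "X * (1 - H s + s * (Y / X)) = (1 - H s) * X + s * Y" using \<open>X > 0\<close> by (simp add: field_simps)
    ultimately show ?thesis by (simp add: X_def Y_def)
  next
    case False
    have "(1 - H s) * (p \<bullet> u) \<le> 0" using False H1[OF s] by (intro mult_nonneg_nonpos) auto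
    moreover have "s * (q \<bullet> u) \<le> \<bar>s\<bar> * \<bar>q \<bullet> u\<bar>" by (metis abs_ge_self abs_mult)
    moreover have "\<bar>s\<bar> * \<bar>q \<bullet> u\<bar> \<le> s1 * (B * N u)" using s qB[of u] \<open>B > 0\<close> by (intro mult_mono) auto
    moreover have "s1 * (B * N u) \<le> N u" using \<open>B > 0\<close> by (simp add: s1_def)
    ultimately show ?thesis by linarith
  qed
  have H0: "H 0 = 0" using Hub[of 0] Hnn[of 0] \<open>s1 > 0\<close> by simp
  have k0: "k 0 = 0"
  proof -
    have 1: "N (e + k 0 *\<^sub>R v) = 1" using Heq[of 0] H0 by (simp add: h_def)
    have "p \<bullet> (e + k 0 *\<^sub>R v) = 1" by (simp add: inner_add_right pe pv)
    then have "e + k 0 *\<^sub>R v = e" using G_unique[OF dp 1] unfolding e_def by blast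
    then show ?thesis using \<open>v \<noteq> 0\<close> by simp
  qed
  \<comment> \<open>\<open>k s\<close> is a subgradient of \<open>H\<close> at \<open>s\<close>: the
    supremum that gives \<open>H t\<close> is tested with the maximiser for
    \<open>s\<close>.\<close>
  have Hsub: "H s + k s * (t - s) \<le> H t" if "\<bar>t\<bar> \<le> s1" for s t
    using Hle[OF that, of "k s"] by (simp add: Heq algebra_simps)
  have kabs: "\<bar>H t - H s\<bar> \<le> 2 * B * \<bar>t - s\<bar>" if "\<bar>s\<bar> \<le> s1" "\<bar>t\<bar> \<le> s1" for s t
  proof -
    have "H s - H t \<le> 2 * B * \<bar>t - s\<bar>" if "\<bar>s\<bar> \<le> s1" "\<bar>t\<bar> \<le> s1" for s t
    proof -
      have "H s - H t \<le> k s * (s - t)" using Hsub[OF that(2), of s] by (simp add: algebra_simps)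
      also have "\<dots> \<le> \<bar>k s\<bar> * \<bar>s - t\<bar>" by (metis abs_ge_self abs_mult)
      also have "\<dots> \<le> (2 * B) * \<bar>t - s\<bar>" using k(1)[OF that(1)] by (intro mult_mono) (auto simp: abs_minus_commute)
      finally show ?thesis .
    qed
    from this[OF that] this[OF that(2,1)] show ?thesis by (simp add: abs_le_iff abs_minus_commute)
  qed
  \<comment> \<open>The chart of the dual sphere, and next the unnormalised vector that it selects;
    through them \<open>k\<close> inherits its properties from \<open>G\<close> and
    \<open>supp_unique\<close>.\<close>
  define P where "P s = (1 - H s) *\<^sub>R p + s *\<^sub>R q" for s
  define U where "U s = e + k s *\<^sub>R v" for s
  have Pu: "P s \<bullet> u = (1 - H s) * (p \<bullet> u) + s * (q \<bullet> u)" for s u by (simp add: P_def inner_add_left)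
  have PU: "P s \<bullet> U s = N (U s)" for s
    using Heq[of s] by (simp add: Pu U_def inner_add_right pe pv qe qv h_def)
  have NU: "N (U s) > 0" for s using h1[of "k s"] by (simp add: h_def U_def)
  have dP: "dualN N (P s) = 1" if s: "\<bar>s\<bar> \<le> s1" for s
  proof -
    obtain x where "N x = 1" "P s \<bullet> x = dualN N (P s)" using dual_attained by blast
    then have "dualN N (P s) \<le> 1" using calib[OF s, of x] by (simp add: Pu)
    moreover have "1 * N (U s) \<le> dualN N (P s) * N (U s)" using inner_le_dual[of "P s" "U s"] by (simp add: PU)
    then have "1 \<le> dualN N (P s)" using NU[of s] by (simp only: mult_le_cancel_right_pos)
    ultimately show ?thesis by simp
  qed
  have nz: "U s \<noteq> 0" for s using NU[of s] by auto
  have GP: "G (P s) = inverse (N (U s)) *\<^sub>R U s" if s: "\<bar>s\<bar> \<le> s1" for s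
    using nz[of s] PU[of s] by (intro G_unique[OF dP[OF s], symmetric]) (auto simp: N_scale)
  have kinj: "s = t" if "\<bar>s\<bar> \<le> s1" "\<bar>t\<bar> \<le> s1" "k s = k t" for s t
  proof -
    have "U s = U t" using that by (simp add: U_def)
    then have GG: "G (P s) = G (P t)" using GP that by simp
    have "P s = P t"
      by (rule supp_unique[of "G (P s)"])
        (use G[of "P s"] G[of "P t"] dP[OF that(1)] dP[OF that(2)] GG in simp_all)
    then have "P s \<bullet> v = P t \<bullet> v" by simp
    then show ?thesis by (simp add: Pu pv qv)
  qed
  have kmono: "k s < k t" if "- s1 \<le> s" "s < t" "t \<le> s1" for s t
  proof -
    have st: "\<bar>s\<bar> \<le> s1" "\<bar>t\<bar> \<le> s1" using that by auto
    have "k s * (t - s) \<le> k t * (t - s)" using Hsub[OF st(2), of s] Hsub[OF st(1), of t] by (simp add: algebra_simps)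
    then have "k s \<le> k t" using that(2) by simp
    moreover have "k s \<noteq> k t" using kinj[OF st] that(2) by auto
    ultimately show ?thesis by simp
  qed
  obtain L where L: "L > 0" "\<And>p q. dualN N p = 1 \<Longrightarrow> dualN N q = 1 \<Longrightarrow> norm (G p - G q) \<le> L * norm (p - q)"
    using G_Lipschitz by blast
  define M where "M = 2 * B * norm p + norm q"
  have "M > 0" using \<open>B > 0\<close> \<open>q \<noteq> 0\<close> by (simp add: M_def add_nonneg_pos)
  have PM: "norm (P s - P t) \<le> M * \<bar>s - t\<bar>" if "\<bar>s\<bar> \<le> s1" "\<bar>t\<bar> \<le> s1" for s t
  proof -
    have "P s - P t = (H t - H s) *\<^sub>R p + (s - t) *\<^sub>R q" by (simp add: P_def algebra_simps)
    then have "norm (P s - P t) \<le> \<bar>H t - H s\<bar> * norm p + \<bar>s - t\<bar> * norm q"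
      by (metis norm_scaleR norm_triangle_ineq)
    also have "\<dots> \<le> (2 * B * \<bar>t - s\<bar>) * norm p + \<bar>s - t\<bar> * norm q"
      using kabs[OF that] by (intro add_right_mono mult_right_mono) auto
    finally show ?thesis by (simp add: M_def algebra_simps abs_minus_commute)
  qed
  have Gcont: "continuous_on {-s1..s1} (\<lambda>s. G (P s))"
  proof (rule lipschitz_on_continuous_on[of "L * M"], rule lipschitz_onI)
    fix s t assume "s \<in> {-s1..s1}" "t \<in> {-s1..s1}"
    then have st: "\<bar>s\<bar> \<le> s1" "\<bar>t\<bar> \<le> s1" by auto
    have "norm (G (P s) - G (P t)) \<le> L * norm (P s - P t)" by (intro L dP st)
    also have "\<dots> \<le> L * (M * \<bar>s - t\<bar>)" using PM[OF st] L(1) by (intro mult_left_mono) auto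
    finally show "dist (G (P s)) (G (P t)) \<le> L * M * dist s t" by (simp add: dist_norm mult.assoc)
  qed (use L \<open>M > 0\<close> in simp)
  have kG: "k s = (q \<bullet> G (P s)) / (p \<bullet> G (P s))" "p \<bullet> G (P s) \<noteq> 0" if "\<bar>s\<bar> \<le> s1" for s
    using nz[of s] by (simp_all add: GP[OF that] inverse_eq_divide) (simp_all add: U_def inner_add_right pe pv qe qv)
  have kcont: "continuous_on {-s1..s1} k"
  proof -
    have "continuous_on {-s1..s1} (\<lambda>s. (q \<bullet> G (P s)) / (p \<bullet> G (P s)))"
      using kG(2) by (intro continuous_intros Gcont) auto
    then show ?thesis by (rule continuous_on_eq) (use kG(1) in auto)
  qed
  \<comment> \<open>The subgradient inequalities at \<open>s\<close> and \<open>y\<close> squeeze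
    the difference quotient of \<open>H\<close> between \<open>k s\<close> and \<open>k y\<close>,
    so continuity of \<open>k\<close> gives differentiability.\<close>
  have Hder: "(H has_real_derivative k s) (at s)" if s: "\<bar>s\<bar> < s1" for s
    unfolding has_field_derivative_def has_derivative_at_alt
  proof (intro conjI allI impI)
    fix \<epsilon> :: real assume "\<epsilon> > 0"
    have "isCont k s" using kcont s by (intro continuous_on_interior[OF kcont]) auto
    then obtain d where d: "d > 0" "\<And>t. \<bar>t - s\<bar> < d \<Longrightarrow> \<bar>k t - k s\<bar> < \<epsilon>"
      using \<open>\<epsilon> > 0\<close> unfolding continuous_at_eps_delta dist_real_def by blast
    show "\<exists>d>0. \<forall>y. norm (y - s) < d \<longrightarrow> norm (H y - H s - k s * (y - s)) \<le> \<epsilon> * norm (y - s)"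
    proof (intro exI[of _ "min d (s1 - \<bar>s\<bar>)"] conjI allI impI)
      fix y assume y: "norm (y - s) < min d (s1 - \<bar>s\<bar>)"
      then have ys: "\<bar>y\<bar> \<le> s1" by auto
      have 1: "0 \<le> H y - H s - k s * (y - s)" using Hsub[OF ys, of s] by simp
      have "H y - H s - k s * (y - s) \<le> (k y - k s) * (y - s)"
        using Hsub[of s y] s by (simp add: algebra_simps)
      also have "\<dots> \<le> \<bar>k y - k s\<bar> * \<bar>y - s\<bar>" by (metis abs_ge_self abs_mult)
      also have "\<dots> \<le> \<epsilon> * \<bar>y - s\<bar>" using d(2)[of y] y by (intro mult_right_mono) auto
      finally show "norm (H y - H s - k s * (y - s)) \<le> \<epsilon> * norm (y - s)" using 1 by simp
    qed (use d s in auto)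
  qed (rule bounded_linear_mult_right)
  have Hcont: "continuous_on {-s1..s1} H"
  proof -
    have "continuous_on {-s1..s1} (\<lambda>s. 1 - (h (k s) - s * k s))"
      by (intro continuous_intros kcont continuous_on_compose2[OF hcont[of UNIV] kcont]) auto
    then show ?thesis by (simp add: H_def[abs_def])
  qed
  define K where "K s = integral {-s1..s} H - integral {-s1..0} H" for s
  have K0: "K 0 = 0" by (simp add: K_def)
  have Kder: "(K has_real_derivative H s) (at s)" if s: "\<bar>s\<bar> < s1" for s
  proof -
    have "((\<lambda>x. integral {-s1..x} H) has_real_derivative H s) (at s within {-s1..s1})"
      using s by (intro integral_has_real_derivative Hcont) auto
    moreover have "at s within {-s1..s1} = at s" using s by (intro at_within_interior) auto
    ultimately have "((\<lambda>x. integral {-s1..x} H) has_real_derivative H s) (at s)" by simp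
    from DERIV_diff[OF this DERIV_const[of "integral {-s1..0} H"]] show ?thesis by (simp add: K_def[abs_def])
  qed
  \<comment> \<open>\<open>k s\<close> is the cross product of \<open>e\<close> with
    \<open>U s\<close>, that is, of \<open>bd (g \<beta>s)\<close> with a bounded multiple of
    \<open>bd (g \<beta>)\<close>. It is thus of the order of \<open>g \<beta> - g \<beta>s\<close>,
    while \<open>\<beta> - \<beta>s\<close> is of the order of \<open>s\<close>.\<close>
  have kflat: "\<exists>A>0. \<exists>r>0. \<forall>s. \<bar>s\<bar> < r \<longrightarrow> \<bar>k s\<bar> \<le> A * \<bar>s\<bar> ^ Suc n" for n
  proof -
    obtain A1 r1 where A1: "A1 > 0" "r1 > 0" "\<And>\<beta>. \<bar>\<beta> - \<beta>s\<bar> < r1 \<Longrightarrow> \<bar>g \<beta> - g \<beta>s\<bar> \<le> A1 * \<bar>\<beta> - \<beta>s\<bar> ^ Suc n"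
      using flat[of n] by blast
    obtain A2 r2 where A2: "A2 > 0" "r2 > 0" "\<And>x b. dualN N x = 1 \<Longrightarrow> norm (x - D.bd b) < r2 \<Longrightarrow>
        \<exists>a. x = D.bd a \<and> \<bar>a - b\<bar> \<le> pi / 3 \<and> \<bar>a - b\<bar> \<le> A2 * norm (x - D.bd b)"
      using D.angle_near by blast
    obtain A3 where A3: "A3 > 0" "\<And>a b. \<bar>cross2 (bd a) (bd b)\<bar> \<le> A3 * \<bar>a - b\<bar>" using abs_cross2_bd_le by blast
    define A4 where "A4 = 1 + 2 * B * N v"
    have "A4 > 0" using \<open>B > 0\<close> by (simp add: A4_def add_pos_nonneg)
    have P0: "P 0 = D.bd \<beta>s" by (simp add: P_def H0 p_def)
    define r where "r = min s1 (min (r2 / M) (r1 / (A2 * M)))"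
    have "\<bar>k s\<bar> \<le> (A4 * A3 * A1 * (A2 * M) ^ Suc n) * \<bar>s\<bar> ^ Suc n" if s: "\<bar>s\<bar> < r" for s
    proof -
      have s': "\<bar>s\<bar> \<le> s1" "\<bar>s\<bar> < r2 / M" "\<bar>s\<bar> < r1 / (A2 * M)" using s by (auto simp: r_def)
      have Pd: "norm (P s - D.bd \<beta>s) \<le> M * \<bar>s\<bar>" using PM[OF s'(1), of 0] \<open>s1 > 0\<close> P0 by simp
      have "M * \<bar>s\<bar> < r2" using s'(2) \<open>M > 0\<close> by (simp add: pos_less_divide_eq mult.commute)
      then have "norm (P s - D.bd \<beta>s) < r2" using Pd by linarith
      then obtain \<beta> where \<beta>: "P s = D.bd \<beta>" "\<bar>\<beta> - \<beta>s\<bar> \<le> A2 * norm (P s - D.bd \<beta>s)"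
        using A2(3)[OF dP[OF s'(1)]] by blast
      have "A2 * norm (P s - D.bd \<beta>s) \<le> A2 * (M * \<bar>s\<bar>)" using Pd A2(1) by (intro mult_left_mono) auto
      then have b: "\<bar>\<beta> - \<beta>s\<bar> \<le> (A2 * M) * \<bar>s\<bar>" using \<beta>(2) by simp
      have "(A2 * M) * \<bar>s\<bar> < r1" using s'(3) \<open>M > 0\<close> A2(1) by (simp add: pos_less_divide_eq mult.commute)
      then have "\<bar>g \<beta> - g \<beta>s\<bar> \<le> A1 * \<bar>\<beta> - \<beta>s\<bar> ^ Suc n" using b by (intro A1) linarith
      also have "\<dots> \<le> A1 * ((A2 * M) * \<bar>s\<bar>) ^ Suc n" using b A1(1) by (intro mult_left_mono power_mono) auto
      finally have gb: "\<bar>g \<beta> - g \<beta>s\<bar> \<le> A1 * ((A2 * M) * \<bar>s\<bar>) ^ Suc n" .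
      have "cross2 e (U s) = k s * cross2 e v" by (simp add: U_def cross2_def algebra_simps)
      then have "cross2 e (U s) = k s" using ev by simp
      moreover have "U s = N (U s) *\<^sub>R bd (g \<beta>)" using GP[OF s'(1)] nz[of s] \<beta>(1) by (simp add: g(3))
      moreover have "e = bd (g \<beta>s)" by (simp add: e_def p_def g(3))
      ultimately have ks: "k s = N (U s) * cross2 (bd (g \<beta>s)) (bd (g \<beta>))"
        using cross2_scale[of 1 "bd (g \<beta>s)" "N (U s)" "bd (g \<beta>)"] by simp
      have NU4: "N (U s) \<le> A4"
      proof -
        have "N (U s) \<le> N e + \<bar>k s\<bar> * N v" unfolding U_def using N_triangle[of e "k s *\<^sub>R v"] by (simp add: N_scale)
        also have "\<dots> \<le> 1 + (2 * B) * N v" using k(1)[OF s'(1)] Ne by (intro add_mono mult_right_mono) auto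
        finally show ?thesis by (simp add: A4_def)
      qed
      have "\<bar>k s\<bar> = N (U s) * \<bar>cross2 (bd (g \<beta>s)) (bd (g \<beta>))\<bar>" using NU[of s] by (simp add: ks abs_mult)
      also have "\<dots> \<le> A4 * (A3 * \<bar>g \<beta>s - g \<beta>\<bar>)" using NU4 A3(2) \<open>A4 > 0\<close> by (intro mult_mono) auto
      also have "\<dots> \<le> A4 * (A3 * (A1 * ((A2 * M) * \<bar>s\<bar>) ^ Suc n))"
        using gb \<open>A4 > 0\<close> A3(1) by (intro mult_left_mono) (auto simp: abs_minus_commute)
      finally show ?thesis by (simp only: power_mult_distrib mult.assoc)
    qed
    moreover have "r > 0" using \<open>s1 > 0\<close> \<open>M > 0\<close> A1 A2 by (simp add: r_def)
    moreover have "A4 * A3 * A1 * (A2 * M) ^ Suc n > 0" using \<open>A4 > 0\<close> A3 A1 A2 \<open>M > 0\<close> by simp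
    ultimately show ?thesis by blast
  qed
  have Kflat: "\<exists>A>0. \<exists>r>0. \<forall>s. \<bar>s\<bar> < r \<longrightarrow> \<bar>K s\<bar> \<le> A * \<bar>s\<bar> ^ n" for n
  proof -
    obtain A r where A: "A > 0" "r > 0" "\<And>s. \<bar>s\<bar> < r \<Longrightarrow> \<bar>k s\<bar> \<le> A * \<bar>s\<bar> ^ Suc n" using kflat by blast
    \<comment> \<open>With \<open>\<bar>s\<bar> < 1\<close> the surplus powers gained by integration
      may be dropped.\<close>
    have "\<bar>K s\<bar> \<le> A * \<bar>s\<bar> ^ n" if s: "\<bar>s\<bar> < min 1 (min r s1)" for s
    proof -
      have Ht: "\<bar>H t\<bar> \<le> A * \<bar>s\<bar> ^ n" if t: "\<bar>t\<bar> \<le> \<bar>s\<bar>" for t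
      proof -
        have t': "\<bar>t\<bar> \<le> s1" "\<bar>t\<bar> < r" "\<bar>t\<bar> \<le> 1" using t s by auto
        have "H t \<le> k t * t" using Hsub[of 0 t] H0 \<open>s1 > 0\<close> by simp
        also have "\<dots> \<le> \<bar>k t\<bar> * \<bar>t\<bar>" by (metis abs_ge_self abs_mult)
        also have "\<dots> \<le> (A * \<bar>t\<bar> ^ Suc n) * 1" using A(3)[OF t'(2)] t' A(1) by (intro mult_mono) auto
        also have "\<dots> \<le> A * \<bar>t\<bar> ^ n" using t' A(1) by (simp add: mult_left_le_one_le mult_left_mono)
        also have "\<dots> \<le> A * \<bar>s\<bar> ^ n" using t A(1) by (intro mult_left_mono power_mono) auto
        finally show ?thesis using Hnn[OF t'(1)] by simp
      qed
      have "norm (K s - K 0) \<le> A * \<bar>s\<bar> ^ n * norm (s - 0)"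
      proof (rule field_differentiable_bound[of "{-\<bar>s\<bar>..\<bar>s\<bar>}"])
        fix z assume "z \<in> {-\<bar>s\<bar>..\<bar>s\<bar>}"
        then have z: "\<bar>z\<bar> \<le> \<bar>s\<bar>" by auto
        have "\<bar>z\<bar> < s1" using z s by linarith
        then show "(K has_field_derivative H z) (at z within {-\<bar>s\<bar>..\<bar>s\<bar>})"
          by (rule has_field_derivative_at_within[OF Kder])
        show "norm (H z) \<le> A * \<bar>s\<bar> ^ n" using Ht[OF z] by simp
      qed auto
      also have "\<dots> \<le> A * \<bar>s\<bar> ^ n * 1" using s A(1) by (intro mult_left_mono) auto
      finally show ?thesis by (simp add: K0)
    qed
    then show ?thesis using A \<open>s1 > 0\<close> by (intro exI[of _ A] conjI exI[of _ "min 1 (min r s1)"]) auto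
  qed
  have "flat_frame N e v p q s1 H k K"
  proof
    show "N (e + k s *\<^sub>R v) = 1 - H s + s * k s" for s using Heq[of s] by (simp add: h_def)
  qed (use pe pv qe qv ev \<open>s1 > 0\<close> calib Hder Kder kcont kmono k0 H0 K0 Kflat in auto)
  then show ?thesis by blast
qed

end

section \<open>The sub-Finsler distance\<close>

definition hpt :: "pt3 \<Rightarrow> pt2" where
  "hpt P = (fst P, fst (snd P))"

definition vpt :: "pt3 \<Rightarrow> real" where
  "vpt P = snd (snd P)"

definition mk3 :: "pt2 \<Rightarrow> real \<Rightarrow> pt3" where
  "mk3 c z = (fst c, snd c, z)"

lemma hpt_mk3 [simp]: "hpt (mk3 c z) = c" and vpt_mk3 [simp]: "vpt (mk3 c z) = z"
  and mk3_hpt_vpt [simp]: "mk3 (hpt P) (vpt P) = P"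
  by (simp_all add: hpt_def vpt_def mk3_def)

lemma hpt_0 [simp]: "hpt 0 = 0" and vpt_0 [simp]: "vpt 0 = 0"
  by (simp_all add: hpt_def vpt_def zero_prod_def)

lemma bounded_linear_hpt: "bounded_linear hpt"
  unfolding hpt_def[abs_def] by (intro bounded_linear_Pair bounded_linear_fst bounded_linear_compose[OF bounded_linear_fst bounded_linear_snd])

lemma bounded_linear_vpt: "bounded_linear vpt"
  unfolding vpt_def[abs_def] by (intro bounded_linear_compose[OF bounded_linear_snd bounded_linear_snd])

lemma abs_vpt_le: "\<bar>vpt P\<bar> \<le> norm P"
  using norm_snd_le[of "snd (snd P)" "fst (snd P)"] norm_snd_le[of "snd P" "fst P"] by (simp add: vpt_def)

text \<open>In terms of the cross product, so that a linear map of the plane acts on the vertical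
  part by its determinant.\<close>

definition hvel :: "pt3 \<Rightarrow> pt2 \<Rightarrow> pt3" where
  "hvel P u = mk3 u (cross2 (hpt P) u / 2)"

lemma hvel_eq: "fst u *\<^sub>R X1 P + snd u *\<^sub>R X2 P = hvel P u"
  by (cases P) (simp add: X1_def X2_def hvel_def mk3_def hpt_def cross2_def field_simps)

lemma admissibleD:
  assumes "admissible \<gamma> u"
  shows "abs_continuous_on {0..1} \<gamma>" "set_borel_measurable lborel {0..1} u"
    "set_integrable lborel {0..1} (\<lambda>t. (norm (u t))\<^sup>2)"
    "AE t in lborel. t \<in> {0..1} \<longrightarrow> (\<gamma> has_vector_derivative hvel (\<gamma> t) (u t)) (at t within {0..1})"
  using assms unfolding admissible_def hvel_eq by auto

lemma admissible_smooth:
  assumes d: "\<And>t. t \<in> {0..1} \<Longrightarrow> (\<gamma> has_vector_derivative hvel (\<gamma> t) (u t)) (at t within {0..1})"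
    and u: "continuous_on {0..1} u"
  shows "admissible \<gamma> u"
proof -
  have gc: "continuous_on {0..1} \<gamma>"
    using d has_vector_derivative_continuous continuous_on_eq_continuous_within by blast
  have "continuous_on {0..1} (\<lambda>t. hvel (\<gamma> t) (u t))"
    unfolding hvel_def mk3_def cross2_def hpt_def by (intro continuous_intros gc u) auto
  then have "compact ((\<lambda>t. hvel (\<gamma> t) (u t)) ` {0..1})"
    by (rule compact_continuous_image) simp
  then have "bounded ((\<lambda>t. hvel (\<gamma> t) (u t)) ` {0..1})" by (rule compact_imp_bounded)
  then obtain B where "\<forall>x\<in>(\<lambda>t. hvel (\<gamma> t) (u t)) ` {0..1}. norm x \<le> B"
    unfolding bounded_iff by (elim exE)
  then have B: "norm (hvel (\<gamma> t) (u t)) \<le> B" if "t \<in> {0..1}" for t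
    using that by (rule bspec[OF _ imageI])
  have "dist (\<gamma> s) (\<gamma> t) \<le> B * \<bar>s - t\<bar>" if "s \<in> {0..1}" "t \<in> {0..1}" for s t
  proof -
    have "norm (\<gamma> s - \<gamma> t) \<le> B * norm (s - t)"
    proof (rule differentiable_bound[of "{0..1}"])
      fix x :: real assume x: "x \<in> {0..1}"
      show "(\<gamma> has_derivative (\<lambda>h. h *\<^sub>R hvel (\<gamma> x) (u x))) (at x within {0..1})"
        using d[OF x] by (simp add: has_vector_derivative_def)
      show "onorm (\<lambda>h. h *\<^sub>R hvel (\<gamma> x) (u x)) \<le> B"
        by (rule onorm_le) (simp add: mult.commute[of B] mult_left_mono B[OF x])
    qed (use that in auto)
    then show ?thesis by (simp add: dist_norm)
  qed
  then have ac: "abs_continuous_on {0..1} \<gamma>" by (rule abs_continuous_on_Lipschitz)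
  have m: "set_borel_measurable lborel {0..1} u"
    unfolding set_borel_measurable_def using borel_measurable_continuous_on_indicator[OF _ u] by simp
  have i: "set_integrable lborel {0..1} (\<lambda>t. (norm (u t))\<^sup>2)"
    unfolding set_integrable_def by (rule borel_integrable_compact) (auto intro!: continuous_intros u)
  show ?thesis
    unfolding admissible_def hvel_eq using ac m i d by auto
qed

section \<open>Lengths, calibrations and distance\<close>

context plane_norm
begin

lemma admissible_integrable:
  assumes "admissible \<gamma> u" shows "set_integrable lborel {0..1} (\<lambda>t. N (u t))"
proof -
  obtain C where C: "C > 0" "\<And>x. N x \<le> C * norm x" by (rule N_upper, rule that, assumption+)
  note a = admissibleD[OF assms]
  have "set_integrable lborel {0..1} (\<lambda>t. C * (1 + (norm (u t))\<^sup>2))"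
    by (intro set_integrable_mult_right set_integral_add(1) a(3)) (simp add: set_integrable_def)
  then show ?thesis
  proof (rule set_integrable_bound)
    have "(\<lambda>t. indicator {0..1} t *\<^sub>R u t) \<in> borel_measurable lborel"
      using a(2) by (simp add: set_borel_measurable_def)
    then have "(\<lambda>t. N (indicator {0..1} t *\<^sub>R u t)) \<in> borel_measurable lborel"
      by (rule measurable_compose) (rule N_measurable)
    then show "set_borel_measurable lborel {0..1} (\<lambda>t. N (u t))"
      by (simp add: set_borel_measurable_def N_scale)
    show "AE t in lborel. t \<in> {0..1} \<longrightarrow> norm (N (u t)) \<le> norm (C * (1 + (norm (u t))\<^sup>2))"
    proof (intro AE_I2 impI)
      fix t
      have "2 * norm (u t) \<le> 1 + (norm (u t))\<^sup>2" using zero_le_power2[of "norm (u t) - 1"] by (simp add: power2_diff)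
      then have "norm (u t) \<le> 1 + (norm (u t))\<^sup>2" using norm_ge_zero[of "u t"] by linarith
      then have "C * norm (u t) \<le> C * (1 + (norm (u t))\<^sup>2)" using C(1) by (intro mult_left_mono) auto
      then have "N (u t) \<le> C * (1 + (norm (u t))\<^sup>2)" using C(2)[of "u t"] by linarith
      moreover have "0 \<le> C * (1 + (norm (u t))\<^sup>2)" using C(1) by (intro mult_nonneg_nonneg) auto
      ultimately show "norm (N (u t)) \<le> norm (C * (1 + (norm (u t))\<^sup>2))"
        by (simp only: real_norm_def abs_of_nonneg N_nonneg)
    qed
  qed
qed

lemma sF_length_eq:
  assumes "admissible \<gamma> u"
  shows "((\<lambda>t. N (u t)) has_integral sF_length N u) {0..1}" "sF_length N u \<ge> 0"
proof -
  note s = set_borel_integral_eq_integral[OF admissible_integrable[OF assms]]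
  show "((\<lambda>t. N (u t)) has_integral sF_length N u) {0..1}"
    using s by (simp add: sF_length_def has_integral_integral)
  then show "sF_length N u \<ge> 0" by (rule has_integral_nonneg) simp
qed

text \<open>The derivative of \<open>F\<close> along the curve exists almost everywhere and
  integrates to the increment by \<open>abs_continuous_on_diff_le_integral\<close>. The intermediate
  time \<open>T\<close> lets the bound control the curve before its end as well.\<close>

lemma calibration_bound:
  assumes adm: "admissible \<gamma> u" and T: "T \<in> {0..1}"
    and lip: "\<And>s t. s \<in> {0..T} \<Longrightarrow> t \<in> {0..T} \<Longrightarrow> \<bar>F (\<gamma> s) - F (\<gamma> t)\<bar> \<le> L * dist (\<gamma> s) (\<gamma> t)"
    and der: "\<And>t. t \<in> {0..T} \<Longrightarrow> (\<gamma> has_vector_derivative hvel (\<gamma> t) (u t)) (at t within {0..T}) \<Longrightarrow>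
       \<exists>D. ((\<lambda>t. F (\<gamma> t)) has_real_derivative D) (at t within {0..T}) \<and> D \<le> N (u t)"
  shows "F (\<gamma> T) - F (\<gamma> 0) \<le> sF_length N u"
proof -
  note a = admissibleD[OF adm]
  obtain S where S: "S \<in> null_sets lborel" "\<And>t. t \<notin> S \<Longrightarrow> t \<in> {0..1} \<Longrightarrow> (\<gamma> has_vector_derivative hvel (\<gamma> t) (u t)) (at t within {0..1})"
    using a(4) by (auto elim!: AE_E3)
  have sub: "{0..T} \<subseteq> {0..1}" using T by auto
  have int: "(\<lambda>t. N (u t)) integrable_on {0..1}" using sF_length_eq(1)[OF adm] by (rule has_integral_integrable)
  have intT: "(\<lambda>t. N (u t)) integrable_on {0..T}" by (rule integrable_on_subinterval[OF int sub])
  have "F (\<gamma> T) - F (\<gamma> 0) \<le> integral {0..T} (\<lambda>t. N (u t))"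
  proof (rule abs_continuous_on_diff_le_integral[where f = "\<lambda>t. F (\<gamma> t)"])
    show "abs_continuous_on {0..T} (\<lambda>t. F (\<gamma> t))"
      by (rule abs_continuous_on_compose_Lipschitz[OF abs_continuous_on_subset[OF a(1) sub], where L = L])
        (unfold dist_real_def, rule lip)
    show "negligible S" using S(1) by (simp add: negligible_iff_null_sets null_sets_completionI)
    show "((\<lambda>t. N (u t)) has_integral integral {0..T} (\<lambda>t. N (u t))) {0..T}" using intT by (rule integrable_integral)
    fix t assume t: "t \<in> {0..T} - S"
    have "(\<gamma> has_vector_derivative hvel (\<gamma> t) (u t)) (at t within {0..T})"
      by (rule has_vector_derivative_within_subset[OF S(2) sub]) (use t sub in auto)
    then show "\<exists>D. ((\<lambda>t. F (\<gamma> t)) has_real_derivative D) (at t within {0..T}) \<and> D \<le> N (u t)"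
      using der t by blast
  qed (use T in auto)
  also have "\<dots> \<le> integral {0..1} (\<lambda>t. N (u t))"
    by (rule integral_subset_le[OF sub intT int]) simp
  also have "\<dots> = sF_length N u" using sF_length_eq(1)[OF adm] by (rule integral_unique)
  finally show ?thesis .
qed

definition lengths :: "pt3 \<Rightarrow> pt3 \<Rightarrow> real set" where
  "lengths P Q = {sF_length N u | \<gamma> u. admissible \<gamma> u \<and> \<gamma> 0 = P \<and> \<gamma> 1 = Q}"

lemma sF_dist_eq: "sF_dist N P Q = Inf (lengths P Q)"
  by (simp add: sF_dist_def lengths_def)

lemma lengths_nonneg: "l \<in> lengths P Q \<Longrightarrow> 0 \<le> l"
  using sF_length_eq(2) by (auto simp: lengths_def)

lemma lengths_nonempty: "lengths P Q \<noteq> {}"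
proof -
  obtain x0 y0 z0 where P: "P = (x0, y0, z0)" by (cases P)
  obtain x1 y1 z1 where Q: "Q = (x1, y1, z1)" by (cases Q)
  txt \<open>A segment plus polynomial loops; \<open>s\<close> is chosen so that the enclosed area gives the height of \<open>Q\<close>.\<close>
  define a b where "a = x1 - x0" and "b = y1 - y0"
  define s where "s = 15 * (x0 * b - y0 * a + b / 3 - 2 * (z1 - z0))"
  define \<alpha> \<beta> where "\<alpha> = a + 1" and "\<beta> = b + s"
  define x where "x t = x0 + \<alpha> * t - t ^ 2" for t :: real
  define y where "y t = y0 + \<beta> * t - 3 * s * t ^ 2 + 2 * s * t ^ 3" for t :: real
  define z where "z t = z0 + ((x0 * \<beta> - y0 * \<alpha>) * t + (y0 - 3 * s * x0) * t ^ 2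
     + (2 * s * x0 - s * \<alpha> + \<beta> / 3) * t ^ 3 + s * \<alpha> * t ^ 4 - (2 * s / 5) * t ^ 5) / 2" for t :: real
  define u where "u t = (\<alpha> - 2 * t, \<beta> - 6 * s * t + 6 * s * t ^ 2)" for t :: real
  define \<gamma> where "\<gamma> t = (x t, y t, z t)" for t
  have dx: "(x has_real_derivative fst (u t)) (at t within {0..1})" for t
    unfolding x_def[abs_def] u_def by (auto intro!: derivative_eq_intros)
  have dy: "(y has_real_derivative snd (u t)) (at t within {0..1})" for t
    unfolding y_def[abs_def] u_def by (auto intro!: derivative_eq_intros)
  have dz: "(z has_real_derivative cross2 (x t, y t) (u t) / 2) (at t within {0..1})" for t
    unfolding z_def[abs_def] u_def x_def y_def cross2_def
    by (auto intro!: derivative_eq_intros) (simp add: field_simps power2_eq_square power3_eq_cube power4_eq_xxxx)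
  have "admissible \<gamma> u"
  proof (rule admissible_smooth)
    fix t :: real
    have "(\<gamma> has_vector_derivative (fst (u t), snd (u t), cross2 (x t, y t) (u t) / 2)) (at t within {0..1})"
      unfolding \<gamma>_def[abs_def]
      by (intro has_vector_derivative_Pair dx[unfolded has_real_derivative_iff_has_vector_derivative]
         dy[unfolded has_real_derivative_iff_has_vector_derivative] dz[unfolded has_real_derivative_iff_has_vector_derivative])
    then show "(\<gamma> has_vector_derivative hvel (\<gamma> t) (u t)) (at t within {0..1})"
      by (simp add: hvel_def mk3_def hpt_def \<gamma>_def)
  next
    show "continuous_on {0..1} u" unfolding u_def by (intro continuous_intros)
  qed
  moreover have "\<gamma> 0 = P" by (simp add: \<gamma>_def P x_def y_def z_def)
  moreover have "\<gamma> 1 = Q"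
  proof -
    have "x 1 = x1" "y 1 = y1" by (simp_all add: x_def y_def \<alpha>_def \<beta>_def a_def b_def)
    \<comment> \<open>In \<open>2 * (z 1 - z0)\<close> the coefficient of \<open>s\<close> is 1/3 -
      2/5 = -1/15, whence the factor 15.\<close>
    moreover have "z 1 = z1" unfolding z_def \<alpha>_def \<beta>_def s_def by (simp add: field_simps)
    ultimately show ?thesis by (simp add: \<gamma>_def Q)
  qed
  ultimately show ?thesis unfolding lengths_def by blast
qed

lemma bdd_below_lengths: "bdd_below (lengths P Q)"
  using lengths_nonneg by (intro bdd_belowI)

lemma sF_dist_nonneg: "0 \<le> sF_dist N P Q"
  unfolding sF_dist_eq using lengths_nonneg by (intro cInf_greatest lengths_nonempty)

lemma sF_dist_le: "admissible \<gamma> u \<Longrightarrow> \<gamma> 0 = P \<Longrightarrow> \<gamma> 1 = Q \<Longrightarrow> sF_dist N P Q \<le> sF_length N u"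
  unfolding sF_dist_eq by (intro cInf_lower bdd_below_lengths) (auto simp: lengths_def)

lemma sF_dist_lessE:
  assumes "sF_dist N P Q < r"
  obtains \<gamma> u where "admissible \<gamma> u" "\<gamma> 0 = P" "\<gamma> 1 = Q" "sF_length N u < r"
  using cInf_lessD[OF lengths_nonempty assms[unfolded sF_dist_eq]] by (auto simp: lengths_def)

text \<open>Linear maps of the plane lift to group endomorphisms, acting on heights by the determinant.\<close>

lemma sF_dist_automorphism:
  assumes M: "bounded_linear M" and det: "\<And>a b. cross2 (M a) (M b) = \<delta> * cross2 a b"
    and bd: "\<And>w. N (M w) \<le> \<kappa> * N w" and "0 \<le> \<kappa>"
  shows "sF_dist N 0 (mk3 (M (hpt P)) (\<delta> * vpt P)) \<le> \<kappa> * sF_dist N 0 P"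
proof -
  interpret M: bounded_linear M by (rule M)
  define A where "A P = mk3 (M (hpt P)) (\<delta> * vpt P)" for P
  have A: "bounded_linear A"
    unfolding A_def mk3_def
    by (intro bounded_linear_Pair bounded_linear_compose[OF bounded_linear_fst] bounded_linear_compose[OF bounded_linear_snd]
       bounded_linear_compose[OF M bounded_linear_hpt] bounded_linear_const_mult bounded_linear_vpt)
  interpret A: bounded_linear A by (rule A)
  have key: "sF_dist N 0 (A P) \<le> \<kappa> * sF_length N u" if adm: "admissible \<gamma> u" "\<gamma> 0 = 0" "\<gamma> 1 = P" for \<gamma> u
  proof -
    note a = admissibleD[OF adm(1)]
    obtain B where B: "\<And>x. norm (A x) \<le> norm x * B" using A.bounded by blast
    obtain BM where BM: "BM > 0" "\<And>x. norm (M x) \<le> norm x * BM" using M.pos_bounded by blast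
    have adm': "admissible (\<lambda>t. A (\<gamma> t)) (\<lambda>t. M (u t))"
      unfolding admissible_def hvel_eq
    proof (intro conjI)
      show "abs_continuous_on {0..1} (\<lambda>t. A (\<gamma> t))"
        by (rule abs_continuous_on_compose_Lipschitz[OF a(1), where L = B])
          (use B in \<open>simp add: dist_norm mult.commute flip: A.diff\<close>)
      have "(\<lambda>t. indicator {0..1} t *\<^sub>R u t) \<in> borel_measurable lborel"
        using a(2) by (simp add: set_borel_measurable_def)
      then have "(\<lambda>t. M (indicator {0..1} t *\<^sub>R u t)) \<in> borel_measurable lborel"
        by (rule measurable_compose) (intro borel_measurable_continuous_onI M.continuous_on continuous_on_id)
      then show m: "set_borel_measurable lborel {0..1} (\<lambda>t. M (u t))"
        by (simp add: set_borel_measurable_def M.scaleR)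
      have "set_integrable lborel {0..1} (\<lambda>t. BM\<^sup>2 * (norm (u t))\<^sup>2)"
        by (intro set_integrable_mult_right a(3))
      then show "set_integrable lborel {0..1} (\<lambda>t. (norm (M (u t)))\<^sup>2)"
      proof (rule set_integrable_bound)
        have "(\<lambda>t. (norm (indicator {0..1} t *\<^sub>R M (u t)))\<^sup>2) \<in> borel_measurable lborel"
          using m unfolding set_borel_measurable_def by measurable
        moreover have "(\<lambda>t. (norm (indicator {0..1} t *\<^sub>R M (u t)))\<^sup>2) = (\<lambda>t. indicator {0..1} t *\<^sub>R (norm (M (u t)))\<^sup>2)"
          by (auto simp: indicator_def)
        ultimately show "set_borel_measurable lborel {0..1} (\<lambda>t. (norm (M (u t)))\<^sup>2)"
          by (simp add: set_borel_measurable_def)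
        show "AE t in lborel. t \<in> {0..1} \<longrightarrow> norm ((norm (M (u t)))\<^sup>2) \<le> norm (BM\<^sup>2 * (norm (u t))\<^sup>2)"
        proof (intro AE_I2 impI)
          fix t
          have "(norm (M (u t)))\<^sup>2 \<le> (norm (u t) * BM)\<^sup>2" by (intro power_mono BM) simp
          then show "norm ((norm (M (u t)))\<^sup>2) \<le> norm (BM\<^sup>2 * (norm (u t))\<^sup>2)"
            by (simp add: power_mult_distrib mult.commute)
        qed
      qed
      show "AE t in lborel. t \<in> {0..1} \<longrightarrow> ((\<lambda>t. A (\<gamma> t)) has_vector_derivative hvel (A (\<gamma> t)) (M (u t))) (at t within {0..1})"
        using a(4)
      proof eventually_elim
        fix t assume *: "t \<in> {0..1} \<longrightarrow> (\<gamma> has_vector_derivative hvel (\<gamma> t) (u t)) (at t within {0..1})"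
        have "A (hvel (\<gamma> t) (u t)) = hvel (A (\<gamma> t)) (M (u t))"
          by (simp add: A_def hvel_def det)
        then show "t \<in> {0..1} \<longrightarrow> ((\<lambda>t. A (\<gamma> t)) has_vector_derivative hvel (A (\<gamma> t)) (M (u t))) (at t within {0..1})"
          using * A.has_vector_derivative by metis
      qed
    qed
    have "sF_dist N 0 (A P) \<le> sF_length N (\<lambda>t. M (u t))"
      by (rule sF_dist_le[OF adm']) (simp_all add: adm A.zero)
    also have "\<dots> \<le> \<kappa> * sF_length N u"
      by (rule has_integral_le[OF sF_length_eq(1)[OF adm'] has_integral_mult_right[OF sF_length_eq(1)[OF adm(1)]]]) (rule bd)
    finally show ?thesis .
  qed
  have "sF_dist N 0 (A P) \<le> \<kappa> * sF_dist N 0 P"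
  proof (cases "\<kappa> = 0")
    case True
    obtain l where "l \<in> lengths 0 P" using lengths_nonempty by blast
    then show ?thesis using key True by (auto simp: lengths_def)
  next
    case False
    then have "\<kappa> > 0" using \<open>0 \<le> \<kappa>\<close> by simp
    have "sF_dist N 0 (A P) / \<kappa> \<le> sF_dist N 0 P"
      unfolding sF_dist_eq[of 0 P]
    proof (rule cInf_greatest[OF lengths_nonempty])
      fix l assume "l \<in> lengths 0 P"
      then have "sF_dist N 0 (A P) \<le> \<kappa> * l" using key by (auto simp: lengths_def)
      then show "sF_dist N 0 (A P) / \<kappa> \<le> l" using \<open>\<kappa> > 0\<close> by (simp add: field_simps)
    qed
    then show ?thesis using \<open>\<kappa> > 0\<close> by (simp add: field_simps)
  qed
  then show ?thesis by (simp add: A_def)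
qed

end

section \<open>The origin lies in the support of Lebesgue measure\<close>

lemma jrot_props: "a \<bullet> jrot a = 0" "cross2 a (jrot a) = a \<bullet> a" "norm (jrot a) = norm a" "jrot a \<bullet> jrot a = a \<bullet> a"
  by (simp_all add: jrot_def inner2 cross2_def norm_prod_def add.commute)

lemma jrot_decomp: "(a \<bullet> a) *\<^sub>R w = (w \<bullet> a) *\<^sub>R a + (w \<bullet> jrot a) *\<^sub>R jrot a"
  by (simp add: jrot_def inner2 prod_eq_iff algebra_simps)

lemma borel_hpt [measurable]: "hpt \<in> borel_measurable borel" and borel_vpt [measurable]: "vpt \<in> borel_measurable borel"
  by (intro borel_measurable_continuous_onI linear_continuous_on bounded_linear_hpt bounded_linear_vpt)+

context plane_norm
begin

lemma sF_dist_dilation: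
  assumes "0 \<le> \<kappa>" shows "sF_dist N 0 (mk3 (\<kappa> *\<^sub>R c) (\<kappa>\<^sup>2 * z)) \<le> \<kappa> * sF_dist N 0 (mk3 c z)"
  using sF_dist_automorphism[of "\<lambda>w. \<kappa> *\<^sub>R w" "\<kappa>\<^sup>2" \<kappa> "mk3 c z"] assms
  by (simp add: bounded_linear_scaleR_right cross2_scale power2_eq_square N_scale)

text \<open>The linear map taking \<open>c\<close> to \<open>c'\<close> and \<open>jrot c\<close> to
  \<open>\<tau> *\<^sub>R jrot c'\<close> has determinant
  \<open>\<tau> * (c' \<bullet> c') / (c \<bullet> c)\<close>, and it is close to the identity when
  these images are close to \<open>c\<close> and \<open>jrot c\<close>;
  \<open>sF_dist_automorphism\<close> applies to it.\<close>

lemma sF_dist_stretch: "\<exists>B>0. \<forall>c c' \<tau> z. c \<noteq> 0 \<longrightarrow>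
   sF_dist N 0 (mk3 c' (\<tau> * (c' \<bullet> c') / (c \<bullet> c) * z))
    \<le> (1 + B * (N (c' - c) + N (\<tau> *\<^sub>R jrot c' - jrot c)) / norm c) * sF_dist N 0 (mk3 c z)"
proof -
  obtain k where k: "k > 0" "\<And>x. k * norm x \<le> N x" by (rule N_lower, rule that, assumption+)
  have "sF_dist N 0 (mk3 c' (\<tau> * (c' \<bullet> c') / (c \<bullet> c) * z))
    \<le> (1 + (1/k) * (N (c' - c) + N (\<tau> *\<^sub>R jrot c' - jrot c)) / norm c) * sF_dist N 0 (mk3 c z)"
    if "c \<noteq> 0" for c c' \<tau> z
  proof -
    define n where "n = c \<bullet> c"
    have "n > 0" using that by (simp add: n_def)
    have nn: "n = norm c * norm c" by (simp add: n_def power2_norm_eq_inner[symmetric] power2_eq_square)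
    define M where "M w = ((w \<bullet> c) / n) *\<^sub>R c' + ((w \<bullet> jrot c) / n) *\<^sub>R (\<tau> *\<^sub>R jrot c')" for w
    have Mbl: "bounded_linear M"
      unfolding M_def[abs_def] divide_inverse
      by (intro bounded_linear_add bounded_linear_scaleR_const bounded_linear_mult_const bounded_linear_inner_left)
    have Mdet: "cross2 (M a) (M b) = (\<tau> * (c' \<bullet> c') / n) * cross2 a b" for a b
    proof -
      have "cross2 (M a) (M b) = ((a \<bullet> c) * (b \<bullet> jrot c) - (a \<bullet> jrot c) * (b \<bullet> c)) / (n * n) * (\<tau> * cross2 c' (jrot c'))"
        using \<open>n > 0\<close> by (simp add: M_def cross2_def field_simps)
      also have "(a \<bullet> c) * (b \<bullet> jrot c) - (a \<bullet> jrot c) * (b \<bullet> c) = n * cross2 a b"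
        using lagrange_cross2[of c "jrot c" a b] by (simp add: jrot_props n_def inner_commute mult.commute)
      finally show ?thesis using \<open>n > 0\<close> by (simp add: jrot_props)
    qed
    have Mc: "M c = c'" using \<open>n > 0\<close> by (simp add: M_def jrot_props n_def)
    define E where "E = N (c' - c) + N (\<tau> *\<^sub>R jrot c' - jrot c)"
    have "E \<ge> 0" by (simp add: E_def)
    have bd: "N (M w) \<le> (1 + (1/k) * E / norm c) * N w" for w
    proof -
      have "w = inverse n *\<^sub>R (n *\<^sub>R w)" using \<open>n > 0\<close> by simp
      also have "n *\<^sub>R w = (w \<bullet> c) *\<^sub>R c + (w \<bullet> jrot c) *\<^sub>R jrot c" unfolding n_def by (rule jrot_decomp)
      finally have w: "w = ((w \<bullet> c) / n) *\<^sub>R c + ((w \<bullet> jrot c) / n) *\<^sub>R jrot c"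
        by (simp add: scaleR_add_right divide_inverse mult.commute)
      have "M w - w = M w - (((w \<bullet> c) / n) *\<^sub>R c + ((w \<bullet> jrot c) / n) *\<^sub>R jrot c)"
        by (rule arg_cong[OF w])
      also have "\<dots> = ((w \<bullet> c) / n) *\<^sub>R (c' - c) + ((w \<bullet> jrot c) / n) *\<^sub>R (\<tau> *\<^sub>R jrot c' - jrot c)"
        unfolding M_def scaleR_diff_right by simp
      finally have "M w - w = ((w \<bullet> c) / n) *\<^sub>R (c' - c) + ((w \<bullet> jrot c) / n) *\<^sub>R (\<tau> *\<^sub>R jrot c' - jrot c)" .
      then have "N (M w - w) \<le> \<bar>(w \<bullet> c) / n\<bar> * N (c' - c) + \<bar>(w \<bullet> jrot c) / n\<bar> * N (\<tau> *\<^sub>R jrot c' - jrot c)"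
        using N_triangle[of "((w \<bullet> c) / n) *\<^sub>R (c' - c)" "((w \<bullet> jrot c) / n) *\<^sub>R (\<tau> *\<^sub>R jrot c' - jrot c)"] by (simp only: N_scale)
      also have "\<dots> \<le> (norm w / norm c) * N (c' - c) + (norm w / norm c) * N (\<tau> *\<^sub>R jrot c' - jrot c)"
      proof -
        have "\<bar>w \<bullet> c\<bar> / n \<le> (norm w * norm c) / n" "\<bar>w \<bullet> jrot c\<bar> / n \<le> (norm w * norm c) / n"
          using Cauchy_Schwarz_ineq2[of w c] Cauchy_Schwarz_ineq2[of w "jrot c"] \<open>n > 0\<close>
          by (auto simp: jrot_props intro!: divide_right_mono)
        moreover have "(norm w * norm c) / n = norm w / norm c" using that by (simp add: nn)
        ultimately show ?thesis using \<open>n > 0\<close> by (intro add_mono mult_right_mono) auto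
      qed
      also have "\<dots> = norm w * (E / norm c)" by (simp add: E_def add_divide_distrib algebra_simps)
      also have "\<dots> \<le> (N w / k) * (E / norm c)"
        using k(2)[of w] k(1) \<open>E \<ge> 0\<close> by (intro mult_right_mono) (auto simp: field_simps)
      finally have "N (M w - w) \<le> (1/k) * E / norm c * N w" by (simp add: mult_ac)
      moreover have "N (M w) \<le> N w + N (M w - w)" using N_triangle[of w "M w - w"] by simp
      ultimately show ?thesis by (simp add: algebra_simps)
    qed
    show ?thesis
      using sF_dist_automorphism[OF Mbl Mdet bd, of "mk3 c z"] k(1) \<open>E \<ge> 0\<close> by (simp add: Mc E_def n_def)
  qed
  then show ?thesis using k(1) by (intro exI[of _ "1/k"]) auto
qed

text \<open>\<open>emeasure\<close> vanishes on non-measurable sets, so the balls must first be shown to be Borel. Stretching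
  automorphisms move points within each of the strata \<open>c \<noteq> 0 \<noteq> z\<close>, \<open>z = 0\<close> and \<open>c = 0\<close>, which makes the
  balls relatively open there, with no need for continuity of the distance.\<close>

lemma zero_in_msupport: "0 \<in> msupport (sF_dist N) lborel"
  unfolding msupport_def
proof (intro CollectI allI impI)
  fix r :: real assume "r > 0"
  define U where "U = {P. sF_dist N 0 P < r}"
  obtain B where B: "B > 0" "\<And>c c' \<tau> z. c \<noteq> 0 \<Longrightarrow> sF_dist N 0 (mk3 c' (\<tau> * (c' \<bullet> c') / (c \<bullet> c) * z))
    \<le> (1 + B * (N (c' - c) + N (\<tau> *\<^sub>R jrot c' - jrot c)) / norm c) * sF_dist N 0 (mk3 c z)"
    using sF_dist_stretch by blast
  have Nc: "continuous_on S (\<lambda>x. N (f x))" if "continuous_on S f" for S and f :: "'z::topological_space \<Rightarrow> pt2"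
    by (rule continuous_on_compose2[OF N_continuous[of UNIV] that]) auto
  have jc: "continuous_on S (\<lambda>x. jrot (f x))" if "continuous_on S f" for S and f :: "'z::topological_space \<Rightarrow> pt2"
    unfolding jrot_def by (intro continuous_intros that)
  have hc: "continuous_on S hpt" and vc: "continuous_on S vpt" for S
    by (intro linear_continuous_on bounded_linear_hpt bounded_linear_vpt)+
  have int: "P \<in> interior U" if P: "P \<in> U" "hpt P \<noteq> 0" "vpt P \<noteq> 0" for P
  proof -
    define c z where "c = hpt P" and "z = vpt P"
    have cz: "c \<noteq> 0" "z \<noteq> 0" "P = mk3 c z" using P by (simp_all add: c_def z_def)
    \<comment> \<open>Chosen so that the stretch taking \<open>c\<close> to \<open>hpt Q\<close>
      takes the height \<open>z\<close> exactly to \<open>vpt Q\<close>.\<close>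
    define \<tau> where "\<tau> Q = (vpt Q / z) * (c \<bullet> c) / (hpt Q \<bullet> hpt Q)" for Q
    define \<psi> where "\<psi> Q = (1 + B * (N (hpt Q - c) + N (\<tau> Q *\<^sub>R jrot (hpt Q) - jrot c)) / norm c) * sF_dist N 0 P" for Q
    define W where "W = {Q. hpt Q \<noteq> 0} \<inter> \<psi> -` {..<r}"
    have "continuous_on {Q. hpt Q \<noteq> 0} \<psi>"
      unfolding \<psi>_def \<tau>_def using cz by (intro continuous_intros Nc jc hc vc) auto
    moreover have "{Q. hpt Q \<noteq> 0} = hpt -` (- {0})" by auto
    then have "open {Q. hpt Q \<noteq> 0}"
      using open_vimage[OF open_Compl[OF closed_singleton] hc[of UNIV]] by simp
    ultimately have "open W" unfolding W_def by (rule continuous_open_preimage) simp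
    moreover have "P \<in> W"
      using cz P(1) by (simp add: W_def \<psi>_def \<tau>_def U_def)
    moreover have "W \<subseteq> U"
    proof
      fix Q assume Q: "Q \<in> W"
      then have "hpt Q \<noteq> 0" by (simp add: W_def)
      then have "\<tau> Q * (hpt Q \<bullet> hpt Q) / (c \<bullet> c) * z = vpt Q" using cz by (simp add: \<tau>_def)
      then have "sF_dist N 0 Q \<le> \<psi> Q"
        using B(2)[OF cz(1), of "hpt Q" "\<tau> Q" z] by (simp add: \<psi>_def cz(3))
      then show "Q \<in> U" using Q by (simp add: W_def U_def)
    qed
    ultimately show ?thesis by (rule interiorI)
  qed
  define V where "V = {c. c \<noteq> 0 \<and> mk3 c 0 \<in> U}"
  have "open V"
  proof (subst open_subopen, intro ballI)
    fix c assume c: "c \<in> V"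
    define \<psi> where "\<psi> c' = (1 + B * (N (c' - c) + N (jrot c' - jrot c)) / norm c) * sF_dist N 0 (mk3 c 0)" for c'
    define W where "W = - {0} \<inter> \<psi> -` {..<r}"
    have "continuous_on (- {0}) \<psi>"
      unfolding \<psi>_def using c by (intro continuous_intros Nc jc) (auto simp: V_def)
    then have "open W" unfolding W_def by (rule continuous_open_preimage) auto
    moreover have "c \<in> W" using c by (simp add: W_def \<psi>_def V_def U_def)
    moreover have "W \<subseteq> V"
    proof
      fix c' assume "c' \<in> W"
      then show "c' \<in> V" using B(2)[of c c' 1 0] c by (simp add: W_def \<psi>_def V_def U_def)
    qed
    ultimately show "\<exists>T. open T \<and> c \<in> T \<and> T \<subseteq> V" by blast
  qed
  define J where "J = {z. z \<noteq> 0 \<and> mk3 0 z \<in> U}"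
  have "open J"
  proof (subst open_subopen, intro ballI)
    fix z assume z: "z \<in> J"
    \<comment> \<open>On the vertical axis points are moved by the dilation with factor
      \<open>sqrt (z' / z)\<close>, which reaches all heights of the sign of
      \<open>z\<close>.\<close>
    define W where "W = {z'. z' / z > 0 \<and> sqrt (z' / z) * sF_dist N 0 (mk3 0 z) < r}"
    have "open W" unfolding W_def using z
      by (intro open_Collect_conj open_Collect_less continuous_intros) (auto simp: J_def)
    moreover have "z \<in> W" using z by (simp add: W_def J_def U_def)
    moreover have "W \<subseteq> J"
    proof
      fix z' assume z': "z' \<in> W"
      then have "(sqrt (z' / z))\<^sup>2 * z = z'" using z by (simp add: W_def J_def)
      then have "sF_dist N 0 (mk3 0 z') \<le> sqrt (z' / z) * sF_dist N 0 (mk3 0 z)"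
        using sF_dist_dilation[of "sqrt (z' / z)" 0 z] z' by (simp add: W_def)
      then show "z' \<in> J" using z' by (auto simp: W_def J_def U_def)
    qed
    ultimately show "\<exists>T. open T \<and> z \<in> T \<and> T \<subseteq> J" by blast
  qed
  have Ueq: "U = interior U \<union> {P. hpt P \<in> V \<and> vpt P = 0} \<union> {P. hpt P = 0 \<and> vpt P \<in> J} \<union> (U \<inter> {mk3 0 0})"
  proof (intro equalityI subsetI)
    fix P assume "P \<in> U"
    then show "P \<in> interior U \<union> {P. hpt P \<in> V \<and> vpt P = 0} \<union> {P. hpt P = 0 \<and> vpt P \<in> J} \<union> (U \<inter> {mk3 0 0})"
      using int[of P] mk3_hpt_vpt[of P] by (cases "hpt P = 0"; cases "vpt P = 0") (simp_all add: V_def J_def)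
  next
    fix P assume "P \<in> interior U \<union> {P. hpt P \<in> V \<and> vpt P = 0} \<union> {P. hpt P = 0 \<and> vpt P \<in> J} \<union> (U \<inter> {mk3 0 0})"
    then show "P \<in> U"
      using subsetD[OF interior_subset, of P U]
      by (elim UnE) (auto simp: V_def J_def, (metis mk3_hpt_vpt)+)
  qed
  have VJ [measurable]: "V \<in> sets borel" "J \<in> sets borel" using \<open>open V\<close> \<open>open J\<close> by auto
  have "{P. hpt P \<in> V \<and> vpt P = 0} \<in> sets borel" "{P. hpt P = 0 \<and> vpt P \<in> J} \<in> sets borel"
    by measurable
  moreover have "interior U \<in> sets borel" by simp
  moreover have "U \<inter> {mk3 0 0} \<in> sets borel" by (cases "mk3 0 0 \<in> U") auto
  ultimately have UB: "U \<in> sets borel" by (subst Ueq) (intro sets.Un)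
  \<comment> \<open>A dilated copy of a point with \<open>c\<close> and \<open>z\<close> both
    nonzero lies in the ball and, by \<open>int\<close>, in its interior, which is therefore
    nonempty.\<close>
  define D where "D = sF_dist N 0 (mk3 (1, 0) 1)"
  have "D \<ge> 0" by (simp add: D_def sF_dist_nonneg)
  define s where "s = r / (D + 1)"
  have "s > 0" using \<open>r > 0\<close> \<open>D \<ge> 0\<close> by (simp add: s_def)
  have "s * D < r" using \<open>r > 0\<close> \<open>D \<ge> 0\<close> by (simp add: s_def field_simps)
  then have "mk3 (s *\<^sub>R (1, 0)) (s\<^sup>2 * 1) \<in> U"
    using sF_dist_dilation[of s "(1,0)" 1] \<open>s > 0\<close> by (simp add: U_def D_def)
  then have "mk3 (s *\<^sub>R (1, 0)) (s\<^sup>2 * 1) \<in> interior U"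
    using \<open>s > 0\<close> by (intro int) (auto simp: zero_prod_def)
  then have "\<not> negligible (interior U)" using open_not_negligible[OF open_interior] by blast
  then have "\<not> negligible U" using negligible_subset interior_subset by blast
  then have "emeasure lborel U \<noteq> 0"
    using UB by (auto simp: negligible_iff_null_sets null_sets_completion_iff null_sets_def)
  then show "0 < emeasure lborel {y. sF_dist N 0 y < r}"
    by (simp add: U_def zero_less_iff_neq_zero)
qed

end

section \<open>Calibrations and failure of the measure contraction property\<close>

text \<open>Brouwer's theorem for \<open>y - g (f y - z)\<close>, where \<open>g\<close> inverts the
  derivative: the linear part cancels and the remainder keeps the ball of radius \<open>t\<close> in
  itself. Differentiability at the single point \<open>x0\<close> suffices, and the linear radius
  \<open>c * t\<close> is what gives the set of endpoints a volume of order at least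
  \<open>t ^ 3\<close>.\<close>

lemma local_surjection:
  fixes f :: "'a::euclidean_space \<Rightarrow> 'a"
  assumes "open S" "x0 \<in> S" and cont: "continuous_on S f"
    and der: "(f has_derivative f') (at x0)" and inj: "inj f'"
  shows "\<exists>c>0. \<exists>t0>0. \<forall>t. 0 < t \<longrightarrow> t \<le> t0 \<longrightarrow> ball (f x0) (c * t) \<subseteq> f ` cball x0 t"
proof -
  have lf: "linear f'" using der has_derivative_linear by blast
  obtain g where g: "linear g" "g \<circ> f' = id" using linear_injective_left_inverse[OF lf inj] by blast
  have fg: "f' \<circ> g = id" using linear_inverse_left[OF lf g(1)] g(2) by blast
  obtain B where B: "B > 0" "\<And>x. norm (g x) \<le> B * norm x" using linear_bounded_pos[OF g(1)] by blast
  obtain d1 where d1: "d1 > 0" "cball x0 d1 \<subseteq> S" using open_contains_cball assms(1,2) by blast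
  obtain d2 where d2: "d2 > 0" "\<And>y. norm (y - x0) < d2 \<Longrightarrow> norm (f y - f x0 - f' (y - x0)) \<le> 1 / (2 * B) * norm (y - x0)"
    using der B(1) unfolding has_derivative_at_alt by (metis divide_pos_pos mult_pos_pos zero_less_numeral zero_less_one)
  have "ball (f x0) (1 / (2 * B) * t) \<subseteq> f ` cball x0 t" if t: "0 < t" "t \<le> min d1 (d2 / 2)" for t
  proof
    fix z assume z: "z \<in> ball (f x0) (1 / (2 * B) * t)"
    define \<phi> where "\<phi> y = y - g (f y - z)" for y
    have "\<exists>y\<in>cball x0 t. \<phi> y = y"
    proof (rule brouwer)
      show "continuous_on (cball x0 t) \<phi>"
      proof -
        have "continuous_on (cball x0 t) f" using cont d1 t by (meson continuous_on_subset min.boundedE subset_cball subset_trans)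
        then have "continuous_on (cball x0 t) (\<lambda>y. f y - z)" by (intro continuous_intros)
        then have "continuous_on (cball x0 t) (\<lambda>y. g (f y - z))"
          using linear_continuous_on_compose g(1) by blast
        then show ?thesis unfolding \<phi>_def by (intro continuous_intros)
      qed
      show "\<phi> \<in> cball x0 t \<rightarrow> cball x0 t"
      proof
        fix y assume y: "y \<in> cball x0 t"
        then have yt: "norm (y - x0) \<le> t" by (simp add: dist_norm norm_minus_commute)
        have "g (f' (y - x0)) = y - x0" using g(2) by (metis comp_apply id_apply)
        then have "\<phi> y - x0 = g (f' (y - x0)) - g (f y - z)" by (simp add: \<phi>_def)
        also have "\<dots> = g ((z - f x0) - (f y - f x0 - f' (y - x0)))"
          by (simp add: linear_diff[OF g(1), symmetric] algebra_simps)
        finally have "norm (\<phi> y - x0) \<le> B * norm ((z - f x0) - (f y - f x0 - f' (y - x0)))" using B(2) by metis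
        also have "\<dots> \<le> B * (1 / (2 * B) * t + 1 / (2 * B) * t)"
        proof (rule mult_left_mono)
          have "norm (y - x0) < d2" using yt t d2(1) by simp
          then have "norm (f y - f x0 - f' (y - x0)) \<le> 1 / (2 * B) * norm (y - x0)" by (rule d2(2))
          also have "\<dots> \<le> 1 / (2 * B) * t" using yt B(1) by (intro mult_left_mono) auto
          finally have 1: "norm (f y - f x0 - f' (y - x0)) \<le> 1 / (2 * B) * t" .
          have 2: "norm (z - f x0) \<le> 1 / (2 * B) * t" using z by (simp add: dist_norm norm_minus_commute)
          show "norm ((z - f x0) - (f y - f x0 - f' (y - x0))) \<le> 1 / (2 * B) * t + 1 / (2 * B) * t"
            using norm_triangle_ineq4[of "z - f x0" "f y - f x0 - f' (y - x0)"] 1 2 by linarith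
        qed (use B(1) in simp)
        also have "\<dots> = t" using B(1) by simp
        finally show "\<phi> y \<in> cball x0 t" by (simp add: dist_norm norm_minus_commute)
      qed
    qed (use t in auto)
    then obtain y where y: "y \<in> cball x0 t" "\<phi> y = y" by blast
    then have "g (f y - z) = 0" by (simp add: \<phi>_def)
    then have "f' (g (f y - z)) = 0" using linear_0[OF lf] by simp
    then have "f y - z = 0" using fg by (metis comp_apply id_apply)
    then show "z \<in> f ` cball x0 t" using y(1) by auto
  qed
  moreover have "1 / (2 * B) > 0" "min d1 (d2 / 2) > 0" using B d1 d2 by auto
  ultimately show ?thesis by blast
qed

text \<open>For curvature bound 0 the weight is constantly \<open>t powr Nn\<close>. Almost every
  curve of the measure starts at \<open>x\<close> and ends in \<open>A\<close>; being a geodesic, it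
  is at time \<open>t\<close> in a point to which \<open>mid\<close> applies. The contraction
  inequality is then tested on \<open>B\<close>.\<close>

lemma MCP_bound:
  assumes MCP: "MCP d (lborel :: pt3 measure) 0 Nn" and "1 < Nn" and x: "x \<in> msupport d lborel"
    and A: "A \<in> sets lborel" "0 < emeasure lborel A" "emeasure lborel A < \<infinity>"
    and t: "0 < t" "t \<le> 1" and B: "B \<in> sets lborel"
    and mid: "\<And>y m. y \<in> A \<Longrightarrow> d x m = t * d x y \<Longrightarrow> d m y = (1 - t) * d x y \<Longrightarrow> m \<in> B"
  shows "ennreal (t powr Nn) \<le> emeasure lborel B / emeasure lborel A"
proof -
  obtain \<eta> where \<eta>: "prob_space \<eta>" "sets \<eta> = sets (Geo_space d lborel)" "space \<eta> = space (Geo_space d lborel)"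
    "distr \<eta> lborel (\<lambda>\<gamma>. \<gamma> 0) = return lborel x"
    "distr \<eta> lborel (\<lambda>\<gamma>. \<gamma> 1) = density lborel (\<lambda>y. indicator A y / emeasure lborel A)"
    "\<And>t B. t \<in> {0..1} \<Longrightarrow> B \<in> sets lborel \<Longrightarrow>
            (\<integral>\<^sup>+ \<gamma>. indicator B (\<gamma> t) * enn_powr (tau_KN 0 Nn t (d (\<gamma> 0) (\<gamma> 1))) Nn \<partial>\<eta>)
              \<le> emeasure lborel B / emeasure lborel A"
    using MCP[unfolded MCP_def, rule_format, OF x A(1)] A(2,3) by blast
  interpret prob_space \<eta> by (rule \<eta>(1))
  have ev: "(\<lambda>\<gamma>. \<gamma> s) \<in> measurable \<eta> lborel" if "s \<in> {0..1}" for s :: real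
  proof -
    have "(\<lambda>\<gamma>. \<gamma> s) \<in> measurable (Geo_space d lborel) lborel"
      unfolding Geo_space_def by (rule measurable_restrict_space1) (rule measurable_component_singleton[OF that])
    then show ?thesis using measurable_cong_sets[OF \<eta>(2) refl] by blast
  qed
  have sp: "\<gamma> \<in> Geo d lborel" if "\<gamma> \<in> space \<eta>" for \<gamma>
    using that \<eta>(3) by (auto simp: Geo_space_def space_restrict_space)
  have "AE y in distr \<eta> lborel (\<lambda>\<gamma>. \<gamma> 0). y = x"
    unfolding \<eta>(4) by (subst AE_return) auto
  then have ae0: "AE \<gamma> in \<eta>. \<gamma> 0 = x"
    by (subst (asm) AE_distr_iff) (use ev[of 0] in auto)
  have "AE y in density lborel (\<lambda>y. indicator A y / emeasure lborel A). y \<in> A"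
    using A(1) by (subst AE_density) (auto simp: indicator_def)
  then have "AE y in distr \<eta> lborel (\<lambda>\<gamma>. \<gamma> 1). y \<in> A" unfolding \<eta>(5) .
  then have ae1: "AE \<gamma> in \<eta>. \<gamma> 1 \<in> A"
    by (subst (asm) AE_distr_iff) (use A(1) ev[of 1] in auto)
  have tau: "enn_powr (tau_KN 0 Nn t \<theta>) Nn = ennreal (t powr Nn)" for \<theta>
  proof -
    have "(Nn - 1) * pi\<^sup>2 > 0" using \<open>1 < Nn\<close> by simp
    then have "sigma_KN 0 (Nn - 1) t \<theta> = ennreal t" by (simp add: sigma_KN_def not_le)
    then have "tau_KN 0 Nn t \<theta> = ennreal (t powr (1 / Nn)) * ennreal (t powr (1 - 1 / Nn))"
      using t by (simp add: tau_KN_def enn_powr_def)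
    also have "\<dots> = ennreal (t powr (1 / Nn) * t powr (1 - 1 / Nn))" by (simp add: ennreal_mult)
    also have "t powr (1 / Nn) * t powr (1 - 1 / Nn) = t" using t by (simp add: powr_add[symmetric])
    finally show ?thesis using t by (simp add: enn_powr_def)
  qed
  have "AE \<gamma> in \<eta>. indicator B (\<gamma> t) * enn_powr (tau_KN 0 Nn t (d (\<gamma> 0) (\<gamma> 1))) Nn = ennreal (t powr Nn)"
    using ae0 ae1 AE_space
  proof eventually_elim
    fix \<gamma> assume *: "\<gamma> 0 = x" "\<gamma> 1 \<in> A" "\<gamma> \<in> space \<eta>"
    have geo: "d (\<gamma> s) (\<gamma> s') = \<bar>s' - s\<bar> * d (\<gamma> 0) (\<gamma> 1)" if "s \<in> {0..1}" "s' \<in> {0..1}" for s s'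
      using sp[OF *(3)] that unfolding Geo_def by blast
    have "\<gamma> t \<in> B"
      using mid[OF *(2), of "\<gamma> t"] geo[of 0 t] geo[of t 1] t *(1) by simp
    then show "indicator B (\<gamma> t) * enn_powr (tau_KN 0 Nn t (d (\<gamma> 0) (\<gamma> 1))) Nn = ennreal (t powr Nn)"
      by (simp add: tau)
  qed
  then have "(\<integral>\<^sup>+ \<gamma>. indicator B (\<gamma> t) * enn_powr (tau_KN 0 Nn t (d (\<gamma> 0) (\<gamma> 1))) Nn \<partial>\<eta>) = (\<integral>\<^sup>+ \<gamma>. ennreal (t powr Nn) \<partial>\<eta>)"
    by (rule nn_integral_cong_AE)
  also have "\<dots> = ennreal (t powr Nn)" by (simp add: emeasure_space_1)
  finally show ?thesis using \<eta>(6)[of t B] t B by simp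
qed

lemma has_vector_derivative_mk3:
  assumes "(c has_vector_derivative c') (at t within S)" "(z has_vector_derivative z') (at t within S)"
  shows "((\<lambda>t. mk3 (c t) (z t)) has_vector_derivative mk3 c' z') (at t within S)"
  unfolding mk3_def
  by (intro has_vector_derivative_Pair assms(2) bounded_linear.has_vector_derivative[OF bounded_linear_fst assms(1)]
      bounded_linear.has_vector_derivative[OF bounded_linear_snd assms(1)])

lemma cross2_lin:
  "cross2 (\<alpha> *\<^sub>R a + \<beta> *\<^sub>R b) (\<gamma> *\<^sub>R a + \<delta> *\<^sub>R b) = (\<alpha> * \<delta> - \<beta> * \<gamma>) * cross2 a b"
  by (simp add: cross2_def algebra_simps)

section \<open>Calibrations and their extremal curves\<close>

context flat_frame
begin

definition Xc :: "pt3 \<Rightarrow> real" where "Xc P = p \<bullet> hpt P"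
definition Yc :: "pt3 \<Rightarrow> real" where "Yc P = q \<bullet> hpt P"
text \<open>Along horizontal curves the height has derivative \<open>(X Y' - X' Y) / 2\<close>;
  adding \<open>X Y / 2\<close> turns this into \<open>X Y'\<close>.\<close>

definition Zc :: "pt3 \<Rightarrow> real" where "Zc P = vpt P + Xc P * Yc P / 2"

text \<open>The calibrations: \<open>X\<close> minus the integral of \<open>H (l + m x)\<close> over \<open>[0, X]\<close>, plus terms whose
  horizontal derivative is \<open>(l + m X) Y'\<close>.\<close>

definition F :: "real \<Rightarrow> real \<Rightarrow> pt3 \<Rightarrow> real" where
  "F l m P = Xc P - (K (l + m * Xc P) - K l) / m + l * Yc P + m * Zc P"

lemma cross2_pq: "cross2 p q = 1"
  using lagrange_cross2[of p q e v] by (simp add: ev pe pv qe qv)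

lemma p_le_N: "p \<bullet> u \<le> N u"
  using calib_le[of 0 u] s0 H0 by simp

lemma bl_Xc: "bounded_linear Xc" and bl_Yc: "bounded_linear Yc"
  unfolding Xc_def[abs_def] Yc_def[abs_def]
  by (intro bounded_linear_compose[OF bounded_linear_inner_right bounded_linear_hpt])+

lemma Xc_hvel [simp]: "Xc (hvel P u) = p \<bullet> u" and Yc_hvel [simp]: "Yc (hvel P u) = q \<bullet> u"
  by (simp_all add: Xc_def Yc_def hvel_def)

lemma vpt_hvel: "vpt (hvel P u) = (Xc P * (q \<bullet> u) - (p \<bullet> u) * Yc P) / 2"
  using lagrange_cross2[of p q "hpt P" u] by (simp add: hvel_def cross2_pq Xc_def Yc_def)

text \<open>The chain rule for \<open>K\<close> produces \<open>- H X'\<close> and \<open>Zc\<close>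
  produces \<open>X Y'\<close>. The result is the pairing of the control with the covector of
  parameter \<open>l + m * X\<close>, to which \<open>calib_le\<close> applies as long as the chart
  covers that parameter.\<close>

lemma F_along:
  assumes g: "(\<gamma> has_vector_derivative hvel (\<gamma> t) u) (at t within S)" and s: "\<bar>l + m * Xc (\<gamma> t)\<bar> < s0" and "m \<noteq> 0"
  shows "((\<lambda>t. F l m (\<gamma> t)) has_real_derivative
     ((1 - H (l + m * Xc (\<gamma> t))) * (p \<bullet> u) + (l + m * Xc (\<gamma> t)) * (q \<bullet> u))) (at t within S)"
proof -
  have dX: "((\<lambda>t. Xc (\<gamma> t)) has_real_derivative p \<bullet> u) (at t within S)"
    using bounded_linear.has_vector_derivative[OF bl_Xc g] by (simp add: has_real_derivative_iff_has_vector_derivative)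
  have dY: "((\<lambda>t. Yc (\<gamma> t)) has_real_derivative q \<bullet> u) (at t within S)"
    using bounded_linear.has_vector_derivative[OF bl_Yc g] by (simp add: has_real_derivative_iff_has_vector_derivative)
  have dv: "((\<lambda>t. vpt (\<gamma> t)) has_real_derivative (Xc (\<gamma> t) * (q \<bullet> u) - (p \<bullet> u) * Yc (\<gamma> t)) / 2) (at t within S)"
    using bounded_linear.has_vector_derivative[OF bounded_linear_vpt g]
    by (simp add: has_real_derivative_iff_has_vector_derivative vpt_hvel)
  have "((\<lambda>t. l + m * Xc (\<gamma> t)) has_real_derivative m * (p \<bullet> u)) (at t within S)"
    using DERIV_add[OF DERIV_const[of l] DERIV_cmult[OF dX, of m]] by simp
  from DERIV_chain2[OF K_deriv[OF s] this]
  have dK: "((\<lambda>t. K (l + m * Xc (\<gamma> t))) has_real_derivative H (l + m * Xc (\<gamma> t)) * (m * (p \<bullet> u))) (at t within S)" .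
  note d1 = DERIV_cdivide[OF DERIV_diff[OF dK DERIV_const[of "K l"]], of m]
  note d2 = DERIV_cmult[OF dY, of l]
  note d3 = DERIV_cmult[OF DERIV_add[OF dv DERIV_cdivide[OF DERIV_mult'[OF dX dY], of 2]], of m]
  show ?thesis
    unfolding F_def Zc_def
    by (rule DERIV_cong[OF DERIV_add[OF DERIV_add[OF DERIV_diff[OF dX d1] d2] d3]])
      (use \<open>m \<noteq> 0\<close> in \<open>simp add: field_simps\<close>)
qed

text \<open>Both \<open>p\<close> and \<open>- p\<close> are bounded by the norm, so
  \<open>Xc\<close> and \<open>- Xc\<close> are calibrations for all curves. This a priori bound
  keeps curves in the region where \<open>F l m\<close> is a calibration too.\<close>

lemma Xc_bound:
  assumes adm: "admissible \<gamma> u" and T: "T \<in> {0..1}"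
  shows "\<bar>Xc (\<gamma> T) - Xc (\<gamma> 0)\<bar> \<le> sF_length N u"
proof -
  interpret X: bounded_linear Xc by (rule bl_Xc)
  obtain B where B: "\<And>x. norm (Xc x) \<le> norm x * B" using X.bounded by blast
  have lip: "\<bar>Xc (\<gamma> s) - Xc (\<gamma> t)\<bar> \<le> B * dist (\<gamma> s) (\<gamma> t)" for s t
    using B[of "\<gamma> s - \<gamma> t"] by (simp add: X.diff dist_norm mult.commute)
  have 1: "Xc (\<gamma> T) - Xc (\<gamma> 0) \<le> sF_length N u"
  proof (rule calibration_bound[OF adm T lip])
    fix t assume "(\<gamma> has_vector_derivative hvel (\<gamma> t) (u t)) (at t within {0..T})"
    then have "((\<lambda>t. Xc (\<gamma> t)) has_real_derivative p \<bullet> u t) (at t within {0..T})"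
      using bounded_linear.has_vector_derivative[OF bl_Xc, of \<gamma> "hvel (\<gamma> t) (u t)"] by (simp add: has_real_derivative_iff_has_vector_derivative)
    then show "\<exists>D. ((\<lambda>t. Xc (\<gamma> t)) has_real_derivative D) (at t within {0..T}) \<and> D \<le> N (u t)"
      using p_le_N by blast
  qed
  have 2: "(- Xc (\<gamma> T)) - (- Xc (\<gamma> 0)) \<le> sF_length N u"
  proof (rule calibration_bound[OF adm T, where F = "\<lambda>P. - Xc P" and L = B])
    fix s t show "\<bar>- Xc (\<gamma> s) - - Xc (\<gamma> t)\<bar> \<le> B * dist (\<gamma> s) (\<gamma> t)"
      using lip[of t s] by (simp add: dist_commute)
  next
    fix t assume "(\<gamma> has_vector_derivative hvel (\<gamma> t) (u t)) (at t within {0..T})"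
    then have "((\<lambda>t. Xc (\<gamma> t)) has_real_derivative p \<bullet> u t) (at t within {0..T})"
      using bounded_linear.has_vector_derivative[OF bl_Xc, of \<gamma> "hvel (\<gamma> t) (u t)"] by (simp add: has_real_derivative_iff_has_vector_derivative)
    from DERIV_minus[OF this]
    show "\<exists>D. ((\<lambda>t. - Xc (\<gamma> t)) has_real_derivative D) (at t within {0..T}) \<and> D \<le> N (u t)"
      using p_le_N[of "- u t"] by (intro exI[of _ "- (p \<bullet> u t)"]) (simp add: N_minus)
  qed
  from 1 2 show ?thesis by (simp add: abs_le_iff)
qed

lemma H_cont: "continuous_on {-s0<..<s0} H"
proof (rule continuous_at_imp_continuous_on, rule ballI)
  fix x assume "x \<in> {-s0<..<s0}"
  then have "\<bar>x\<bar> < s0" by auto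
  then show "isCont H x" by (rule DERIV_isCont[OF H_deriv])
qed

text \<open>The chart ends at \<open>s0\<close>, so \<open>l + m * X\<close> must not leave it; a
  curve that starts with \<open>\<bar>X\<bar> \<le> R\<close> and is shorter than \<open>R\<close>
  keeps \<open>\<bar>X\<bar> \<le> 2 * R\<close>. The remaining work is a Lipschitz bound for
  \<open>F l m\<close> along the curve, required for absolute continuity.\<close>

lemma F_le_length:
  assumes adm: "admissible \<gamma> u" and X0: "\<bar>Xc (\<gamma> 0)\<bar> \<le> R" and len: "sF_length N u < R"
    and m: "0 < m" and lm: "\<bar>l\<bar> + m * (2 * R) < s0"
  shows "F l m (\<gamma> 1) - F l m (\<gamma> 0) \<le> sF_length N u"
proof -
  have X: "\<bar>Xc (\<gamma> t)\<bar> \<le> 2 * R" if "t \<in> {0..1}" for t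
    using Xc_bound[OF adm that] X0 len by linarith
  define s' where "s' = \<bar>l\<bar> + m * (2 * R)"
  have s': "\<bar>l + m * Xc (\<gamma> t)\<bar> \<le> s'" if "t \<in> {0..1}" for t
  proof -
    have "\<bar>m * Xc (\<gamma> t)\<bar> \<le> m * (2 * R)" using X[OF that] m by (simp add: abs_mult)
    then show ?thesis unfolding s'_def by linarith
  qed
  have ss: "s' < s0" using lm by (simp add: s'_def)
  have "compact (H ` {-s'..s'})"
    by (rule compact_continuous_image[OF continuous_on_subset[OF H_cont]]) (use ss in auto)
  then have "bounded (H ` {-s'..s'})" by (rule compact_imp_bounded)
  then obtain BH where BH: "\<And>s. s \<in> {-s'..s'} \<Longrightarrow> norm (H s) \<le> BH" unfolding bounded_iff by blast
  have Klip: "\<bar>K a - K b\<bar> \<le> BH * \<bar>a - b\<bar>" if "\<bar>a\<bar> \<le> s'" "\<bar>b\<bar> \<le> s'" for a b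
  proof -
    have "norm (K a - K b) \<le> BH * norm (a - b)"
    proof (rule field_differentiable_bound[of "{-s'..s'}"])
      fix z assume z: "z \<in> {-s'..s'}"
      then have "\<bar>z\<bar> < s0" using ss by auto
      then show "(K has_field_derivative H z) (at z within {-s'..s'})"
        by (rule has_field_derivative_at_within[OF K_deriv])
      show "norm (H z) \<le> BH" by (rule BH[OF z])
    qed (use that in auto)
    then show ?thesis by simp
  qed
  have "s' \<ge> 0" using s'[of 0] by (metis abs_ge_zero atLeastAtMost_iff order.refl order_trans zero_le_one)
  then have BH0: "BH \<ge> 0" using BH[of 0] norm_ge_zero[of "H 0"] by (metis atLeastAtMost_iff neg_le_0_iff_le order_trans)
  have "compact (\<gamma> ` {0..1})"
    by (rule compact_continuous_image[OF abs_continuous_on_imp_continuous_on[OF admissibleD(1)[OF adm]]]) simp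
  then have "bounded (\<gamma> ` {0..1})" by (rule compact_imp_bounded)
  then obtain Bg where Bg: "\<And>t. t \<in> {0..1} \<Longrightarrow> norm (\<gamma> t) \<le> Bg" unfolding bounded_iff by blast
  have Bg0: "Bg \<ge> 0" using Bg[of 0] norm_ge_zero[of "\<gamma> 0"] by (metis atLeastAtMost_iff order.refl order_trans zero_le_one)
  interpret X: bounded_linear Xc by (rule bl_Xc)
  interpret Y: bounded_linear Yc by (rule bl_Yc)
  interpret V: bounded_linear vpt by (rule bounded_linear_vpt)
  obtain BX where BX: "BX > 0" "\<And>x. norm (Xc x) \<le> norm x * BX" using X.pos_bounded by blast
  obtain BY where BY: "BY > 0" "\<And>x. norm (Yc x) \<le> norm x * BY" using Y.pos_bounded by blast
  \<comment> \<open>One summand each for \<open>X\<close>, the \<open>K\<close> term,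
    \<open>l * Y\<close> and \<open>m * Zc\<close>; the last uses the product rule on the bounded
    curve.\<close>
  define L where "L = BX + BH * BX + \<bar>l\<bar> * BY + m * (1 + (Bg * BX) * BY + (Bg * BY) * BX)"
  have lip: "\<bar>F l m (\<gamma> s) - F l m (\<gamma> t)\<bar> \<le> L * dist (\<gamma> s) (\<gamma> t)" if st: "s \<in> {0..1}" "t \<in> {0..1}" for s t
  proof -
    define D where "D = dist (\<gamma> s) (\<gamma> t)"
    have "D \<ge> 0" by (simp add: D_def)
    have x: "\<bar>Xc (\<gamma> s) - Xc (\<gamma> t)\<bar> \<le> BX * D" using BX(2)[of "\<gamma> s - \<gamma> t"] by (simp add: X.diff D_def dist_norm mult.commute)
    have y: "\<bar>Yc (\<gamma> s) - Yc (\<gamma> t)\<bar> \<le> BY * D" using BY(2)[of "\<gamma> s - \<gamma> t"] by (simp add: Y.diff D_def dist_norm mult.commute)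
    have z: "\<bar>vpt (\<gamma> s) - vpt (\<gamma> t)\<bar> \<le> D" using abs_vpt_le[of "\<gamma> s - \<gamma> t"] by (simp add: V.diff D_def dist_norm)
    have kk: "\<bar>(K (l + m * Xc (\<gamma> s)) - K (l + m * Xc (\<gamma> t))) / m\<bar> \<le> BH * BX * D"
    proof -
      have "\<bar>K (l + m * Xc (\<gamma> s)) - K (l + m * Xc (\<gamma> t))\<bar> \<le> BH * \<bar>(l + m * Xc (\<gamma> s)) - (l + m * Xc (\<gamma> t))\<bar>"
        by (rule Klip[OF s' s']) (use st in auto)
      also have "(l + m * Xc (\<gamma> s)) - (l + m * Xc (\<gamma> t)) = m * (Xc (\<gamma> s) - Xc (\<gamma> t))" by (simp add: algebra_simps)
      also have "BH * \<bar>m * (Xc (\<gamma> s) - Xc (\<gamma> t))\<bar> = m * (BH * \<bar>Xc (\<gamma> s) - Xc (\<gamma> t)\<bar>)" using m by (simp add: abs_mult)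
      also have "\<dots> \<le> m * (BH * (BX * D))" using x m BH0 by (intro mult_left_mono) auto
      finally show ?thesis using m by (simp add: field_simps)
    qed
    have Xb: "\<bar>Xc (\<gamma> s)\<bar> \<le> Bg * BX"
    proof -
      have "\<bar>Xc (\<gamma> s)\<bar> \<le> norm (\<gamma> s) * BX" using BX(2)[of "\<gamma> s"] by simp
      also have "\<dots> \<le> Bg * BX" using Bg[OF st(1)] BX(1) by (intro mult_right_mono) auto
      finally show ?thesis .
    qed
    have Yb: "\<bar>Yc (\<gamma> t)\<bar> \<le> Bg * BY"
    proof -
      have "\<bar>Yc (\<gamma> t)\<bar> \<le> norm (\<gamma> t) * BY" using BY(2)[of "\<gamma> t"] by simp
      also have "\<dots> \<le> Bg * BY" using Bg[OF st(2)] BY(1) by (intro mult_right_mono) auto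
      finally show ?thesis .
    qed
    have xy: "\<bar>Xc (\<gamma> s) * Yc (\<gamma> s) - Xc (\<gamma> t) * Yc (\<gamma> t)\<bar> \<le> (Bg * BX) * (BY * D) + (Bg * BY) * (BX * D)"
    proof -
      have "Xc (\<gamma> s) * Yc (\<gamma> s) - Xc (\<gamma> t) * Yc (\<gamma> t) = Xc (\<gamma> s) * (Yc (\<gamma> s) - Yc (\<gamma> t)) + Yc (\<gamma> t) * (Xc (\<gamma> s) - Xc (\<gamma> t))"
        by (simp add: algebra_simps)
      also have "\<bar>\<dots>\<bar> \<le> \<bar>Xc (\<gamma> s)\<bar> * \<bar>Yc (\<gamma> s) - Yc (\<gamma> t)\<bar> + \<bar>Yc (\<gamma> t)\<bar> * \<bar>Xc (\<gamma> s) - Xc (\<gamma> t)\<bar>"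
        by (metis abs_mult abs_triangle_ineq)
      also have "\<dots> \<le> (Bg * BX) * (BY * D) + (Bg * BY) * (BX * D)"
        using Xb Yb x y Bg0 BX(1) BY(1) by (intro add_mono mult_mono) auto
      finally show ?thesis .
    qed
    have zz: "\<bar>Zc (\<gamma> s) - Zc (\<gamma> t)\<bar> \<le> D + ((Bg * BX) * (BY * D) + (Bg * BY) * (BX * D))"
    proof -
      have "Zc (\<gamma> s) - Zc (\<gamma> t) = (vpt (\<gamma> s) - vpt (\<gamma> t)) + (Xc (\<gamma> s) * Yc (\<gamma> s) - Xc (\<gamma> t) * Yc (\<gamma> t)) / 2"
        by (simp add: Zc_def diff_divide_distrib)
      moreover have "\<bar>a + b / 2\<bar> \<le> D + W" if "\<bar>a\<bar> \<le> D" "\<bar>b\<bar> \<le> W" for a b W :: real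
        using that by linarith
      ultimately show ?thesis using z xy by presburger
    qed
    have lY: "\<bar>l * (Yc (\<gamma> s) - Yc (\<gamma> t))\<bar> \<le> \<bar>l\<bar> * (BY * D)" using y by (simp add: abs_mult mult_left_mono)
    have mZ: "\<bar>m * (Zc (\<gamma> s) - Zc (\<gamma> t))\<bar> \<le> m * (D + ((Bg * BX) * (BY * D) + (Bg * BY) * (BX * D)))"
      using zz m by (simp add: abs_mult mult_left_mono)
    have "F l m (\<gamma> s) - F l m (\<gamma> t) = (Xc (\<gamma> s) - Xc (\<gamma> t)) - (K (l + m * Xc (\<gamma> s)) - K (l + m * Xc (\<gamma> t))) / m
        + l * (Yc (\<gamma> s) - Yc (\<gamma> t)) + m * (Zc (\<gamma> s) - Zc (\<gamma> t))"
      by (simp add: F_def diff_divide_distrib algebra_simps)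
    then have "\<bar>F l m (\<gamma> s) - F l m (\<gamma> t)\<bar> \<le> BX * D + BH * BX * D + \<bar>l\<bar> * (BY * D) + m * (D + ((Bg * BX) * (BY * D) + (Bg * BY) * (BX * D)))"
      using x kk lY mZ by linarith
    also have "\<dots> = L * D" by (simp add: L_def algebra_simps)
    finally show ?thesis by (simp add: D_def)
  qed
  have one: "(1::real) \<in> {0..1}" by simp
  show ?thesis
  proof (rule calibration_bound[OF adm one])
    fix s t :: real assume "s \<in> {0..1}" "t \<in> {0..1}"
    then show "\<bar>F l m (\<gamma> s) - F l m (\<gamma> t)\<bar> \<le> L * dist (\<gamma> s) (\<gamma> t)" by (rule lip)
  next
    fix t :: real assume t: "t \<in> {0..1}" and g: "(\<gamma> has_vector_derivative hvel (\<gamma> t) (u t)) (at t within {0..1})"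
    have s: "\<bar>l + m * Xc (\<gamma> t)\<bar> < s0" using s'[OF t] ss by linarith
    show "\<exists>D. ((\<lambda>t. F l m (\<gamma> t)) has_real_derivative D) (at t within {0..1}) \<and> D \<le> N (u t)"
      using F_along[OF g s] m calib_le[of "l + m * Xc (\<gamma> t)" "u t"] s by (metis less_imp_le less_irrefl)
  qed
qed

lemma F_le_dist:
  assumes X0: "\<bar>Xc P\<bar> \<le> R" and len: "sF_dist N P Q < R" and m: "0 < m" and lm: "\<bar>l\<bar> + m * (2 * R) < s0"
  shows "F l m Q - F l m P \<le> sF_dist N P Q"
proof (rule ccontr)
  assume "\<not> ?thesis"
  then have "sF_dist N P Q < min R (F l m Q - F l m P)" using len by simp
  then obtain \<gamma> u where g: "admissible \<gamma> u" "\<gamma> 0 = P" "\<gamma> 1 = Q" "sF_length N u < min R (F l m Q - F l m P)"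
    by (rule sF_dist_lessE)
  then show False using F_le_length[OF g(1), of R m l] X0 m lm by simp
qed

lemma Xc_le_dist: "\<bar>Xc Q - Xc P\<bar> \<le> sF_dist N P Q"
proof (rule ccontr)
  assume "\<not> ?thesis"
  then have "sF_dist N P Q < \<bar>Xc Q - Xc P\<bar>" by simp
  then obtain \<gamma> u where "admissible \<gamma> u" "\<gamma> 0 = P" "\<gamma> 1 = Q" "sF_length N u < \<bar>Xc Q - Xc P\<bar>" by (rule sF_dist_lessE)
  then show False using Xc_bound[of \<gamma> u 1] by simp
qed

text \<open>The point with \<open>X = a\<close> on the curve from 0 with velocity
  \<open>e + k (l + m X) v\<close>. Here \<open>b\<close> is the integral of
  \<open>k (l + m x)\<close> over [0, a]; the quotient by \<open>m * m\<close> is the integral of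
  \<open>x k (l + m x)\<close>, by parts, and subtracting \<open>a * b / 2\<close> passes from
  \<open>Zc\<close> to the height.\<close>

definition endpt :: "real \<Rightarrow> real \<Rightarrow> real \<Rightarrow> pt3" where
  "endpt l m a = (let b = (H (l + m * a) - H l) / m in
     mk3 (a *\<^sub>R e + b *\<^sub>R v) ((a * m * H (l + m * a) - (K (l + m * a) - K l)) / (m * m) - a * b / 2))"

lemma endpt_0: "endpt l m 0 = 0"
  by (simp add: endpt_def Let_def mk3_def zero_prod_def)

lemma endpt_coords: "Xc (endpt l m a) = a" "Yc (endpt l m a) = (H (l + m * a) - H l) / m"
  by (simp_all add: endpt_def Let_def Xc_def Yc_def inner_add_right pe pv qe qv)

text \<open>By \<open>calib_eq\<close> the curve runs in directions in which \<open>F l m\<close>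
  grows at full speed, so its length is the increment of \<open>F l m\<close>. The second, cruder
  bound is uniform in \<open>l\<close> and \<open>m\<close> and fixes the radius \<open>R\<close> in
  \<open>not_MCP\<close>.\<close>

lemma endpt_dist_le:
  assumes m: "0 < m" and a: "0 < a" and lm: "\<bar>l\<bar> + m * a < s0"
  shows "sF_dist N 0 (endpt l m a) \<le> F l m (endpt l m a)"
    and "sF_dist N 0 (endpt l m a) \<le> a * (N e + (k s0 - k (- s0)) * N v)"
proof -
  define \<gamma> where "\<gamma> t = endpt l m (a * t)" for t
  define u where "u t = a *\<^sub>R (e + k (l + m * (a * t)) *\<^sub>R v)" for t
  have s: "\<bar>l + m * (a * t)\<bar> < s0" if "t \<in> {0..1}" for t
  proof -
    have "\<bar>m * (a * t)\<bar> \<le> m * a" using that m a by (simp add: abs_mult mult_left_le)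
    then show ?thesis using lm by linarith
  qed
  have g: "(\<gamma> has_vector_derivative hvel (\<gamma> t) (u t)) (at t within {0..1})" if t: "t \<in> {0..1}" for t
  proof -
    define sg where "sg t = l + m * (a * t)" for t
    define Y where "Y t = (H (sg t) - H l) / m" for t
    define Z where "Z t = (a * t * m * H (sg t) - (K (sg t) - K l)) / (m * m) - a * t * Y t / 2" for t
    have ds: "(sg has_real_derivative m * a) (at t within {0..1})"
      unfolding sg_def by (auto intro!: derivative_eq_intros)
    have st: "\<bar>sg t\<bar> < s0" using s[OF t] by (simp add: sg_def)
    have dH: "((\<lambda>t. H (sg t)) has_real_derivative k (sg t) * (m * a)) (at t within {0..1})"
      by (rule DERIV_chain2[OF H_deriv[OF st] ds])
    have dK: "((\<lambda>t. K (sg t)) has_real_derivative H (sg t) * (m * a)) (at t within {0..1})"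
      by (rule DERIV_chain2[OF K_deriv[OF st] ds])
    have dY: "(Y has_real_derivative a * k (sg t)) (at t within {0..1})"
      unfolding Y_def
      by (rule DERIV_cong[OF DERIV_cdivide[OF DERIV_diff[OF dH DERIV_const]]]) (use m in simp)
    have dZ: "(Z has_real_derivative (a * t * (a * k (sg t)) - a * Y t) / 2) (at t within {0..1})"
    proof -
      have da: "((\<lambda>t. a * t) has_real_derivative a) (at t within {0..1})"
        by (auto intro!: derivative_eq_intros)
      have dam: "((\<lambda>t. a * t * m) has_real_derivative a * m) (at t within {0..1})"
        by (auto intro!: derivative_eq_intros)
      show ?thesis
        unfolding Z_def
        by (rule DERIV_cong[OF DERIV_diff[OF DERIV_cdivide[OF DERIV_diff[OF DERIV_mult'[OF dam dH] DERIV_diff[OF dK DERIV_const]]]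
              DERIV_cdivide[OF DERIV_mult'[OF da dY]]]])
          (use m in \<open>simp add: field_simps\<close>)
    qed
    have "((\<lambda>t. (a * t) *\<^sub>R e + Y t *\<^sub>R v) has_vector_derivative (a *\<^sub>R e + (a * k (sg t)) *\<^sub>R v)) (at t within {0..1})"
      by (intro has_vector_derivative_add bounded_linear.has_vector_derivative[OF bounded_linear_scaleR_left]) (auto intro!: derivative_eq_intros dY simp flip: has_real_derivative_iff_has_vector_derivative)
    then have "((\<lambda>t. mk3 ((a * t) *\<^sub>R e + Y t *\<^sub>R v) (Z t)) has_vector_derivative
        mk3 (a *\<^sub>R e + (a * k (sg t)) *\<^sub>R v) ((a * t * (a * k (sg t)) - a * Y t) / 2)) (at t within {0..1})"
      by (rule has_vector_derivative_mk3) (rule dZ[unfolded has_real_derivative_iff_has_vector_derivative])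
    moreover have "(\<lambda>t. mk3 ((a * t) *\<^sub>R e + Y t *\<^sub>R v) (Z t)) = \<gamma>"
      by (simp add: fun_eq_iff \<gamma>_def endpt_def Let_def Y_def Z_def sg_def)
    moreover have "mk3 (a *\<^sub>R e + (a * k (sg t)) *\<^sub>R v) ((a * t * (a * k (sg t)) - a * Y t) / 2) = hvel (\<gamma> t) (u t)"
    proof -
      have "cross2 (hpt (\<gamma> t)) (u t) = (a * t * (a * k (sg t)) - a * Y t) * cross2 e v"
        using cross2_lin[of "a * t" e "Y t" v a "a * k (sg t)"]
        by (simp add: \<gamma>_def endpt_def Let_def Y_def sg_def u_def scaleR_add_right mult.commute)
      then show ?thesis by (simp add: hvel_def ev u_def sg_def scaleR_add_right)
    qed
    ultimately show ?thesis by simp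
  qed
  have kc: "continuous_on {0..1} (\<lambda>t. k (l + m * (a * t)))"
    by (rule continuous_on_compose2[OF k_cont]) (auto intro!: continuous_intros dest!: s)
  have uc: "continuous_on {0..1} u"
    unfolding u_def by (intro continuous_intros kc)
  have adm: "admissible \<gamma> u" by (rule admissible_smooth[OF g uc])
  have ends: "\<gamma> 0 = 0" "\<gamma> 1 = endpt l m a" by (simp_all add: \<gamma>_def endpt_0)
  have le: "sF_dist N 0 (endpt l m a) \<le> sF_length N u" by (rule sF_dist_le[OF adm ends])
  have Nu: "N (u t) = (1 - H (l + m * Xc (\<gamma> t))) * (p \<bullet> u t) + (l + m * Xc (\<gamma> t)) * (q \<bullet> u t)" if "t \<in> {0..1}" for t
  proof -
    define sg where "sg = l + m * (a * t)"
    have "N (u t) = a * (1 - H sg + sg * k sg)"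
      using calib_eq[of sg] s[OF that] a by (simp add: u_def N_scale sg_def)
    moreover have "p \<bullet> u t = a" "q \<bullet> u t = a * k sg"
      by (simp_all add: u_def sg_def inner_add_right pe pv qe qv)
    moreover have "l + m * Xc (\<gamma> t) = sg" by (simp add: \<gamma>_def endpt_coords sg_def)
    ultimately show ?thesis by (simp add: algebra_simps)
  qed
  have "((\<lambda>t. N (u t)) has_integral (F l m (\<gamma> 1) - F l m (\<gamma> 0))) {0..1}"
  proof (rule fundamental_theorem_of_calculus)
    fix t :: real assume t: "t \<in> {0..1}"
    have "\<bar>l + m * Xc (\<gamma> t)\<bar> < s0" using s[OF t] by (simp add: \<gamma>_def endpt_coords)
    from F_along[OF g[OF t] this] m Nu[OF t]
    show "((\<lambda>t. F l m (\<gamma> t)) has_vector_derivative N (u t)) (at t within {0..1})"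
      by (simp add: has_real_derivative_iff_has_vector_derivative)
  qed simp
  then have "sF_length N u = F l m (\<gamma> 1) - F l m (\<gamma> 0)"
    using sF_length_eq(1)[OF adm] has_integral_unique by blast
  moreover have "F l m 0 = 0" by (simp add: F_def Xc_def Yc_def Zc_def)
  ultimately show "sF_dist N 0 (endpt l m a) \<le> F l m (endpt l m a)" using le ends by simp
  have "sF_length N u \<le> a * (N e + (k s0 - k (- s0)) * N v)"
  proof -
    have "((\<lambda>t. a * (N e + (k s0 - k (- s0)) * N v)) has_integral a * (N e + (k s0 - k (- s0)) * N v)) {0..1::real}"
      using has_integral_const_real[of "a * (N e + (k s0 - k (- s0)) * N v)" 0 1] by simp
    then show ?thesis
    proof (rule has_integral_le[OF sF_length_eq(1)[OF adm]])
      fix t :: real assume t: "t \<in> {0..1}"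
      define sg where "sg = l + m * (a * t)"
      have sg: "\<bar>sg\<bar> < s0" using s[OF t] by (simp add: sg_def)
      have k1: "k sg < k s0" "k (- s0) < k sg" using sg by (auto intro!: k_strict)
      have k2: "k (- s0) < 0" "0 < k s0" using k_strict[of "- s0" 0] k_strict[of 0 s0] s0 k0 by auto
      have kb: "\<bar>k sg\<bar> \<le> k s0 - k (- s0)" using k1 k2 by auto
      have "N (u t) = a * N (e + k sg *\<^sub>R v)" using a by (simp add: u_def sg_def N_scale)
      also have "\<dots> \<le> a * (N e + \<bar>k sg\<bar> * N v)"
        using N_triangle[of e "k sg *\<^sub>R v"] a by (simp add: N_scale)
      also have "\<dots> \<le> a * (N e + (k s0 - k (- s0)) * N v)"
        using kb a by (intro mult_left_mono add_left_mono mult_right_mono) auto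
      finally show "N (u t) \<le> a * (N e + (k s0 - k (- s0)) * N v)" .
    qed
  qed
  then show "sF_dist N 0 (endpt l m a) \<le> a * (N e + (k s0 - k (- s0)) * N v)" using le by linarith
qed

end

lemma emeasure_lborel_Times:
  assumes "A \<in> sets borel" "B \<in> sets borel"
  shows "emeasure lborel (A \<times> B :: ('a::euclidean_space \<times> 'b::euclidean_space) set) = emeasure lborel A * emeasure lborel B"
  using lborel.emeasure_pair_measure_Times[of A lborel B] assms by (simp add: lborel_prod)

section \<open>The endpoint map and the contraction estimate\<close>

context flat_frame
begin

text \<open>As a function of \<open>r\<close>, \<open>2 * k s * K r - (H r)\<^sup>2\<close> vanishes
  at 0 and has the derivative \<open>2 * H r * (k s - k r)\<close>, positive because
  \<open>k\<close> is strictly increasing. At \<open>r = s\<close> its positivity makes the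
  derivative of the endpoint map injective.\<close>

lemma H_sq_less:
  assumes "0 < s" "s < s0" shows "(H s)\<^sup>2 < 2 * k s * K s"
proof -
  have kpos: "0 < k r" if "0 < r" "r \<le> s0" for r using k_strict[of 0 r] that s0 k0 by simp
  have Hc: "continuous_on {0..r} H" if "r < s0" for r
    by (rule continuous_on_subset[OF H_cont]) (use that in auto)
  have Hpos: "0 < H r" if r: "0 < r" "r < s0" for r
  proof -
    have "H 0 < H r"
    proof (rule DERIV_pos_imp_increasing_open[OF r(1)])
      fix x assume x: "0 < x" "x < r"
      then show "\<exists>y. (H has_real_derivative y) (at x) \<and> 0 < y"
        using H_deriv[of x] kpos[of x] r by auto
    qed (rule Hc[OF r(2)])
    then show ?thesis by (simp add: H0)
  qed
  have Kc: "continuous_on {0..s} K"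
    by (rule continuous_at_imp_continuous_on) (use assms in \<open>auto intro!: DERIV_isCont[OF K_deriv]\<close>)
  have "2 * k s * K 0 - (H 0)\<^sup>2 < 2 * k s * K s - (H s)\<^sup>2"
  proof (rule DERIV_pos_imp_increasing_open[OF assms(1), where f = "\<lambda>r. 2 * k s * K r - (H r)\<^sup>2"])
    fix x assume x: "0 < x" "x < s"
    then have xs: "\<bar>x\<bar> < s0" using assms by auto
    have "((\<lambda>r. 2 * k s * K r - (H r)\<^sup>2) has_real_derivative (2 * k s * H x - 2 * H x * k x)) (at x)"
      by (rule DERIV_cong[OF DERIV_diff[OF DERIV_cmult[OF K_deriv[OF xs]] DERIV_power[OF H_deriv[OF xs]]]]) simp
    moreover have "0 < 2 * H x * (k s - k x)"
      using Hpos[of x] k_strict[of x s] x assms by (intro mult_pos_pos) auto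
    then have "0 < 2 * k s * H x - 2 * H x * k x" by (simp add: algebra_simps)
    ultimately show "\<exists>y. ((\<lambda>r. 2 * k s * K r - (H r)\<^sup>2) has_real_derivative y) (at x) \<and> 0 < y" by blast
  qed (intro continuous_intros Kc Hc assms(2))
  then show ?thesis by (simp add: H0 K0)
qed

definition E :: "pt3 \<Rightarrow> pt3" where
  "E w = endpt (fst w) (fst (snd w)) (snd (snd w))"

lemma E_cont:
  assumes "\<And>w. w \<in> S \<Longrightarrow> \<bar>fst w + fst (snd w) * snd (snd w)\<bar> < s0 \<and> \<bar>fst w\<bar> < s0 \<and> fst (snd w) \<noteq> 0"
  shows "continuous_on S E"
proof -
  have Kc: "continuous_on {-s0<..<s0} K"
    by (rule continuous_at_imp_continuous_on) (auto intro!: DERIV_isCont[OF K_deriv])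
  have c1: "continuous_on S (\<lambda>w. f (fst w + fst (snd w) * snd (snd w)))" "continuous_on S (\<lambda>w. f (fst w))"
    if "continuous_on {-s0<..<s0} f" for f :: "real \<Rightarrow> real"
    by (rule continuous_on_compose2[OF that], (intro continuous_intros), use assms in fastforce)+
  show ?thesis
    unfolding E_def endpt_def Let_def mk3_def
    by (intro continuous_intros c1 H_cont Kc) (use assms in auto)
qed

text \<open>At \<open>l = 0\<close> the terms \<open>H l\<close> and \<open>K l\<close> have zero
  derivative. A kernel vector has no \<open>a\<close>-component, by the coordinate along
  \<open>e\<close>; the other two coordinates form a linear system in the \<open>l\<close> and
  \<open>m\<close> components whose determinant is nonzero by \<open>H_sq_less\<close>.\<close>

lemma E_deriv:
  assumes \<mu>: "0 < \<mu>" "\<mu> < s0"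
  shows "\<exists>E'. (E has_derivative E') (at (0, \<mu>, 1)) \<and> inj E'"
proof -
  define k1 h1 K1 where "k1 = k \<mu>" and "h1 = H \<mu>" and "K1 = K \<mu>"
  define A :: "pt3 \<Rightarrow> real" where "A = (\<lambda>w. fst w)"
  define M :: "pt3 \<Rightarrow> real" where "M = (\<lambda>w. fst (snd w))"
  define T :: "pt3 \<Rightarrow> real" where "T = (\<lambda>w. snd (snd w))"
  have dA: "(A has_derivative A) (at x)" and dM: "(M has_derivative M) (at x)" and dT: "(T has_derivative T) (at x)" for x
    unfolding A_def M_def T_def by (auto intro!: derivative_eq_intros)
  define x0 :: pt3 where "x0 = (0, \<mu>, 1)"
  have x0: "A x0 = 0" "M x0 = \<mu>" "T x0 = 1" by (simp_all add: x0_def A_def M_def T_def)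
  define sd where "sd w = A w + (\<mu> * T w + M w)" for w
  have ds: "((\<lambda>w. A w + M w * T w) has_derivative sd) (at x0)"
    unfolding sd_def[abs_def]
    using has_derivative_add[OF dA has_derivative_mult[OF dM dT], of x0] by (simp add: x0 mult.commute)
  have s: "\<bar>A x0 + M x0 * T x0\<bar> < s0" "\<bar>A x0\<bar> < s0" using \<mu> by (simp_all add: x0)
  have dH: "((\<lambda>w. H (A w + M w * T w)) has_derivative (\<lambda>w. sd w * k1)) (at x0)"
    using DERIV_compose_FDERIV[OF H_deriv[OF s(1)] ds] by (simp add: x0 k1_def)
  have dK: "((\<lambda>w. K (A w + M w * T w)) has_derivative (\<lambda>w. sd w * h1)) (at x0)"
    using DERIV_compose_FDERIV[OF K_deriv[OF s(1)] ds] by (simp add: x0 h1_def)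
  have dHA: "((\<lambda>w. H (A w)) has_derivative (\<lambda>w. 0)) (at x0)"
    using DERIV_compose_FDERIV[OF H_deriv[OF s(2)] dA] by (simp add: x0 k0)
  have dKA: "((\<lambda>w. K (A w)) has_derivative (\<lambda>w. 0)) (at x0)"
    using DERIV_compose_FDERIV[OF K_deriv[OF s(2)] dA] by (simp add: x0 H0)
  define b where "b w = (H (A w + M w * T w) - H (A w)) / M w" for w
  define z where "z w = (T w * M w * H (A w + M w * T w) - (K (A w + M w * T w) - K (A w))) / (M w * M w)" for w
  define b' where "b' w = (sd w * k1 * \<mu> - h1 * M w) / (\<mu> * \<mu>)" for w
  define z' where "z' w = (((T w * \<mu> + M w) * h1 + \<mu> * (sd w * k1) - sd w * h1) * (\<mu> * \<mu>) - (\<mu> * h1 - K1) * (2 * \<mu> * M w)) / ((\<mu> * \<mu>) * (\<mu> * \<mu>))" for w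
  have db: "(b has_derivative b') (at x0)"
    unfolding b_def[abs_def]
    by (rule has_derivative_eq_rhs[OF has_derivative_divide'[OF has_derivative_diff[OF dH dHA] dM]])
      (use \<mu> in \<open>simp_all add: x0 H0 b'_def fun_eq_iff h1_def\<close>)
  have dz: "(z has_derivative z') (at x0)"
    unfolding z_def[abs_def]
    by (rule has_derivative_eq_rhs[OF has_derivative_divide'[OF has_derivative_diff[OF has_derivative_mult[OF has_derivative_mult[OF dT dM] dH]
            has_derivative_diff[OF dK dKA]] has_derivative_mult[OF dM dM]]])
      (use \<mu> in \<open>simp_all add: x0 H0 K0 z'_def fun_eq_iff h1_def K1_def algebra_simps\<close>)
  define E' where "E' w = mk3 (T w *\<^sub>R e + b' w *\<^sub>R v) (z' w - (b x0 * T w + b' w) / 2)" for w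
  have Eeq: "E = (\<lambda>w. mk3 (T w *\<^sub>R e + b w *\<^sub>R v) (z w - T w * b w / 2))"
    by (simp add: fun_eq_iff E_def endpt_def Let_def A_def M_def T_def b_def z_def)
  have dc: "((\<lambda>w. T w *\<^sub>R e + b w *\<^sub>R v) has_derivative (\<lambda>w. T w *\<^sub>R e + b' w *\<^sub>R v)) (at x0)"
    by (intro has_derivative_add has_derivative_scaleR_left dT db)
  have dv: "((\<lambda>w. z w - T w * b w / 2) has_derivative (\<lambda>w. z' w - (b x0 * T w + b' w) / 2)) (at x0)"
    by (rule has_derivative_eq_rhs[OF has_derivative_diff[OF dz has_derivative_divide'[OF has_derivative_mult[OF dT db] has_derivative_const]]])
      (simp_all add: x0 fun_eq_iff mult.commute)
  have dE: "(E has_derivative E') (at x0)"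
    unfolding Eeq E'_def[abs_def] mk3_def
    by (intro has_derivative_Pair has_derivative_fst dc has_derivative_snd dv)
  have "inj E'"
  proof -
    have lin: "linear E'" using dE has_derivative_linear by blast
    have "w = 0" if w: "E' w = 0" for w
    proof -
      have c0: "T w *\<^sub>R e + b' w *\<^sub>R v = 0" and v0: "z' w - (b x0 * T w + b' w) / 2 = 0"
        using arg_cong[OF w, of hpt] arg_cong[OF w, of vpt] by (simp_all add: E'_def)
      have T0: "T w = 0" using arg_cong[OF c0, of "\<lambda>u. p \<bullet> u"] by (simp add: inner_add_right pe pv)
      have b0: "b' w = 0" using arg_cong[OF c0, of "\<lambda>u. q \<bullet> u"] by (simp add: inner_add_right qe qv)
      have z0: "z' w = 0" using v0 T0 b0 by simp
      have 1: "(A w + M w) * k1 * \<mu> = h1 * M w" using b0 T0 \<mu> by (simp add: b'_def sd_def)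
      have 2: "(M w * h1 + \<mu> * ((A w + M w) * k1) - (A w + M w) * h1) * \<mu> = (\<mu> * h1 - K1) * (2 * M w)"
      proof -
        have "((M w * h1 + \<mu> * ((A w + M w) * k1) - (A w + M w) * h1) * \<mu>) * \<mu> = ((\<mu> * h1 - K1) * (2 * M w)) * \<mu>"
          using z0 T0 \<mu> by (simp add: z'_def sd_def algebra_simps)
        then show ?thesis using \<mu> by simp
      qed
      have 3: "h1 * \<mu> * (A w + M w) = 2 * K1 * M w"
      proof -
        have "\<mu> * ((A w + M w) * k1) = h1 * M w" using 1 by (simp add: mult_ac)
        then have "(M w * h1 + h1 * M w - (A w + M w) * h1) * \<mu> = (\<mu> * h1 - K1) * (2 * M w)" using 2 by simp
        then show ?thesis by (simp add: algebra_simps)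
      qed
      \<comment> \<open>Multiplying 1 by \<open>h1\<close> and inserting 3 eliminates the
        \<open>l\<close>-component.\<close>
      have "h1 * (h1 * M w) = h1 * ((A w + M w) * k1 * \<mu>)" by (simp only: 1)
      also have "\<dots> = k1 * (h1 * \<mu> * (A w + M w))" by (simp add: mult_ac)
      also have "\<dots> = k1 * (2 * K1 * M w)" by (simp only: 3)
      finally have "(2 * k1 * K1 - h1\<^sup>2) * M w = 0" by (auto simp: algebra_simps power2_eq_square)
      moreover have "2 * k1 * K1 - h1\<^sup>2 > 0" using H_sq_less[OF \<mu>] by (simp add: k1_def K1_def h1_def)
      ultimately have M0: "M w = 0" by simp
      have "k1 > 0" using k_strict[of 0 \<mu>] \<mu> s0 k0 by (simp add: k1_def)
      then have "A w = 0" using 1 M0 \<mu> by simp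
      then show ?thesis using M0 T0 by (simp add: A_def M_def T_def prod_eq_iff)
    qed
    then show ?thesis using lin by (simp add: linear_injective_0)
  qed
  then show ?thesis using dE by (auto simp: x0_def)
qed

text \<open>The set \<open>A\<close> is chosen together with the time \<open>t\<close>: parameters
  within \<open>t\<close> of \<open>(0, \<mu>, 1)\<close> keep \<open>l\<close>, and with it the
  arguments of \<open>K\<close>, of size O(t).\<close>

proposition not_MCP:
  assumes "1 < Nn" shows "\<not> MCP (sF_dist N) (lborel :: pt3 measure) 0 Nn"
proof
  assume MCP: "MCP (sF_dist N) (lborel :: pt3 measure) 0 Nn"
  \<comment> \<open>Since \<open>a \<le> 2\<close> below, \<open>endpt_dist_le\<close> puts all
    endpoints in question at distance less than \<open>R\<close> from 0.\<close>
  define R where "R = 2 * (N e + (k s0 - k (- s0)) * N v) + 1"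
  have k12: "k (- s0) < 0" "0 < k s0" using k_strict[of "- s0" 0] k_strict[of 0 s0] s0 k0 by auto
  have R1: "R \<ge> 1" using k12 by (simp add: R_def)
  \<comment> \<open>With \<open>m' \<le> 2 * \<mu>\<close> this gives
    \<open>m' * (2 * R) \<le> 4 * s0 / 10\<close>; together with
    \<open>\<bar>l'\<bar> < s0 / 10\<close> it stays within the range of
    \<open>F_le_dist\<close>.\<close>
  define \<mu> where "\<mu> = s0 / (10 * R)"
  have \<mu>: "0 < \<mu>" "\<mu> < s0" "\<mu> * R = s0 / 10"
    using s0 R1 by (auto simp: \<mu>_def field_simps)
  have \<mu>s: "\<mu> \<le> s0 / 10"
  proof -
    have "\<mu> * 1 \<le> \<mu> * R" using \<mu>(1) R1 by (intro mult_left_mono) auto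
    then show ?thesis using \<mu>(3) by simp
  qed
  define S :: "pt3 set" where "S = {w. \<bar>fst w + fst (snd w) * snd (snd w)\<bar> < s0 \<and> \<bar>fst w\<bar> < s0 \<and> 0 < fst (snd w)}"
  have "open S" unfolding S_def
    by (intro open_Collect_conj open_Collect_less continuous_intros)
  moreover have "(0, \<mu>, 1) \<in> S" using \<mu> s0 by (simp add: S_def)
  moreover have "continuous_on S E" by (rule E_cont) (auto simp: S_def)
  moreover obtain E' where "(E has_derivative E') (at (0, \<mu>, 1))" "inj E'" using E_deriv[OF \<mu>(1,2)] by blast
  ultimately obtain c t0 where ct: "c > 0" "t0 > 0"
    "\<And>t. 0 < t \<Longrightarrow> t \<le> t0 \<Longrightarrow> ball (E (0, \<mu>, 1)) (c * t) \<subseteq> E ` cball (0, \<mu>, 1) t"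
    using local_surjection[of S "(0, \<mu>, 1)" E E'] by blast
  \<comment> \<open>\<open>A\<close> has volume of order \<open>t ^ 3\<close> and \<open>B\<close>
    of order \<open>t ^ n\<close>; \<open>n - 1 \<ge> Nn + 3\<close> leaves a spare factor
    \<open>t\<close> for the contradiction.\<close>
  define n where "n = nat \<lceil>Nn\<rceil> + 4"
  have n: "Nn + 3 \<le> real (n - 1)" "n \<ge> 1" using assms by (auto simp: n_def)
  obtain KA r where KA: "KA > 0" "r > 0" "\<And>s. \<bar>s\<bar> < r \<Longrightarrow> \<bar>K s\<bar> \<le> KA * \<bar>s\<bar> ^ Suc n" using K_flat[of "Suc n"] by blast
  \<comment> \<open>\<open>Gc * t\<close> bounds the arguments of \<open>K\<close>, because
    \<open>\<bar>l'\<bar> \<le> 2 * t\<close>, \<open>m' \<le> 2 * \<mu>\<close> and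
    \<open>\<bar>X\<bar> \<le> t * R\<close>.\<close>
  define Gc where "Gc = 2 + 2 * \<mu> * R"
  have "Gc > 0" using \<mu> s0 by (simp add: Gc_def mult.assoc)
  \<comment> \<open>Chosen so that the \<open>K\<close> term of a calibration, at most
    \<open>2 * KA * (Gc * t) ^ Suc n\<close> divided by \<open>\<mu> / 2\<close>, is at most half of
    \<open>t * \<rho>\<close> with \<open>\<rho> = Q * t ^ n\<close>.\<close>
  define Q where "Q = 8 * KA * Gc ^ Suc n / \<mu>"
  have "Q > 0" using KA \<open>Gc > 0\<close> \<mu> by (simp add: Q_def)
  define C where "C = R * norm e + norm v"
  have "C \<ge> 0" using R1 by (simp add: C_def)
  define W where "W = unit_ball_vol 3 * c ^ 3"
  have "W > 0" using ct(1) by (simp add: W_def)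
  define V where "V = (2 * C) * (2 * C) * (2 * (1 + R) * Q)"
  have "V \<ge> 0" using \<open>C \<ge> 0\<close> \<open>Q > 0\<close> R1 by (simp add: V_def)
  have ev: "eventually (\<lambda>t. t \<in> {0<..<a}) (at_right (0::real))" if "a > 0" for a
    by (rule eventually_at_right_real[OF that])
  have "eventually (\<lambda>t. t \<in> {0<..<t0} \<and> t \<in> {0<..<\<mu> / 4} \<and> t \<in> {0<..<1/2} \<and> t \<in> {0<..<s0 / 20} \<and> t \<in> {0<..<r / Gc}
      \<and> t \<in> {0<..<1 / Q} \<and> t \<in> {0<..<W / (V + 1)}) (at_right (0::real))"
    using ct \<mu> s0 KA \<open>Gc > 0\<close> \<open>Q > 0\<close> \<open>W > 0\<close> \<open>V \<ge> 0\<close> by (intro eventually_conj ev) auto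
  from eventually_happens'[OF trivial_limit_at_right_real this]
  obtain t where t: "0 < t" "t < t0" "t < \<mu> / 4" "t < 1/2" "t < s0 / 20" "t < r / Gc" "t < 1 / Q" "t < W / (V + 1)"
    by auto
  define \<rho> where "\<rho> = Q * t ^ n"
  have \<rho>: "0 < \<rho>" "\<rho> \<le> 1"
  proof -
    show "0 < \<rho>" using \<open>Q > 0\<close> t by (simp add: \<rho>_def)
    have "t ^ n \<le> t ^ 1" using t n(2) by (intro power_decreasing) auto
    then have "\<rho> \<le> Q * t" using \<open>Q > 0\<close> by (simp add: \<rho>_def)
    also have "\<dots> \<le> 1" using t(7) \<open>Q > 0\<close> by (simp add: field_simps)
    finally show "\<rho> \<le> 1" .
  qed
  define y0 where "y0 = E (0, \<mu>, 1)"
  define A where "A = ball y0 (c * t)"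
  \<comment> \<open>One thin side is enough: the height is of order \<open>t ^ n\<close>, the
    horizontal coordinates are bounded.\<close>
  define B where "B = {-C..C} \<times> ({-C..C} \<times> {-((1 + R) * \<rho>)..(1 + R) * \<rho>})"
  have eA: "emeasure lborel A = ennreal (W * t ^ 3)"
    using emeasure_ball[of "c * t" y0] ct(1) t(1) by (simp add: A_def W_def power3_eq_cube mult_ac)
  have eB: "emeasure lborel B = ennreal (V * t ^ n)"
  proof -
    have "0 \<le> (1 + R) * \<rho>" using R1 \<rho> by simp
    have Icc: "emeasure lborel {-x..x} = ennreal (2 * x)" if "0 \<le> x" for x :: real
      using that by simp
    have "emeasure lborel B = emeasure lborel {-C..C} * (emeasure lborel {-C..C} * emeasure lborel {-((1 + R) * \<rho>)..(1 + R) * \<rho>})"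
      unfolding B_def by (simp only: emeasure_lborel_Times borel_closed closed_Times closed_atLeastAtMost)
    also have "\<dots> = ennreal (2 * C) * (ennreal (2 * C) * ennreal (2 * ((1 + R) * \<rho>)))"
      by (simp only: Icc[OF \<open>C \<ge> 0\<close>] Icc[OF \<open>0 \<le> (1 + R) * \<rho>\<close>])
    also have "\<dots> = ennreal ((2 * C) * ((2 * C) * (2 * ((1 + R) * \<rho>))))"
    proof -
      have "0 \<le> 2 * C" using \<open>C \<ge> 0\<close> by simp
      then show ?thesis by (simp only: ennreal_mult'[symmetric])
    qed
    also have "(2 * C) * ((2 * C) * (2 * ((1 + R) * \<rho>))) = V * t ^ n" by (simp add: V_def \<rho>_def)
    finally show ?thesis .
  qed
  have mid: "P \<in> B" if y: "y \<in> A" and d1: "sF_dist N 0 P = t * sF_dist N 0 y" and d2: "sF_dist N P y = (1 - t) * sF_dist N 0 y" for y P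
  proof -
    have "y \<in> E ` cball (0, \<mu>, 1) t" using ct(3)[of t] t y by (auto simp: A_def y0_def)
    then obtain w where w: "w \<in> cball (0, \<mu>, 1) t" "y = E w" by blast
    obtain l m a where lma: "w = (l, m, a)" by (cases w)
    have "dist w (0, \<mu>, 1) \<le> t" using w(1) by (simp only: mem_cball dist_commute)
    then have nw: "norm (l, m - \<mu>, a - 1) \<le> t" by (simp add: lma dist_norm)
    have l: "\<bar>l\<bar> \<le> t" using norm_fst_le[of l "(m - \<mu>, a - 1)"] nw by simp
    have "norm (m - \<mu>, a - 1) \<le> t" using norm_snd_le[of "(m - \<mu>, a - 1)" l] nw by simp
    then have m: "\<bar>m - \<mu>\<bar> \<le> t" and a: "\<bar>a - 1\<bar> \<le> t"
      using norm_fst_le[of "m - \<mu>" "a - 1"] norm_snd_le[of "a - 1" "m - \<mu>"] by simp_all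
    have y: "y = endpt l m a" by (simp add: w(2) lma E_def)
    have adm: "\<bar>l'\<bar> + m' * (2 * R) < s0" "m' > 0" "m' \<ge> \<mu> / 2" "m' \<le> 2 * \<mu>"
      if "\<bar>l' - l\<bar> \<le> t" "\<bar>m' - m\<bar> \<le> t" for l' m'
    proof -
      show m': "m' > 0" "m' \<ge> \<mu> / 2" "m' \<le> 2 * \<mu>" using that m t(3) \<mu>(1) by linarith+
      have "m' * (2 * R) \<le> (2 * \<mu>) * (2 * R)" using m'(3) R1 by (intro mult_right_mono) auto
      also have "\<dots> = 4 * s0 / 10" using \<mu>(3) by (simp add: mult_ac)
      finally show "\<bar>l'\<bar> + m' * (2 * R) < s0" using that l t(5) s0 by linarith
    qed
    have lm: "\<bar>l\<bar> + m * (2 * R) < s0" "m > 0" using adm[of l m] t(1) by auto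
    have a': "0 < a" "a \<le> 2" using a t(4) by linarith+
    have "m * a \<le> m * (2 * R)" using lm(2) a' R1 by (intro mult_left_mono) auto
    then have lma': "\<bar>l\<bar> + m * a < s0" using lm by linarith
    define D where "D = sF_dist N 0 y"
    have D0: "D \<ge> 0" by (simp add: D_def sF_dist_nonneg)
    have DF: "D \<le> F l m y" using endpt_dist_le(1)[OF lm(2) a'(1) lma'] by (simp add: D_def y)
    have DR: "D < R"
    proof -
      have "D \<le> a * (N e + (k s0 - k (- s0)) * N v)" using endpt_dist_le(2)[OF lm(2) a'(1) lma'] by (simp add: D_def y)
      also have "\<dots> \<le> 2 * (N e + (k s0 - k (- s0)) * N v)" using a' k12 by (intro mult_right_mono) auto
      finally show ?thesis by (simp add: R_def)
    qed
    have tD: "t * D \<le> t * R" "t * R \<le> R" "(1 - t) * D < R" "t * D < R"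
    proof -
      show "t * D \<le> t * R" using DR t(1) by (intro mult_left_mono) auto
      show "t * R \<le> R" using t R1 by (simp add: mult_left_le_one_le)
      have "(1 - t) * D \<le> 1 * D" "t * D \<le> 1 * D" using t D0 by (intro mult_right_mono; simp)+
      then show "(1 - t) * D < R" "t * D < R" using DR by linarith+
    qed
    have X00: "Xc 0 = 0" "F l' m' 0 = 0" for l' m' by (simp_all add: F_def Xc_def Yc_def Zc_def)
    have XP: "\<bar>Xc P\<bar> \<le> t * R" using Xc_le_dist[of P 0] d1 tD(1) by (simp add: X00 D_def)
    have FP: "F l' m' P \<le> t * D" if "\<bar>l' - l\<bar> \<le> t" "\<bar>m' - m\<bar> \<le> t" for l' m'
      using F_le_dist[of 0 R P m' l'] adm[OF that] d1 tD R1 by (simp add: X00 D_def)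
    \<comment> \<open>By \<open>DF\<close> the calibration gains all of \<open>D\<close> from 0 to
      \<open>y\<close>; at most \<open>(1 - t) * D\<close> of it falls between \<open>P\<close> and
      \<open>y\<close>.\<close>
    have FP2: "t * D \<le> F l m P"
    proof -
      have "F l m y - F l m P \<le> (1 - t) * D"
        using F_le_dist[of P R y m l] XP tD lm d2 by (simp add: D_def)
      then show ?thesis using DF by (simp add: algebra_simps)
    qed
    have Kb: "\<bar>(K (l' + m' * Xc P) - K l') / m'\<bar> \<le> t * \<rho> / 2" if "\<bar>l' - l\<bar> \<le> t" "\<bar>m' - m\<bar> \<le> t" for l' m'
    proof -
      note am = adm[OF that]
      define \<kappa> where "\<kappa> = KA * (Gc * t) ^ Suc n"
      have Gr: "Gc * t < r" using t(6) \<open>Gc > 0\<close> by (simp add: pos_less_divide_eq mult.commute)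
      have l': "\<bar>l'\<bar> \<le> 2 * t" using that l by linarith
      have "\<bar>m' * Xc P\<bar> \<le> (2 * \<mu>) * (t * R)" using am XP by (simp add: abs_mult mult_mono)
      then have b1: "\<bar>l' + m' * Xc P\<bar> \<le> Gc * t" using l' by (simp add: Gc_def algebra_simps)
      have b2: "\<bar>l'\<bar> \<le> Gc * t"
      proof -
        have "2 * t \<le> Gc * t" using \<mu>(1) R1 t(1) by (intro mult_right_mono) (auto simp: Gc_def)
        then show ?thesis using l' by linarith
      qed
      have kb: "\<bar>K s\<bar> \<le> \<kappa>" if "\<bar>s\<bar> \<le> Gc * t" for s
      proof -
        have "\<bar>K s\<bar> \<le> KA * \<bar>s\<bar> ^ Suc n" using that Gr by (intro KA) linarith
        also have "\<dots> \<le> \<kappa>" unfolding \<kappa>_def using that KA(1) by (intro mult_left_mono power_mono) auto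
        finally show ?thesis .
      qed
      have "\<bar>K (l' + m' * Xc P) - K l'\<bar> \<le> 2 * \<kappa>" using kb[OF b1] kb[OF b2] by linarith
      then have "\<bar>K (l' + m' * Xc P) - K l'\<bar> / m' \<le> 2 * \<kappa> / (\<mu> / 2)"
        using am(3) \<mu>(1) by (intro frac_le) auto
      then have "\<bar>(K (l' + m' * Xc P) - K l') / m'\<bar> \<le> 2 * \<kappa> / (\<mu> / 2)"
        using am(2) by (simp only: abs_divide abs_of_pos)
      also have "\<dots> = t * \<rho> / 2" using \<mu>(1) by (simp add: \<kappa>_def \<rho>_def Q_def power_mult_distrib field_simps)
      finally show ?thesis .
    qed
    define Wf where "Wf l' m' = (K (l' + m' * Xc P) - K l') / m'" for l' m'
    have FW: "F l' m' P = Xc P - Wf l' m' + l' * Yc P + m' * Zc P" for l' m' by (simp add: F_def Wf_def)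
    have Wb: "\<bar>Wf l' m'\<bar> \<le> t * \<rho> / 2" if "\<bar>l' - l\<bar> \<le> t" "\<bar>m' - m\<bar> \<le> t" for l' m'
      unfolding Wf_def by (rule Kb[OF that])
    have YP: "\<bar>Yc P\<bar> \<le> \<rho>"
    proof -
      \<comment> \<open>The two inequalities at \<open>l + t\<close> and \<open>l - t\<close> bound
        \<open>t * Y\<close> from both sides by differences of two \<open>K\<close> terms, each at
        most \<open>t * \<rho> / 2\<close>.\<close>
      have "F (l + t) m P \<le> F l m P" "F (l - t) m P \<le> F l m P"
        using FP[of "l + t" m] FP[of "l - t" m] FP2 t(1) by auto
      then have "t * Yc P \<le> Wf (l + t) m - Wf l m" "- (t * Yc P) \<le> Wf (l - t) m - Wf l m"
        by (simp_all add: FW distrib_right left_diff_distrib)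
      moreover have "\<bar>Wf l m\<bar> \<le> t * \<rho> / 2" "\<bar>Wf (l + t) m\<bar> \<le> t * \<rho> / 2" "\<bar>Wf (l - t) m\<bar> \<le> t * \<rho> / 2"
        by (rule Wb; use t(1) in simp)+
      ultimately have "t * Yc P \<le> t * \<rho>" "- (t * Yc P) \<le> t * \<rho>" by linarith+
      then have "t * Yc P \<le> t * \<rho>" "t * (- Yc P) \<le> t * \<rho>" by simp_all
      then have "Yc P \<le> \<rho>" "- Yc P \<le> \<rho>" using t(1) by (simp_all only: mult_le_cancel_left_pos)
      then show ?thesis by (simp add: abs_le_iff)
    qed
    have ZP: "\<bar>Zc P\<bar> \<le> \<rho>"
    proof -
      have "F l (m + t) P \<le> F l m P" "F l (m - t) P \<le> F l m P"
        using FP[of l "m + t"] FP[of l "m - t"] FP2 t(1) by auto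
      then have "t * Zc P \<le> Wf l (m + t) - Wf l m" "- (t * Zc P) \<le> Wf l (m - t) - Wf l m"
        by (simp_all add: FW distrib_right left_diff_distrib)
      moreover have "\<bar>Wf l m\<bar> \<le> t * \<rho> / 2" "\<bar>Wf l (m + t)\<bar> \<le> t * \<rho> / 2" "\<bar>Wf l (m - t)\<bar> \<le> t * \<rho> / 2"
        by (rule Wb; use t(1) in simp)+
      ultimately have "t * Zc P \<le> t * \<rho>" "- (t * Zc P) \<le> t * \<rho>" by linarith+
      then have "t * Zc P \<le> t * \<rho>" "t * (- Zc P) \<le> t * \<rho>" by simp_all
      then have "Zc P \<le> \<rho>" "- Zc P \<le> \<rho>" using t(1) by (simp_all only: mult_le_cancel_left_pos)
      then show ?thesis by (simp add: abs_le_iff)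
    qed
    have XR: "\<bar>Xc P\<bar> \<le> R" using XP tD by linarith
    have vP: "\<bar>vpt P\<bar> \<le> (1 + R) * \<rho>"
    proof -
      have "\<bar>Xc P * Yc P\<bar> \<le> R * \<rho>" using XR YP R1 \<rho> by (simp add: abs_mult mult_mono)
      moreover have "vpt P = Zc P - Xc P * Yc P / 2" by (simp add: Zc_def)
      moreover have "\<bar>z - xy / 2\<bar> \<le> \<rho> + R * \<rho>" if "\<bar>z\<bar> \<le> \<rho>" "\<bar>xy\<bar> \<le> R * \<rho>" for z xy using that by linarith
      ultimately have "\<bar>vpt P\<bar> \<le> \<rho> + R * \<rho>" using ZP by presburger
      then show ?thesis by (simp add: distrib_right)
    qed
    have hP: "norm (hpt P) \<le> C"
    proof -
      have dec: "hpt P = Xc P *\<^sub>R e + Yc P *\<^sub>R v"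
      proof -
        define d where "d = hpt P - (Xc P *\<^sub>R e + Yc P *\<^sub>R v)"
        have "p \<bullet> d = 0" "q \<bullet> d = 0"
          by (simp_all add: d_def inner_diff_right inner_add_right pe pv qe qv Xc_def Yc_def)
        then have "cross2 p q * cross2 d (jrot d) = 0" by (subst lagrange_cross2) simp
        then have "d = 0" by (simp add: cross2_pq jrot_props)
        then show ?thesis by (simp add: d_def)
      qed
      have "norm (hpt P) \<le> \<bar>Xc P\<bar> * norm e + \<bar>Yc P\<bar> * norm v"
        by (subst dec) (metis norm_scaleR norm_triangle_ineq)
      also have "\<dots> \<le> R * norm e + 1 * norm v" using XR YP \<rho> by (intro add_mono mult_right_mono) auto
      finally show ?thesis by (simp add: C_def)
    qed
    have "\<bar>fst (hpt P)\<bar> \<le> C" "\<bar>snd (hpt P)\<bar> \<le> C"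
      using hP norm_fst_le[of "fst (hpt P)" "snd (hpt P)"] norm_snd_le[of "snd (hpt P)" "fst (hpt P)"] by simp_all
    then show "P \<in> B" using vP by (cases P) (auto simp: B_def hpt_def vpt_def)
  qed
  have "ennreal (t powr Nn) \<le> emeasure lborel B / emeasure lborel A"
  proof (rule MCP_bound[OF MCP assms zero_in_msupport])
    show "A \<in> sets lborel" by (simp add: A_def)
    show "0 < emeasure lborel A" "emeasure lborel A < \<infinity>" using \<open>W > 0\<close> t(1) by (simp_all add: eA)
    show "B \<in> sets lborel" unfolding B_def sets_lborel by (intro borel_closed closed_Times closed_atLeastAtMost)
  qed (use t mid in auto)
  also have "\<dots> = ennreal (V * t ^ n / (W * t ^ 3))"
    using \<open>W > 0\<close> \<open>V \<ge> 0\<close> t(1) by (simp add: eA eB divide_ennreal)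
  finally have "t powr Nn \<le> V * t ^ n / (W * t ^ 3)"
    using \<open>W > 0\<close> \<open>V \<ge> 0\<close> t(1) by (subst (asm) ennreal_le_iff) auto
  then have "t powr Nn * (W * t ^ 3) \<le> V * t ^ n"
    using \<open>W > 0\<close> t(1) by (simp add: field_simps)
  moreover have "t powr real (n - 1) \<le> t powr (Nn + 3)" using t n(1) by (intro powr_mono') auto
  then have "t ^ (n - 1) \<le> t powr Nn * t ^ 3"
    using t(1) by (simp add: powr_add powr_realpow powr_numeral)
  then have "W * t ^ (n - 1) \<le> t powr Nn * (W * t ^ 3)" using \<open>W > 0\<close> by (simp add: mult_ac)
  moreover have "t ^ n = t * t ^ (n - 1)" using n(2) by (cases n) auto
  ultimately have "W * t ^ (n - 1) \<le> (V * t) * t ^ (n - 1)" by (simp add: mult_ac)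
  then have "W \<le> V * t" using t(1) by simp
  moreover have "t * (V + 1) < W" using t(8) \<open>V \<ge> 0\<close> by (simp add: pos_less_divide_eq)
  ultimately show False using t(1) by (simp add: algebra_simps)
qed

end

theorem theorem5p4:
  fixes Nrm :: "real \<times> real \<Rightarrow> real"
  assumes "is_norm2 Nrm" and "C1_norm Nrm" and "strongly_convex_norm Nrm"
    and "\<exists>\<phi>s\<in>Zset Nrm. \<forall>\<alpha>::real. \<alpha> \<ge> 2 \<longrightarrow>
           (\<lambda>\<phi>. deriv (Ccirc Nrm) \<phi>) \<in> o[at \<phi>s within D1 Nrm](\<lambda>\<phi>. \<bar>\<phi> - \<phi>s\<bar> powr (\<alpha> - 2))"
  shows "\<forall>N::real. 1 < N \<longrightarrow> \<not> MCP (sF_dist Nrm) (lborel :: (real \<times> real \<times> real) measure) 0 N"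
proof -
  interpret plane_norm Nrm by unfold_locales (rule assms(1))
  interpret sc_norm Nrm
    by (intro sc_norm.intro plane_norm_axioms plane_norm_dual sc_norm_axioms.intro assms)
  obtain \<phi>s where \<phi>s: "\<forall>\<alpha>::real. \<alpha> \<ge> 2 \<longrightarrow>
           (\<lambda>\<phi>. deriv (Ccirc Nrm) \<phi>) \<in> o[at \<phi>s within D1 Nrm](\<lambda>\<phi>. \<bar>\<phi> - \<phi>s\<bar> powr (\<alpha> - 2))"
    using assms(4) by (elim bexE)
  obtain e v p q s0 H k K where "flat_frame Nrm e v p q s0 H k K"
    using ex_flat_frame[OF g_flat[OF \<phi>s]] by (elim exE)
  then interpret flat_frame Nrm e v p q s0 H k K .
  show ?thesis using not_MCP by blast
qed

end
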